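(* Let $\varphi:\mathbb{R}_+\to\mathbb{R}$ with $\varphi(0)>0$ satisfy the bounded-derivative hypothesis with constants $\rho_+>0$ and $\rho_->0$ (stated in the context). Let $\tau_\varphi=\inf\{t>0:B_t=\varphi(t)\}$, where $B$ is a standard one-dimensional Brownian motion, and let $\tau_\varphi^K=\tau_\varphi\wedge K$. Let $\tau_\varphi^{\epsilon,K}$ and $\mathcal{N}_{\epsilon,K}$ be the outcome of Algorithm 2 (described in the context) with parameters $\epsilon$, $K$ and $r$. 1. If $\varphi$ satisfies the bounded-derivative hypothesis, then the random variable $\tau_\varphi^{\epsilon,K}$ converges in distribution towards $\tau_\varphi^K$ as $\epsilon$ tends to zero. More precisely, $$F_{\epsilon,K}(t-\epsilon)-(1+\rho_+)\sqrt{\frac{2\epsilon}{\pi}}\le F_K(t)\le F_{\epsilon,K}(t),\quad\text{for any } t\ge\epsilon,$$ where $F_K$ (resp. $F_{\epsilon,K}$) is the cumulative distribution function of $\tau_\varphi^K$ (resp. $\tau_\varphi^{\epsilon,K}$). 2. There exist positive constants $a$, $b$, $\kappa_0$, $\kappa_1$ and $\epsilon_0$ such that: for any $\rho_+\le\kappa_0$ and any $(K,r)$ satisfying $(r+\kappa_0)K\le\kappa_1$, the random number of iterations $\mathcal{N}_{\epsilon,K}$ satisfies $$\mathbb{E}[\mathcal{N}_{\epsilon,K}]\le(a+br)|\log\epsilon|,\quad\forall\,\epsilon\le\epsilon_0.$$ 3. For non-increasing functions $\varphi$: there exist two positive constants $a$ and $\epsilon_0$ such that $$\mathbb{E}[\mathcal{N}_{\epsilon,K}]\le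 a\,r^2K|\log\epsilon|,\quad\forall\,\epsilon\le\epsilon_0.$$
   Context: Bounded-derivative hypothesis: there exist two constants $\rho_+>0$ and $\rho_->0$ such that $\varphi:\mathbb{R}_+\to\mathbb{R}$ is a $\mathcal{C}^1$ function satisfying $\sup_{t\ge 0}\varphi'(t)\le\rho_+$ and $\inf_{t\ge 0}\varphi'(t)\ge-\rho_-$. For $\mu>0$ and $\lambda>0$, the inverse Gaussian distribution $I(\mu,\lambda)$ is the law with density $$f(x)=\sqrt{\frac{\lambda}{2\pi x^3}}\exp\Big\{-\frac{\lambda(x-\mu)^2}{2\mu^2x}\Big\}\mathbf{1}_{\{x\ge 0\}}.$$ Algorithm 2. Let $\epsilon>0$ be a small parameter, $K>0$ a truncation time, and $r>\rho_-$. Initialization: $(T,H)=(0,\varphi(0))$ and $\mathcal{N}_{\epsilon,K}=0$. While $H>\epsilon$ and $T<K$: simulate an inverse Gaussian random variable $\hat G$ with distribution $I(H/r,H^2)$ (using the current value of $H$; conditionally on the past of the algorithm), and do, in this order, $H\leftarrow\varphi(T+\hat G)-\varphi(T)+r\hat G$, then $T\leftarrow\hat G+T$, then $\mathcal{N}_{\epsilon,K}\leftarrow\mathcal{N}_{\epsilon,K}+1$. Outcome: $\tau_\varphi^{\epsilon,K}:=T\wedge K$ and $\mathcal{N}_{\epsilon,K}$, the number of iterations performed. *)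

theory Defs
  imports "HOL-Probability.Probability" "HOL-Real_Asymp.Real_Asymp"
begin

section \<open>Boundary, Brownian motion, first-passage time\<close>

text \<open>A boundary on the half line is a function \<open>\<phi> :: real \<Rightarrow> real\<close> whose values at negative
  arguments are irrelevant; the derivative at \<open>0\<close> is one-sided.\<close>

definition bounded_derivative :: "(real \<Rightarrow> real) \<Rightarrow> real \<Rightarrow> real \<Rightarrow> bool" where
  "bounded_derivative \<phi> \<rho>p \<rho>m \<longleftrightarrow> 0 < \<rho>p \<and> 0 < \<rho>m \<and>
     (\<exists>\<phi>'. (\<forall>t\<ge>0. (\<phi> has_real_derivative \<phi>' t) (at t within {0..})) \<and>
           continuous_on {0..} \<phi>' \<and>
           (SUP t\<in>{0..}. ereal (\<phi>' t)) \<le> ereal \<rho>p \<and>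
           (INF t\<in>{0..}. ereal (\<phi>' t)) \<ge> ereal (- \<rho>m))"

locale standard_brownian_motion = prob_space M
  for M :: "'a measure" and B :: "real \<Rightarrow> 'a \<Rightarrow> real" +
  assumes random_variable: "\<And>t. 0 \<le> t \<Longrightarrow> B t \<in> borel_measurable M"
    and start: "AE \<omega> in M. B 0 \<omega> = 0"
    and increment: "\<And>s t. 0 \<le> s \<Longrightarrow> s < t \<Longrightarrow>
      distributed M lborel (\<lambda>\<omega>. B t \<omega> - B s \<omega>) (normal_density 0 (sqrt (t - s)))"
    and indep_increments: "\<And>(t :: nat \<Rightarrow> real) n. 0 \<le> t 0 \<Longrightarrow> (\<And>i. i < n \<Longrightarrow> t i \<le> t (Suc i)) \<Longrightarrow>
      indep_vars (\<lambda>_. borel) (\<lambda>i \<omega>. B (t (Suc i)) \<omega> - B (t i) \<omega>) {..<n}"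
    and paths: "\<And>\<omega>. \<omega> \<in> space M \<Longrightarrow> continuous_on {0..} (\<lambda>t. B t \<omega>)"

text \<open>The value is \<open>\<infinity>\<close> on paths that never hit the boundary.\<close>

definition first_passage_time :: "(real \<Rightarrow> 'a \<Rightarrow> real) \<Rightarrow> (real \<Rightarrow> real) \<Rightarrow> 'a \<Rightarrow> ereal" where
  "first_passage_time B \<phi> \<omega> = Inf {ereal t | t. 0 < t \<and> B t \<omega> = \<phi> t}"

definition truncated_passage_time ::
    "(real \<Rightarrow> 'a \<Rightarrow> real) \<Rightarrow> (real \<Rightarrow> real) \<Rightarrow> real \<Rightarrow> 'a \<Rightarrow> real" where
  "truncated_passage_time B \<phi> K \<omega> = real_of_ereal (min (first_passage_time B \<phi> \<omega>) (ereal K))"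

definition passage_law ::
    "'a measure \<Rightarrow> (real \<Rightarrow> 'a \<Rightarrow> real) \<Rightarrow> (real \<Rightarrow> real) \<Rightarrow> real \<Rightarrow> real measure" where
  "passage_law M B \<phi> K = distr M borel (truncated_passage_time B \<phi> K)"


section \<open>Inverse Gaussian distribution\<close>

definition inverse_gaussian_density :: "real \<Rightarrow> real \<Rightarrow> real \<Rightarrow> real" where
  "inverse_gaussian_density \<mu> l x =
     sqrt (l / (2 * pi * x ^ 3)) * exp (- (l * (x - \<mu>)\<^sup>2 / (2 * \<mu>\<^sup>2 * x))) * indicator {0..} x"

definition inverse_gaussian :: "real \<Rightarrow> real \<Rightarrow> real measure" where
  "inverse_gaussian \<mu> l = density lborel (\<lambda>x. ennreal (inverse_gaussian_density \<mu> l x))"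


section \<open>The algorithm\<close>

text \<open>The state is the pair \<open>(T, H)\<close>.\<close>

definition running :: "real \<Rightarrow> real \<Rightarrow> real \<times> real \<Rightarrow> bool" where
  "running \<epsilon> K s \<longleftrightarrow> snd s > \<epsilon> \<and> fst s < K"

text \<open>Effect of one iteration with simulated value \<open>g\<close>.  The clamping \<open>max 0\<close> restricts \<open>\<phi>\<close> to the
  half line: all times that occur are almost surely nonnegative, but the transition kernel below
  has to be measurable on all of \<open>real \<times> real\<close>.\<close>

definition update :: "(real \<Rightarrow> real) \<Rightarrow> real \<Rightarrow> real \<times> real \<Rightarrow> real \<Rightarrow> real \<times> real" where
  "update \<phi> r s g =
     (g + fst s, \<phi> (max 0 (fst s + g)) - \<phi> (max 0 (fst s)) + r * g)"

text \<open>Conditional law of the next state given the current one; the state is frozen once the loop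
  condition fails.\<close>

definition step_kernel ::
    "(real \<Rightarrow> real) \<Rightarrow> real \<Rightarrow> real \<Rightarrow> real \<Rightarrow> real \<times> real \<Rightarrow> (real \<times> real) measure" where
  "step_kernel \<phi> \<epsilon> K r s =
     (if running \<epsilon> K s
      then distr (inverse_gaussian (snd s / r) ((snd s)\<^sup>2)) borel (update \<phi> r s)
      else return borel s)"

definition history_kernel ::
    "(real \<Rightarrow> real) \<Rightarrow> real \<Rightarrow> real \<Rightarrow> real \<Rightarrow> nat \<Rightarrow> (nat \<Rightarrow> real \<times> real) \<Rightarrow> (real \<times> real) measure" where
  "history_kernel \<phi> \<epsilon> K r n x =
     (case n of 0 \<Rightarrow> return borel (0, \<phi> 0) | Suc m \<Rightarrow> step_kernel \<phi> \<epsilon> K r (x m))"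

text \<open>Law of the whole sequence of states (Ionescu-Tulcea extension); lemma
  \<open>Ionescu_Tulcea_history_kernel\<close> below shows that the construction applies.\<close>

definition trajectory_law ::
    "(real \<Rightarrow> real) \<Rightarrow> real \<Rightarrow> real \<Rightarrow> real \<Rightarrow> (nat \<Rightarrow> real \<times> real) measure" where
  "trajectory_law \<phi> \<epsilon> K r =
     projective_family.lim UNIV
       (Ionescu_Tulcea.CI (history_kernel \<phi> \<epsilon> K r) (\<lambda>_. borel)) (\<lambda>_. borel)"

text \<open>The number of iterations is \<open>\<infinity>\<close> if the loop does not terminate.\<close>

definition iterations :: "real \<Rightarrow> real \<Rightarrow> (nat \<Rightarrow> real \<times> real) \<Rightarrow> enat" where
  "iterations \<epsilon> K x = Inf {enat n | n. \<not> running \<epsilon> K (x n)}"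

definition outcome_time :: "real \<Rightarrow> real \<Rightarrow> (nat \<Rightarrow> real \<times> real) \<Rightarrow> real" where
  "outcome_time \<epsilon> K x = (case iterations \<epsilon> K x of enat n \<Rightarrow> min (fst (x n)) K | \<infinity> \<Rightarrow> K)"

definition outcome_law :: "(real \<Rightarrow> real) \<Rightarrow> real \<Rightarrow> real \<Rightarrow> real \<Rightarrow> real measure" where
  "outcome_law \<phi> \<epsilon> K r = distr (trajectory_law \<phi> \<epsilon> K r) borel (outcome_time \<epsilon> K)"

definition expected_iterations :: "(real \<Rightarrow> real) \<Rightarrow> real \<Rightarrow> real \<Rightarrow> real \<Rightarrow> ennreal" where
  "expected_iterations \<phi> \<epsilon> K r =
     (\<integral>\<^sup>+x. ennreal_of_enat (iterations \<epsilon> K x) \<partial>trajectory_law \<phi> \<epsilon> K r)"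


section \<open>Well-formedness of the construction\<close>


lemma DERIV_cdf_std_normal:
  "((cdf (density lborel std_normal_density)) has_real_derivative std_normal_density x) (at x)"
proof -
  let ?N = "density lborel std_normal_density"
  interpret real_distribution ?N by (rule real_dist_normal_dist)
  have cont: "continuous_on A std_normal_density" for A :: "real set"
    unfolding normal_density_def by (intro continuous_intros) auto
  have eq: "cdf ?N y = cdf ?N (x - 1) + integral {x - 1..y} std_normal_density"
    if "y \<in> {x - 1<..<x + 1}" for y
  proof -
    have si: "set_integrable lborel {x - 1..y} std_normal_density"
      by (rule borel_integrable_atLeastAtMost') (rule cont)
    have "cdf ?N y - cdf ?N (x - 1) = measure ?N {x - 1<..y}"
      using that by (intro cdf_diff_eq) auto
    also have "\<dots> = measure ?N {x - 1..y}"
    proof -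
      have "AE t in lborel. t \<noteq> x - 1" by (rule AE_lborel_singleton)
      then have "AE t in ?N. t \<noteq> x - 1" by (subst AE_density) (auto elim!: eventually_mono)
      then show ?thesis
        by (intro measure_eq_AE) auto
    qed
    also have "\<dots> = (LINT t:{x - 1..y}|lborel. std_normal_density t)"
      using si unfolding measure_def
      by (subst emeasure_density)
         (auto simp: set_lebesgue_integral_def set_integrable_def integral_eq_nn_integral mult.commute
            ennreal_mult'' ennreal_indicator intro!: arg_cong[where f=enn2real] nn_integral_cong)
    also have "\<dots> = integral {x - 1..y} std_normal_density"
      by (rule set_borel_integral_eq_integral(2)[OF si])
    finally show ?thesis by simp
  qed
  have "((\<lambda>y. integral {x - 1..y} std_normal_density) has_real_derivative std_normal_density x)
      (at x within {x - 1..x + 1})"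
    by (rule integral_has_real_derivative) (auto intro: cont)
  then have "((\<lambda>y. integral {x - 1..y} std_normal_density) has_real_derivative std_normal_density x)
      (at x)"
    by (simp add: at_within_Icc_at)
  then have "((\<lambda>y. cdf ?N (x - 1) + integral {x - 1..y} std_normal_density)
      has_real_derivative std_normal_density x) (at x)"
    by (auto intro!: derivative_eq_intros)
  then show ?thesis
    by (rule has_field_derivative_transform_within_open[where S="{x - 1<..<x + 1}"])
       (auto simp: eq)
qed

lemma inverse_gaussian_density_nonneg: "0 \<le> l \<Longrightarrow> 0 \<le> inverse_gaussian_density \<mu> l x"
  by (auto simp: inverse_gaussian_density_def indicator_def)

lemma prob_space_inverse_gaussian:
  assumes \<mu>: "0 < \<mu>" and l: "0 < l"
  shows "prob_space (inverse_gaussian \<mu> l)"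
proof -
  let ?P = "cdf (density lborel std_normal_density)"
  interpret N: real_distribution "density lborel std_normal_density" by (rule real_dist_normal_dist)
  let ?f = "inverse_gaussian_density \<mu> l"
  define s where "s = sqrt l"
  define u where "u x = s * (sqrt x / \<mu> - 1 / sqrt x)" for x
  define v where "v x = - (s * (sqrt x / \<mu> + 1 / sqrt x))" for x
  define F where "F x = ?P (u x) + exp (2 * l / \<mu>) * ?P (v x)" for x
  have s: "s > 0" "s\<^sup>2 = l" using l by (auto simp: s_def)
  have du: "(u has_real_derivative s * (1 / (2 * sqrt x * \<mu>) + 1 / (2 * x * sqrt x))) (at x)" if "x > 0" for x
    unfolding u_def using that \<mu> by (auto intro!: derivative_eq_intros simp: field_simps)
  have dv: "(v has_real_derivative - (s * (1 / (2 * sqrt x * \<mu>) - 1 / (2 * x * sqrt x)))) (at x)" if "x > 0" for x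
    unfolding v_def using that \<mu> by (auto intro!: derivative_eq_intros simp: field_simps)
  have uq: "(u x)\<^sup>2 = l * (x - \<mu>)\<^sup>2 / (\<mu>\<^sup>2 * x)" if "x > 0" for x
  proof -
    have "u x = s * (x - \<mu>) / (\<mu> * sqrt x)"
      using that \<mu> by (simp add: u_def field_simps)
    then show ?thesis using that s by (simp add: power_divide power_mult_distrib)
  qed
  have vq: "(v x)\<^sup>2 = l * (x + \<mu>)\<^sup>2 / (\<mu>\<^sup>2 * x)" if "x > 0" for x
  proof -
    have "v x = - (s * (x + \<mu>) / (\<mu> * sqrt x))"
      using that \<mu> by (simp add: v_def field_simps)
    then show ?thesis using that s by (simp add: power_divide power_mult_distrib)
  qed
  have vu: "exp (2 * l / \<mu>) * std_normal_density (v x) = std_normal_density (u x)" if "x > 0" for x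
  proof -
    have "(v x)\<^sup>2 = (u x)\<^sup>2 + 4 * l / \<mu>"
      unfolding uq[OF that] vq[OF that] using that \<mu> by (simp add: field_simps power2_eq_square)
    then have "2 * l / \<mu> - (v x)\<^sup>2 / 2 = - (u x)\<^sup>2 / 2"
      by (simp add: field_simps)
    then have "exp (2 * l / \<mu>) * exp (- (v x)\<^sup>2 / 2) = exp (- (u x)\<^sup>2 / 2)"
      by (simp add: exp_add[symmetric])
    then show ?thesis by (simp add: std_normal_density_def)
  qed
  have fx: "?f x = std_normal_density (u x) * (s / (x * sqrt x))" if "x > 0" for x
  proof -
    have "sqrt (l / (2 * pi * x ^ 3)) = s / (sqrt (2 * pi) * (x * sqrt x))"
      using that by (simp add: s_def real_sqrt_divide real_sqrt_mult power3_eq_cube)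
    moreover have "l * (x - \<mu>)\<^sup>2 / (2 * \<mu>\<^sup>2 * x) = (u x)\<^sup>2 / 2"
      unfolding uq[OF that] by simp
    ultimately show ?thesis
      using that by (simp add: inverse_gaussian_density_def std_normal_density_def)
  qed
  have dF: "DERIV F x :> ?f x" if x: "x > 0" for x
  proof -
    let ?du = "s * (1 / (2 * sqrt x * \<mu>) + 1 / (2 * x * sqrt x))"
    let ?dv = "- (s * (1 / (2 * sqrt x * \<mu>) - 1 / (2 * x * sqrt x)))"
    have "DERIV F x :> std_normal_density (u x) * ?du
        + exp (2 * l / \<mu>) * (std_normal_density (v x) * ?dv)"
      unfolding F_def
      by (intro DERIV_add DERIV_cmult DERIV_chain2[OF DERIV_cdf_std_normal] du dv x)
    also have "exp (2 * l / \<mu>) * (std_normal_density (v x) * ?dv) = std_normal_density (u x) * ?dv"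
      by (simp only: mult.assoc[symmetric] vu[OF x])
    also have "std_normal_density (u x) * ?du + std_normal_density (u x) * ?dv
        = std_normal_density (u x) * (?du + ?dv)" by (rule distrib_left[symmetric])
    also have "?du + ?dv = s / (x * sqrt x)"
      using x by (simp add: field_simps)
    finally show ?thesis using fx[OF x] by simp
  qed
  have cont: "isCont ?f x" if x: "x > 0" for x
  proof -
    have "continuous (at x) (\<lambda>x. sqrt (l / (2 * pi * x ^ 3)) * exp (- (l * (x - \<mu>)\<^sup>2 / (2 * \<mu>\<^sup>2 * x))))"
      using x \<mu> by (intro continuous_intros) auto
    moreover have "\<forall>\<^sub>F y in nhds x. y > 0"
      using x by (rule eventually_nhds_in_open[of "{0<..}", simplified, rotated]) auto
    then have "\<forall>\<^sub>F y in nhds x. sqrt (l / (2 * pi * y ^ 3)) * exp (- (l * (y - \<mu>)\<^sup>2 / (2 * \<mu>\<^sup>2 * y))) = ?f y"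
      by eventually_elim (simp add: inverse_gaussian_density_def)
    ultimately show ?thesis using isCont_cong by fast
  qed
  have "filterlim u at_bot (at_right 0)" "filterlim v at_bot (at_right 0)"
    "filterlim u at_top at_top" "filterlim v at_bot at_top"
    unfolding u_def v_def using s \<mu> by real_asymp+
  note L = this
  have "(F \<longlongrightarrow> 0 + exp (2 * l / \<mu>) * 0) (at_right 0)" "(F \<longlongrightarrow> 1 + exp (2 * l / \<mu>) * 0) at_top"
    unfolding F_def
    by (intro tendsto_intros filterlim_compose[OF N.cdf_lim_at_bot] filterlim_compose[OF N.cdf_lim_at_top_prob] L)+
  then have "((F \<circ> real_of_ereal) \<longlongrightarrow> 0) (at_right 0)" "((F \<circ> real_of_ereal) \<longlongrightarrow> 1) (at_left \<infinity>)"
    by (simp_all add: ereal_tendsto_simps zero_ereal_def del: ereal_eq_0)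
  note lim = this
  note FTC = interval_integral_FTC_nonneg[of 0 \<infinity> F ?f 0 1, OF _ _ _ _ lim]
  have "set_integrable lborel (einterval 0 \<infinity>) ?f" "(LBINT x=0..\<infinity>. ?f x) = 1 - 0"
    using l by (intro FTC; auto simp: dF cont inverse_gaussian_density_nonneg zero_ereal_def)+
  then have "set_integrable lborel {0<..} ?f" "(LINT x:{0<..}|lborel. ?f x) = 1"
    by (auto simp: interval_lebesgue_integral_def einterval_def zero_ereal_def greaterThan_def)
  then have int: "integrable lborel (\<lambda>x. indicator {0<..} x * ?f x)" "(\<integral>x. indicator {0<..} x * ?f x \<partial>lborel) = 1"
    by (auto simp: set_integrable_def set_lebesgue_integral_def)
  have "(\<lambda>x. indicator {0<..} x * ?f x) = ?f"
    by (rule ext) (auto simp: inverse_gaussian_density_def indicator_def)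
  then have "integrable lborel ?f" "(\<integral>x. ?f x \<partial>lborel) = 1" using int by auto
  then have "(\<integral>\<^sup>+x. ?f x \<partial>lborel) = 1"
    using l by (simp add: nn_integral_eq_integral inverse_gaussian_density_nonneg)
  moreover have "?f \<in> borel_measurable borel" 
    unfolding inverse_gaussian_density_def by measurable
  ultimately show ?thesis
    by (intro prob_spaceI) (simp add: inverse_gaussian_def emeasure_density)
qed

lemma borel_measurable_inverse_gaussian_density [measurable]:
  assumes [measurable]: "f \<in> borel_measurable M" "g \<in> borel_measurable M" "h \<in> borel_measurable M"
  shows "(\<lambda>x. inverse_gaussian_density (f x) (g x) (h x)) \<in> borel_measurable M"
  unfolding inverse_gaussian_density_def by measurable

lemma space_inverse_gaussian [simp]: "space (inverse_gaussian \<mu> l) = UNIV"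
  and sets_inverse_gaussian [simp, measurable_cong]: "sets (inverse_gaussian \<mu> l) = sets borel"
  by (simp_all add: inverse_gaussian_def)

lemma measurable_update:
  assumes "continuous_on {0..} \<phi>"
  shows "(\<lambda>z. update \<phi> r (fst z) (snd z)) \<in> borel_measurable borel"
proof -
  have "continuous_on UNIV (\<lambda>x :: real. \<phi> (max 0 x))"
    by (rule continuous_on_compose2[OF assms]) (auto intro!: continuous_intros)
  then have [measurable]: "(\<lambda>x. \<phi> (max 0 x)) \<in> borel_measurable borel"
    by (rule borel_measurable_continuous_onI)
  have "(\<lambda>z. update \<phi> r (fst z) (snd z)) \<in> borel_measurable ((borel \<Otimes>\<^sub>M borel) \<Otimes>\<^sub>M borel)"
    unfolding update_def by measurable
  then show ?thesis by (simp add: borel_prod)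
qed

lemma prob_space_step_kernel:
  assumes "0 < \<epsilon>" "0 < r" "continuous_on {0..} \<phi>"
  shows "prob_space (step_kernel \<phi> \<epsilon> K r s)"
proof (cases "running \<epsilon> K s")
  case True
  then have "0 < snd s" using assms(1) by (simp add: running_def)
  then interpret prob_space "inverse_gaussian (snd s / r) ((snd s)\<^sup>2)"
    using assms(2) by (intro prob_space_inverse_gaussian) auto
  have "update \<phi> r s \<in> borel_measurable borel"
    using measurable_compose[OF _ measurable_update[OF assms(3)], of "\<lambda>g. (s, g)"] by simp
  then show ?thesis using True
    by (simp add: step_kernel_def) (intro prob_space_distr, simp)
next
  case False
  then show ?thesis by (simp add: step_kernel_def prob_space_return)
qed

lemma measurable_step_kernel:
  assumes "0 < \<epsilon>" "0 < r" "continuous_on {0..} \<phi>"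
  shows "step_kernel \<phi> \<epsilon> K r \<in> measurable borel (subprob_algebra borel)"
proof (rule measurable_subprob_algebra)
  fix s :: "real \<times> real"
  show "subprob_space (step_kernel \<phi> \<epsilon> K r s)"
    by (rule prob_space_imp_subprob_space[OF prob_space_step_kernel[OF assms]])
  show "sets (step_kernel \<phi> \<epsilon> K r s) = sets borel"
    by (simp add: step_kernel_def)
next
  fix A :: "(real \<times> real) set" assume A [measurable]: "A \<in> sets borel"
  have up: "(\<lambda>z. update \<phi> r (fst z) (snd z)) \<in> borel_measurable (borel \<Otimes>\<^sub>M lborel)"
    using measurable_update[OF assms(3)]
    by (simp add: measurable_cong_sets[OF sets_pair_measure_cong[OF refl sets_lborel] refl] borel_prod)
  have [measurable]: "update \<phi> r s \<in> borel_measurable borel" for s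
    using measurable_compose[OF _ measurable_update[OF assms(3)], of "\<lambda>g. (s, g)"] by simp
  have [measurable]: "Measurable.pred borel (running \<epsilon> K)"
    unfolding running_def borel_prod[symmetric] by measurable
  let ?d = "\<lambda>s x. ennreal (inverse_gaussian_density (snd s / r) ((snd s)\<^sup>2) x)"
  have "emeasure (step_kernel \<phi> \<epsilon> K r s) A =
      (if running \<epsilon> K s then \<integral>\<^sup>+x. ?d s x * indicator A (update \<phi> r s x) \<partial>lborel else indicator A s)" for s
    using measurable_sets_borel[of "update \<phi> r s" borel A]
    by (auto simp: step_kernel_def emeasure_distr inverse_gaussian_def emeasure_density
        intro!: nn_integral_cong split: split_indicator)
  moreover have "(\<lambda>s. \<integral>\<^sup>+x. ?d s x * indicator A (update \<phi> r s x) \<partial>lborel) \<in> borel_measurable borel"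
  proof (rule lborel.borel_measurable_nn_integral)
    have [measurable]: "snd \<in> borel_measurable (borel :: (real \<times> real) measure)"
      unfolding borel_prod[symmetric] by measurable
    have [measurable]: "(\<lambda>z. indicator A (update \<phi> r (fst z) (snd z)) :: ennreal)
        \<in> borel_measurable (borel \<Otimes>\<^sub>M lborel)"
      by (rule measurable_compose[OF up]) simp
    have "(\<lambda>z. ?d (fst z) (snd z) * indicator A (update \<phi> r (fst z) (snd z)))
        \<in> borel_measurable (borel \<Otimes>\<^sub>M lborel)"
      by measurable
    then show "(\<lambda>(s, x). ?d s x * indicator A (update \<phi> r s x)) \<in> borel_measurable (borel \<Otimes>\<^sub>M lborel)"
      by (simp add: case_prod_beta')
  qed
  ultimately show "(\<lambda>s. emeasure (step_kernel \<phi> \<epsilon> K r s) A) \<in> borel_measurable borel"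
    by simp
qed

lemma Ionescu_Tulcea_history_kernel:
  assumes "0 < \<epsilon>" "0 < r" "continuous_on {0..} \<phi>"
  shows "Ionescu_Tulcea (history_kernel \<phi> \<epsilon> K r) (\<lambda>_. borel)"
proof (rule Ionescu_Tulcea.intro)
  fix n
  show "history_kernel \<phi> \<epsilon> K r n \<in> measurable (Pi\<^sub>M {0..<n} (\<lambda>_. borel)) (subprob_algebra borel)"
  proof (cases n)
    case 0
    have "(return borel (0, \<phi> 0) :: (real \<times> real) measure) \<in> space (subprob_algebra borel)"
      by (simp add: space_subprob_algebra prob_space_imp_subprob_space prob_space_return)
    then show ?thesis by (simp add: history_kernel_def[abs_def] 0)
  next
    case (Suc m)
    then show ?thesis
      unfolding history_kernel_def[abs_def]
      by (auto intro!: measurable_compose[OF _ measurable_step_kernel[OF assms]] measurable_component_singleton)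
  qed
next
  fix n :: nat and x :: "nat \<Rightarrow> real \<times> real"
  assume "x \<in> space (Pi\<^sub>M {0..<n} (\<lambda>_. borel :: (real \<times> real) measure))"
  show "prob_space (history_kernel \<phi> \<epsilon> K r n x)"
    by (cases n) (auto simp: history_kernel_def prob_space_return prob_space_step_kernel[OF assms])
qed

end

theory Submission
  imports Defs
begin

text \<open>Write \<open>Q(T, H)\<close> for the probability that Brownian motion, started at time \<open>T\<close> at distance \<open>H\<close> below
  the boundary, hits it by time \<open>t\<close>.  Since \<open>r\<close> exceeds \<open>\<rho>m\<close>, the line of slope \<open>- r\<close> through the current
  boundary point is hit before the boundary.  The hitting time is inverse Gaussian, and one iteration of
  the algorithm moves the state to the position at that time; by the strong Markov property \<open>Q\<close> is thus
  invariant under the transition kernel, and \<open>Q(0, \<phi> 0)\<close> is the mean of \<open>Q\<close> over the final state.  This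
  gives the comparison of the distribution functions, because a state with \<open>H \<le> \<epsilon>\<close> reaches the boundary
  within time \<open>\<epsilon>\<close> except with probability at most \<open>(1 + \<rho>p) sqrt (2 \<epsilon> / pi)\<close>.

  The iteration bounds come from one Lyapunov function.  As \<open>H\<close> is at most \<open>R G\<close> after a step with time
  \<open>G\<close>, small values of \<open>R H\<close> are roughly squared by a step, so that only of order \<open>ln (- ln \<epsilon>)\<close> of them
  occur in a row, while a step with \<open>R H\<close> bounded below takes time of order at least \<open>1 / R\<^sup>2\<close>, so that
  there are at most of order \<open>1 + R\<^sup>2 K\<close> of those.\<close>

section \<open>The law of the trajectory\<close>

text \<open>The algorithm and Brownian motion live on different probability spaces: the trajectory
  law is built from inverse Gaussian kernels alone. No coupling is constructed; the link is
  \<open>Q\<close>, whose mean along the chain stays constant. The random final index is avoided by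
  evaluating at a fixed index \<open>n\<close>: states are frozen after the loop ends, and the error
  is at most the probability that the loop still runs at \<open>n\<close>. It tends to 0 because the
  Lyapunov bound makes the sum of these probabilities finite, so the iteration estimate also serves
  the statement on distributions. In that estimate \<open>R\<close> is the largest distance that a
  step can create per unit of its duration: \<open>r + 1\<close> for the second claim,
  \<open>r\<close> for non-increasing boundaries, \<open>r + \<rho>p\<close> for termination. The
  bound is a constant times \<open>1 + R\<^sup>2 * K + ln (2 * (u0 + \<bar>ln (R *
  \<epsilon>)\<bar>))\<close>, doubly logarithmic in \<open>\<epsilon>\<close>; comparison with
  \<open>\<bar>ln \<epsilon>\<bar>\<close> yields both claims on expectations.\<close>

lemma borel_measurable_fst_snd:
  "(fst :: real \<times> real \<Rightarrow> real) \<in> borel_measurable borel" "(snd :: real \<times> real \<Rightarrow> real) \<in> borel_measurable borel"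
  unfolding borel_prod[symmetric] by measurable

lemma measurable_update_at: "continuous_on {0..} \<phi> \<Longrightarrow> update \<phi> r s \<in> borel_measurable borel"
  using measurable_compose[OF _ measurable_update, of "\<lambda>g. (s, g)"] by simp

lemma measurable_running [measurable]: "Measurable.pred borel (running \<epsilon> K)"
  unfolding running_def borel_prod[symmetric] by measurable

text \<open>The infimum in \<open>enat\<close> is turned into a \<open>LEAST\<close> over the
  indices, with a separate case for the empty set, where it is \<open>\<infinity>\<close>.\<close>

lemma measurable_iterations [measurable]:
  "iterations \<epsilon> K \<in> measurable (PiM UNIV (\<lambda>_. borel)) (count_space UNIV)"
proof -
  have "iterations \<epsilon> K x = (if \<forall>n. running \<epsilon> K (x n) then \<infinity> else enat (LEAST n. \<not> running \<epsilon> K (x n)))" for x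
  proof (cases "\<forall>n. running \<epsilon> K (x n)")
    case True
    then have "{enat n | n. \<not> running \<epsilon> K (x n)} = {}" by blast
    with True show ?thesis by (simp add: iterations_def top_enat_def)
  next
    case False
    then obtain n where "\<not> running \<epsilon> K (x n)" by blast
    then have "\<not> running \<epsilon> K (x (LEAST n. \<not> running \<epsilon> K (x n)))"
      by (rule LeastI)
    then have "Inf {enat n | n. \<not> running \<epsilon> K (x n)} \<le> enat (LEAST n. \<not> running \<epsilon> K (x n))"
      by (intro Inf_lower) blast
    moreover have "enat (LEAST n. \<not> running \<epsilon> K (x n)) \<le> Inf {enat n | n. \<not> running \<epsilon> K (x n)}"
      by (intro Inf_greatest) (auto intro: Least_le)
    ultimately have "iterations \<epsilon> K x = enat (LEAST n. \<not> running \<epsilon> K (x n))"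
      unfolding iterations_def by (rule antisym)
    with False show ?thesis by (simp only: if_False)
  qed
  then have "iterations \<epsilon> K = (\<lambda>x. if \<forall>n. running \<epsilon> K (x n) then \<infinity> else enat (LEAST n. \<not> running \<epsilon> K (x n)))"
    by blast
  then show ?thesis by simp
qed

lemma measurable_outcome_time [measurable]:
  "outcome_time \<epsilon> K \<in> borel_measurable (PiM UNIV (\<lambda>_. borel))"
proof -
  note [measurable] = borel_measurable_fst_snd
  have "(\<lambda>x. (\<lambda>i x. case i of enat n \<Rightarrow> min (fst (x n)) K | \<infinity> \<Rightarrow> K) (iterations \<epsilon> K x) x)
     \<in> borel_measurable (PiM UNIV (\<lambda>_. borel))"
  proof (rule measurable_compose_countable)
    fix i show "(\<lambda>x. case i of enat n \<Rightarrow> min (fst (x n)) K | \<infinity> \<Rightarrow> K) \<in> borel_measurable (PiM UNIV (\<lambda>_. borel :: (real \<times> real) measure))"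
      by (cases i) (auto simp del: fst_conv)
  qed measurable
  then show ?thesis by (simp add: outcome_time_def[abs_def])
qed

section \<open>Finite-dimensional integrals and Markov property of the trajectory law\<close>

context
  fixes \<phi> :: "real \<Rightarrow> real" and \<epsilon> K r :: real
  assumes params: "0 < \<epsilon>" "0 < r" "continuous_on {0..} \<phi>"
begin

interpretation IT: Ionescu_Tulcea "history_kernel \<phi> \<epsilon> K r" "\<lambda>_. borel"
  by (rule Ionescu_Tulcea_history_kernel[OF params])

lemma sets_trajectory_law [measurable_cong]:
  "sets (trajectory_law \<phi> \<epsilon> K r) = sets (PiM UNIV (\<lambda>_. borel))"
  unfolding trajectory_law_def by simp

lemma space_trajectory_law: "space (trajectory_law \<phi> \<epsilon> K r) = UNIV"
  using sets_eq_imp_space_eq[OF sets_trajectory_law] by (simp add: space_PiM)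

text \<open>Links the projective limit with the composed kernels \<open>IT.C\<close>; the integrals
  in the next lemmas are reduced to finite stages through it.\<close>

lemma nn_integral_trajectory_law_restrict:
  assumes [measurable]: "F \<in> borel_measurable (PiM {0..<n} (\<lambda>_. borel))"
  shows "(\<integral>\<^sup>+x. F (restrict x {0..<n}) \<partial>trajectory_law \<phi> \<epsilon> K r) = (\<integral>\<^sup>+x. F x \<partial>IT.C 0 n (\<lambda>_. undefined))"
proof -
  let ?T = "trajectory_law \<phi> \<epsilon> K r"
  \<comment> \<open>\<open>IT.CI\<close> is defined from the stage \<open>IT.up_to\<close> of an
    index set. For an initial segment that stage is \<open>n\<close>, where restricting to the
    segment changes nothing.\<close>
  have "IT.up_to {0..<n} = n"
    using IT.up_to_less[of "{0..<n}" "IT.up_to {0..<n}"] by (intro antisym) (auto simp: IT.up_to_iff intro!: leI)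
  then have "distr ?T (PiM {0..<n} (\<lambda>_. borel)) (\<lambda>x. restrict x {0..<n})
      = distr (IT.C 0 n (\<lambda>_. undefined)) (PiM {0..<n} (\<lambda>_. borel)) (\<lambda>x. restrict x {0..<n})"
    unfolding trajectory_law_def using IT.distr_lim[of "{0..<n}"] by (simp add: IT.CI_def)
  also have "\<dots> = IT.C 0 n (\<lambda>_. undefined)"
    using IT.distr_C[of n n "\<lambda>_. undefined" 0] by simp
  finally have *: "distr ?T (PiM {0..<n} (\<lambda>_. borel)) (\<lambda>x. restrict x {0..<n}) = IT.C 0 n (\<lambda>_. undefined)" .
  show ?thesis unfolding *[symmetric]
    by (subst nn_integral_distr)
       (auto simp: measurable_cong_sets[OF sets_trajectory_law refl] intro!: measurable_restrict_subset assms)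
qed

lemma prob_space_trajectory_law: "prob_space (trajectory_law \<phi> \<epsilon> K r)"
proof
  show "emeasure (trajectory_law \<phi> \<epsilon> K r) (space (trajectory_law \<phi> \<epsilon> K r)) = 1"
    using nn_integral_trajectory_law_restrict[of "\<lambda>_. 1" 0]
    by (simp del: nn_integral_const add: nn_integral_return space_PiM) simp
qed

lemma nn_integral_trajectory_law_0:
  assumes [measurable]: "f \<in> borel_measurable borel"
  shows "(\<integral>\<^sup>+x. f (x 0) \<partial>trajectory_law \<phi> \<epsilon> K r) = f (0, \<phi> 0)"
proof -
  have "(\<integral>\<^sup>+x. f (x 0) \<partial>trajectory_law \<phi> \<epsilon> K r)
      = (\<integral>\<^sup>+x. (\<lambda>x. f (x 0)) (restrict x {0..<Suc 0}) \<partial>trajectory_law \<phi> \<epsilon> K r)"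
    by simp
  also have "\<dots> = (\<integral>\<^sup>+x. f (x 0) \<partial>IT.C 0 (Suc 0) (\<lambda>_. undefined))"
    by (subst nn_integral_trajectory_law_restrict) measurable
  also have "\<dots> = (\<integral>\<^sup>+x. (\<integral>\<^sup>+x. f (x 0) \<partial>IT.eP 0 x) \<partial>return (PiM {0..<0} (\<lambda>_. borel)) (\<lambda>_. undefined))"
    unfolding IT.C.simps
    using IT.measurable_eP[of 0]
    by (subst nn_integral_bind[where B="PiM {0..<Suc 0} (\<lambda>_. borel)"]) (auto simp: space_PiM)
  also have "\<dots> = (\<integral>\<^sup>+x. f (x 0) \<partial>IT.eP 0 (\<lambda>_. undefined))"
  proof (subst nn_integral_return)
    show "(\<lambda>x. \<integral>\<^sup>+ x. f (x 0) \<partial>IT.eP 0 x) \<in> borel_measurable (PiM {0..<0} (\<lambda>_. borel))"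
      by (rule measurable_compose[OF IT.measurable_eP nn_integral_measurable_subprob_algebra]) measurable
  qed (auto simp: space_PiM)
  also have "\<dots> = f (0, \<phi> 0)"
    by (subst IT.nn_integral_eP) (auto simp: space_PiM history_kernel_def nn_integral_return)
  finally show ?thesis .
qed

text \<open>The kernel at index \<open>Suc n\<close> reads only coordinate \<open>n\<close> of the
  history. This is the Markov property of the sequence of states, in the form needed for functions
  of two consecutive states.\<close>

lemma nn_integral_trajectory_law_Suc:
  assumes [measurable]: "case_prod g \<in> borel_measurable (borel \<Otimes>\<^sub>M borel)"
  shows "(\<integral>\<^sup>+x. g (x n) (x (Suc n)) \<partial>trajectory_law \<phi> \<epsilon> K r)
    = (\<integral>\<^sup>+x. (\<integral>\<^sup>+y. g (x n) y \<partial>step_kernel \<phi> \<epsilon> K r (x n)) \<partial>trajectory_law \<phi> \<epsilon> K r)"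
proof -
  let ?u = "\<lambda>_ :: nat. undefined :: real \<times> real"
  have mg[measurable]: "(\<lambda>s. \<integral>\<^sup>+y. g s y \<partial>step_kernel \<phi> \<epsilon> K r s) \<in> borel_measurable borel"
    by (rule nn_integral_measurable_subprob_algebra2[OF _ measurable_step_kernel[OF params]]) measurable
  have "(\<integral>\<^sup>+x. g (x n) (x (Suc n)) \<partial>trajectory_law \<phi> \<epsilon> K r)
      = (\<integral>\<^sup>+x. (\<lambda>x. g (x n) (x (Suc n))) (restrict x {0..<Suc (Suc n)}) \<partial>trajectory_law \<phi> \<epsilon> K r)"
    by simp
  also have "\<dots> = (\<integral>\<^sup>+x. g (x n) (x (Suc n)) \<partial>IT.C 0 (Suc (Suc n)) ?u)"
    by (subst nn_integral_trajectory_law_restrict) measurable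
  also have "\<dots> = (\<integral>\<^sup>+x. (\<integral>\<^sup>+x. g (x n) (x (Suc n)) \<partial>IT.eP (Suc n) x) \<partial>IT.C 0 (Suc n) ?u)"
    unfolding IT.C.simps(2)[of 0 "Suc n"]
    by (subst nn_integral_bind[where B="PiM {0..<Suc (Suc n)} (\<lambda>_. borel)"])
       (auto simp: space_PiM measurable_cong_sets[OF IT.sets_C refl] simp del: IT.C.simps)
  also have "\<dots> = (\<integral>\<^sup>+x. (\<integral>\<^sup>+y. g (x n) y \<partial>step_kernel \<phi> \<epsilon> K r (x n)) \<partial>IT.C 0 (Suc n) ?u)"
  proof (rule nn_integral_cong)
    fix x assume "x \<in> space (IT.C 0 (Suc n) ?u)"
    then have x: "x \<in> space (PiM {0..<Suc n} (\<lambda>_. borel))"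
      by (simp add: IT.space_C space_PiM del: IT.C.simps)
    show "(\<integral>\<^sup>+x. g (x n) (x (Suc n)) \<partial>IT.eP (Suc n) x) = (\<integral>\<^sup>+y. g (x n) y \<partial>step_kernel \<phi> \<epsilon> K r (x n))"
      by (subst IT.nn_integral_eP[OF x]) (auto simp: history_kernel_def)
  qed
  also have "\<dots> = (\<integral>\<^sup>+x. (\<lambda>x. \<integral>\<^sup>+y. g (x n) y \<partial>step_kernel \<phi> \<epsilon> K r (x n)) (restrict x {0..<Suc n}) \<partial>trajectory_law \<phi> \<epsilon> K r)"
    by (subst nn_integral_trajectory_law_restrict) measurable
  finally show ?thesis by simp
qed

lemma sets_running [measurable]: "{x. running \<epsilon> K (x n)} \<in> sets (trajectory_law \<phi> \<epsilon> K r)"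
proof -
  have "{x \<in> space (trajectory_law \<phi> \<epsilon> K r). running \<epsilon> K (x n)} \<in> sets (trajectory_law \<phi> \<epsilon> K r)"
    by measurable
  then show ?thesis by (simp add: space_trajectory_law)
qed

lemma emeasure_running:
  "emeasure (trajectory_law \<phi> \<epsilon> K r) {x. running \<epsilon> K (x n)}
    = (\<integral>\<^sup>+x. indicator {s. running \<epsilon> K s} (x n) \<partial>trajectory_law \<phi> \<epsilon> K r)"
proof -
  have "(\<integral>\<^sup>+x. indicator {s. running \<epsilon> K s} (x n) \<partial>trajectory_law \<phi> \<epsilon> K r)
      = (\<integral>\<^sup>+x. indicator {x. running \<epsilon> K (x n)} x \<partial>trajectory_law \<phi> \<epsilon> K r)"
    by (simp add: indicator_def)
  then show ?thesis by simp
qed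

text \<open>The transition formula is applied to the indicator of the failure set, whose inner
  integral vanishes for every starting state.\<close>

lemma AE_trajectory_law_step:
  assumes P[measurable]: "Measurable.pred (borel \<Otimes>\<^sub>M borel) (case_prod P)"
    and s: "\<And>s. AE y in step_kernel \<phi> \<epsilon> K r s. P s y"
  shows "AE x in trajectory_law \<phi> \<epsilon> K r. P (x n) (x (Suc n))"
proof -
  have [measurable]: "{z. \<not> case_prod P z} \<in> sets (borel \<Otimes>\<^sub>M borel)"
  proof -
    have "{z\<in>space (borel \<Otimes>\<^sub>M borel). \<not> case_prod P z} \<in> sets (borel \<Otimes>\<^sub>M borel)"
      by measurable
    then show ?thesis by (simp add: space_pair_measure)
  qed
  have "(\<integral>\<^sup>+x. indicator {z. \<not> case_prod P z} (x n, x (Suc n)) \<partial>trajectory_law \<phi> \<epsilon> K r)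
    = (\<integral>\<^sup>+x. (\<integral>\<^sup>+y. indicator {z. \<not> case_prod P z} (x n, y) \<partial>step_kernel \<phi> \<epsilon> K r (x n)) \<partial>trajectory_law \<phi> \<epsilon> K r)"
    by (subst nn_integral_trajectory_law_Suc[symmetric]) (auto simp: case_prod_beta')
  also have "(\<lambda>x. \<integral>\<^sup>+y. indicator {z. \<not> case_prod P z} (x n, y) \<partial>step_kernel \<phi> \<epsilon> K r (x n)) = (\<lambda>x. 0)"
  proof
    fix x :: "nat \<Rightarrow> real \<times> real"
    have "(\<integral>\<^sup>+y. indicator {z. \<not> case_prod P z} (x n, y) \<partial>step_kernel \<phi> \<epsilon> K r (x n))
      = (\<integral>\<^sup>+y. 0 \<partial>step_kernel \<phi> \<epsilon> K r (x n))"
      using s[of "x n"] by (intro nn_integral_cong_AE) (auto elim!: eventually_mono)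
    then show "(\<integral>\<^sup>+y. indicator {z. \<not> case_prod P z} (x n, y) \<partial>step_kernel \<phi> \<epsilon> K r (x n)) = 0" by simp
  qed
  finally have "(\<integral>\<^sup>+x. indicator {z. \<not> case_prod P z} (x n, x (Suc n)) \<partial>trajectory_law \<phi> \<epsilon> K r) = 0" by simp
  then show ?thesis
    by (subst (asm) nn_integral_0_iff_AE) (auto simp: indicator_def elim!: eventually_mono)
qed

lemma AE_trajectory_law_0:
  assumes [measurable]: "Measurable.pred borel P" and "P (0, \<phi> 0)"
  shows "AE x in trajectory_law \<phi> \<epsilon> K r. P (x 0)"
proof -
  have "(\<integral>\<^sup>+x. indicator {z. \<not> P z} (x 0) \<partial>trajectory_law \<phi> \<epsilon> K r) = 0"
    using assms by (subst nn_integral_trajectory_law_0) auto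
  then show ?thesis
    by (subst (asm) nn_integral_0_iff_AE) (auto simp: indicator_def elim!: eventually_mono)
qed

lemma AE_trajectory_law_frozen:
  "AE x in trajectory_law \<phi> \<epsilon> K r. \<forall>n. \<not> running \<epsilon> K (x n) \<longrightarrow> x (Suc n) = x n"
proof -
  have "AE x in trajectory_law \<phi> \<epsilon> K r. \<not> running \<epsilon> K (x n) \<longrightarrow> x (Suc n) = x n" for n
  proof (rule AE_trajectory_law_step)
    show "AE y in step_kernel \<phi> \<epsilon> K r s. \<not> running \<epsilon> K s \<longrightarrow> y = s" for s
    proof (cases "running \<epsilon> K s")
      case False
      then have eq: "step_kernel \<phi> \<epsilon> K r s = return borel s"
        by (simp add: step_kernel_def)
      show ?thesis unfolding eq by (subst AE_return) auto
    qed simp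
  qed (measurable; simp add: borel_prod)
  then show ?thesis by (simp add: AE_all_countable)
qed

text \<open>Every index before the first failure of the loop condition is running, so the number of
  iterations is dominated by the number of running indices, also when it is infinite. Termwise
  integration turns that number into a sum of probabilities.\<close>

lemma expected_iterations_le:
  "expected_iterations \<phi> \<epsilon> K r \<le> (\<Sum>n. emeasure (trajectory_law \<phi> \<epsilon> K r) {x. running \<epsilon> K (x n)})"
proof -
  have "ennreal_of_enat (iterations \<epsilon> K x) \<le> (\<Sum>n. indicator {x. running \<epsilon> K (x n)} x)" for x
  proof (rule ccontr)
    let ?S = "(\<Sum>n. indicator {x. running \<epsilon> K (x n)} x) :: ennreal"
    assume less: "\<not> ?thesis"
    have le: "ennreal_of_enat (enat m) \<le> ?S" if "enat m \<le> iterations \<epsilon> K x" for m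
    proof -
      have "running \<epsilon> K (x n)" if "n < m" for n
      proof (rule ccontr)
        assume "\<not> running \<epsilon> K (x n)"
        then have "iterations \<epsilon> K x \<le> enat n"
          unfolding iterations_def by (intro Inf_lower) auto
        with \<open>enat m \<le> iterations \<epsilon> K x\<close> \<open>n < m\<close> show False
          by (meson enat_ord_simps(1) leD le_less_trans order_trans)
      qed
      then have "ennreal_of_enat (enat m) = (\<Sum>n<m. indicator {x. running \<epsilon> K (x n)} x)"
        by (simp add: indicator_def)
      also have "\<dots> \<le> ?S" by (intro sum_le_suminf) auto
      finally show ?thesis .
    qed
    show False
    proof (cases "iterations \<epsilon> K x")
      case (enat m) then show False using le[of m] less by simp
    next
      case infinity
      then have "of_nat m \<le> ?S" for m using le[of m] by simp
      then have "?S = \<top>"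
        by (metis ennreal_SUP_of_nat_eq_top SUP_least top.extremum_uniqueI)
      then show False using less by simp
    qed
  qed
  then have "expected_iterations \<phi> \<epsilon> K r \<le> (\<integral>\<^sup>+x. (\<Sum>n. indicator {x. running \<epsilon> K (x n)} x) \<partial>trajectory_law \<phi> \<epsilon> K r)"
    unfolding expected_iterations_def by (intro nn_integral_mono)
  also have "\<dots> = (\<Sum>n. \<integral>\<^sup>+x. indicator {x. running \<epsilon> K (x n)} x \<partial>trajectory_law \<phi> \<epsilon> K r)"
    by (intro nn_integral_suminf) measurable
  also have "\<dots> = (\<Sum>n. emeasure (trajectory_law \<phi> \<epsilon> K r) {x. running \<epsilon> K (x n)})"
    by (intro suminf_cong nn_integral_indicator sets_running)
  finally show ?thesis .
qed

text \<open>Foster-Lyapunov argument: a nonnegative function that loses at least one on average in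
  every running step can pay for at most \<open>V (0, \<phi> 0)\<close> such steps. At all other
  states the kernel freezes the state and \<open>V\<close> keeps its value.\<close>

lemma sum_running_le_potential:
  assumes V[measurable]: "V \<in> borel_measurable borel"
    and drop: "\<And>s. running \<epsilon> K s \<Longrightarrow> (\<integral>\<^sup>+y. V y \<partial>step_kernel \<phi> \<epsilon> K r s) + 1 \<le> V s"
  shows "(\<Sum>n. emeasure (trajectory_law \<phi> \<epsilon> K r) {x. running \<epsilon> K (x n)}) \<le> V (0, \<phi> 0)"
proof -
  let ?T = "trajectory_law \<phi> \<epsilon> K r"
  have step: "(\<integral>\<^sup>+y. V y \<partial>step_kernel \<phi> \<epsilon> K r s) + indicator {s. running \<epsilon> K s} s \<le> V s" for s
    using drop[of s] by (cases "running \<epsilon> K s") (auto simp: step_kernel_def nn_integral_return)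
  have [measurable]: "(\<lambda>s. \<integral>\<^sup>+y. V y \<partial>step_kernel \<phi> \<epsilon> K r s) \<in> borel_measurable borel"
    by (rule nn_integral_measurable_subprob_algebra2[OF _ measurable_step_kernel[OF params]]) measurable
  \<comment> \<open>The mean of \<open>V\<close> at time \<open>m\<close> stays on the left, so that
    the induction telescopes.\<close>
  have "(\<Sum>n<m. emeasure ?T {x. running \<epsilon> K (x n)}) + (\<integral>\<^sup>+x. V (x m) \<partial>?T) \<le> V (0, \<phi> 0)" for m
  proof (induction m)
    case 0 then show ?case by (simp add: nn_integral_trajectory_law_0)
  next
    case (Suc m)
    have "emeasure ?T {x. running \<epsilon> K (x m)} + (\<integral>\<^sup>+x. V (x (Suc m)) \<partial>?T)
      = (\<integral>\<^sup>+x. indicator {s. running \<epsilon> K s} (x m) \<partial>?T) + (\<integral>\<^sup>+x. \<integral>\<^sup>+y. V y \<partial>step_kernel \<phi> \<epsilon> K r (x m) \<partial>?T)"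
      by (subst nn_integral_trajectory_law_Suc[symmetric]) (simp_all add: emeasure_running)
    also have "\<dots> = (\<integral>\<^sup>+x. (\<integral>\<^sup>+y. V y \<partial>step_kernel \<phi> \<epsilon> K r (x m)) + indicator {s. running \<epsilon> K s} (x m) \<partial>?T)"
      by (subst nn_integral_add) (auto simp: add.commute)
    also have "\<dots> \<le> (\<integral>\<^sup>+x. V (x m) \<partial>?T)"
      by (intro nn_integral_mono step)
    finally have "(\<Sum>n<m. emeasure ?T {x. running \<epsilon> K (x n)}) + (emeasure ?T {x. running \<epsilon> K (x m)} + (\<integral>\<^sup>+x. V (x (Suc m)) \<partial>?T))
        \<le> V (0, \<phi> 0)"
      by (rule order_trans[OF add_left_mono Suc.IH])
    then show ?case by (simp add: add.assoc)
  qed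
  then have "(\<Sum>n<m. emeasure ?T {x. running \<epsilon> K (x n)}) \<le> V (0, \<phi> 0)" for m
    by (meson le_iff_add order_trans)
  then show ?thesis by (intro suminf_le_const summableI) 
qed

end

section \<open>Inverse Gaussian steps and the potential function\<close>

text \<open>For these parameters the density is that of the first hitting time of the line
  \<open>H - r * x\<close> by Brownian motion; this form is used in all later estimates.\<close>

lemma inverse_gaussian_density_drift:
  assumes "0 < H" "0 < r" "0 < x"
  shows "inverse_gaussian_density (H / r) (H\<^sup>2) x
    = H / (sqrt (2 * pi) * (x * sqrt x)) * exp (- ((r * x - H)\<^sup>2 / (2 * x)))"
proof -
  have "sqrt (H\<^sup>2 / (2 * pi * x ^ 3)) = H / (sqrt (2 * pi) * (x * sqrt x))"
    using assms by (simp add: real_sqrt_divide real_sqrt_mult power3_eq_cube)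
  moreover have "H\<^sup>2 * (x - H / r)\<^sup>2 / (2 * (H / r)\<^sup>2 * x) = (r * x - H)\<^sup>2 / (2 * x)"
    using assms by (simp add: field_simps power2_eq_square)
  ultimately show ?thesis using assms by (simp add: inverse_gaussian_density_def)
qed

lemma AE_inverse_gaussian_pos: "AE g in inverse_gaussian \<mu> l. 0 < g"
proof -
  have "AE x in lborel. x \<noteq> (0::real)" by (rule AE_lborel_singleton)
  then show ?thesis
    unfolding inverse_gaussian_def
    by (subst AE_density) (auto simp: inverse_gaussian_density_def indicator_def elim!: eventually_mono)
qed

lemma sqrt_two_pi_ge_2: "2 \<le> sqrt (2 * pi)"
  using pi_ge_two by (intro real_le_rsqrt) (simp add: power2_eq_square)

text \<open>Expanding the square pulls \<open>exp (r * H)\<close> out of the exponential and leaves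
  a factor at most one. With \<open>sqrt (2 * pi) \<ge> 2\<close> the density is below a multiple of
  \<open>1 / (x * sqrt x)\<close>, whose antiderivative is explicit.\<close>

lemma inverse_gaussian_upper_tail:
  assumes H: "0 < H" and r: "0 < r" and y: "0 < y"
  shows "emeasure (inverse_gaussian (H / r) (H\<^sup>2)) {y<..} \<le> ennreal (exp (r * H) * H / sqrt y)"
proof -
  define c where "c = exp (r * H) * (H / 2)"
  have c: "c > 0" using H by (simp add: c_def)
  have bound: "inverse_gaussian_density (H / r) (H\<^sup>2) x \<le> c / (x * sqrt x)" if "x > 0" for x
  proof -
    have "- ((r * x - H)\<^sup>2 / (2 * x)) = r * H - (r\<^sup>2 * x / 2 + H\<^sup>2 / (2 * x))"
      using that by (simp add: field_simps power2_eq_square)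
    moreover have "0 \<le> r\<^sup>2 * x / 2 + H\<^sup>2 / (2 * x)" using that by simp
    ultimately have "exp (- ((r * x - H)\<^sup>2 / (2 * x))) \<le> exp (r * H)"
      unfolding exp_le_cancel_iff by linarith
    moreover have "H / (sqrt (2 * pi) * (x * sqrt x)) \<le> H / (2 * (x * sqrt x))"
      using that H sqrt_two_pi_ge_2 by (intro divide_left_mono mult_right_mono mult_pos_pos) auto
    ultimately have "H / (sqrt (2 * pi) * (x * sqrt x)) * exp (- ((r * x - H)\<^sup>2 / (2 * x)))
        \<le> H / (2 * (x * sqrt x)) * exp (r * H)"
      using that H by (intro mult_mono) auto
    then show ?thesis
      unfolding inverse_gaussian_density_drift[OF H r that] by (simp add: c_def field_simps)
  qed
  have "emeasure (inverse_gaussian (H / r) (H\<^sup>2)) {y<..}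
      = (\<integral>\<^sup>+x. ennreal (inverse_gaussian_density (H / r) (H\<^sup>2) x) * indicator {y<..} x \<partial>lborel)"
    by (simp add: inverse_gaussian_def emeasure_density)
  also have "\<dots> \<le> (\<integral>\<^sup>+x. ennreal (c / (x * sqrt x)) * indicator {y..} x \<partial>lborel)"
    using bound y by (intro nn_integral_mono) (auto simp: indicator_def intro!: ennreal_leI)
  also have "\<dots> = ennreal (0 - (- (2 * c / sqrt y)))"
  proof (rule nn_integral_FTC_atLeast)
    show "(\<lambda>x. c / (x * sqrt x)) \<in> borel_measurable borel" by measurable
    show "((\<lambda>x. - (2 * c / sqrt x)) has_real_derivative c / (x * sqrt x)) (at x)" if "y \<le> x" for x
      using that y by (auto intro!: derivative_eq_intros simp: field_simps)
    show "0 \<le> c / (x * sqrt x)" if "y \<le> x" for x using that y c by simp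
    show "((\<lambda>x. - (2 * c / sqrt x)) \<longlongrightarrow> 0) at_top" by real_asymp
  qed
  finally show ?thesis by (simp add: c_def)
qed

text \<open>Up to time \<open>c\<close> the line has used at most half of \<open>H\<close>, so the
  exponential is at most \<open>exp (- z)\<close> with \<open>z = H\<^sup>2 / (8 * x)\<close>.
  Replacing it by \<open>2 / z\<^sup>2\<close> leaves \<open>64 * sqrt x / H ^ 3\<close>, which
  increases in \<open>x\<close>.\<close>

lemma inverse_gaussian_lower_tail:
  assumes H: "0 < H" and r: "0 < r" and c: "0 < c" "r * c \<le> H / 2"
  shows "emeasure (inverse_gaussian (H / r) (H\<^sup>2)) {..c} \<le> ennreal (64 * (sqrt c / H) ^ 3)"
proof -
  define b where "b = 64 * sqrt c / H ^ 3"
  have b: "b \<ge> 0" using H c by (simp add: b_def)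
  have bound: "inverse_gaussian_density (H / r) (H\<^sup>2) x \<le> b" if x: "x > 0" "x \<le> c" for x
  proof -
    have "r * x \<le> r * c" using x r by simp
    then have "(H / 2)\<^sup>2 \<le> (H - r * x)\<^sup>2" using H c by (intro power_mono) auto
    then have sq: "H\<^sup>2 / (8 * x) \<le> (r * x - H)\<^sup>2 / (2 * x)"
      using x by (simp add: divide_simps power2_commute[of H] power_divide)
    define z where "z = H\<^sup>2 / (8 * x)"
    have z: "z > 0" using H x by (simp add: z_def)
    have "z\<^sup>2 / 2 \<le> exp z" using exp_lower_Taylor_quadratic[of z] z by simp
    then have "exp (- z) \<le> 2 / z\<^sup>2" using z by (simp add: exp_minus field_simps)
    moreover have "exp (- ((r * x - H)\<^sup>2 / (2 * x))) \<le> exp (- z)"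
      using sq by (simp add: z_def)
    ultimately have "exp (- ((r * x - H)\<^sup>2 / (2 * x))) \<le> 2 / z\<^sup>2" by linarith
    moreover have "H / (sqrt (2 * pi) * (x * sqrt x)) \<le> H / (2 * (x * sqrt x))"
      using x H sqrt_two_pi_ge_2 by (intro divide_left_mono mult_right_mono mult_pos_pos) auto
    ultimately have "H / (sqrt (2 * pi) * (x * sqrt x)) * exp (- ((r * x - H)\<^sup>2 / (2 * x)))
        \<le> H / (2 * (x * sqrt x)) * (2 / z\<^sup>2)"
      using x H by (intro mult_mono) auto
    also have "\<dots> = 64 * (x / sqrt x) / H ^ 3"
      using x H by (simp add: z_def field_simps power2_eq_square power3_eq_cube)
    also have "x / sqrt x = sqrt x" using x by (simp add: real_div_sqrt)
    also have "64 * sqrt x / H ^ 3 \<le> b"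
      unfolding b_def using x H by (intro divide_right_mono) auto
    finally show ?thesis unfolding inverse_gaussian_density_drift[OF H r x(1)] .
  qed
  have "emeasure (inverse_gaussian (H / r) (H\<^sup>2)) {..c}
      = (\<integral>\<^sup>+x. ennreal (inverse_gaussian_density (H / r) (H\<^sup>2) x) * indicator {..c} x \<partial>lborel)"
    by (simp add: inverse_gaussian_def emeasure_density)
  also have "\<dots> \<le> (\<integral>\<^sup>+x. ennreal b * indicator {0..c} x \<partial>lborel)"
  proof (intro nn_integral_mono)
    fix x :: real
    \<comment> \<open>Division by zero makes the density vanish at \<open>x = 0\<close>.\<close>
    consider "x < 0" | "x = 0" | "x > 0" by linarith
    then show "ennreal (inverse_gaussian_density (H / r) (H\<^sup>2) x) * indicator {..c} x \<le> ennreal b * indicator {0..c} x"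
      by cases (use bound[of x] b in \<open>auto simp: indicator_def inverse_gaussian_density_def[of _ _ 0]
          inverse_gaussian_density_def[where x=x] ennreal_leI\<close>)
  qed
  also have "\<dots> = ennreal (b * c)"
    using c b by (simp add: nn_integral_cmult_indicator ennreal_mult)
  also have "b * c = 64 * (sqrt c / H) ^ 3"
    using c by (simp add: b_def power_divide power3_eq_cube)
  finally show ?thesis .
qed

text \<open>Template for one step of the chain: \<open>\<alpha>\<close> bounds the new potential in
  the typical case, and \<open>\<beta>\<close> is the extra cost on an exceptional event
  \<open>S\<close> of probability at most \<open>p\<close>.\<close>

lemma (in prob_space) nn_integral_le_indicator:
  assumes "AE x in M. f x \<le> \<alpha> + \<beta> * indicator S x" "0 \<le> \<alpha>" "0 \<le> \<beta>" "S \<in> sets M"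
    and "emeasure M S \<le> ennreal p" "0 \<le> p"
  shows "(\<integral>\<^sup>+x. ennreal (f x) \<partial>M) \<le> ennreal (\<alpha> + \<beta> * p)"
proof -
  have "(\<integral>\<^sup>+x. ennreal (f x) \<partial>M) \<le> (\<integral>\<^sup>+x. ennreal \<alpha> + ennreal \<beta> * indicator S x \<partial>M)"
    using assms(1) by (intro nn_integral_mono_AE)
      (auto elim!: eventually_mono simp: assms(2,3) indicator_def ennreal_plus[symmetric] simp del: ennreal_plus intro!: ennreal_leI)
  also have "\<dots> = ennreal \<alpha> + ennreal \<beta> * emeasure M S"
    using assms(4) by (simp add: nn_integral_add nn_integral_cmult_indicator emeasure_space_1)
  also have "\<dots> \<le> ennreal \<alpha> + ennreal \<beta> * ennreal p"
    by (intro add_left_mono mult_left_mono assms) auto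
  also have "\<dots> = ennreal (\<alpha> + \<beta> * p)"
    using assms by (simp add: ennreal_mult ennreal_plus)
  finally show ?thesis .
qed

text \<open>On the scale \<open>u = - ln (R H)\<close> a step roughly doubles \<open>u\<close> once \<open>u\<close> is large, because the inverse
  Gaussian time is of order \<open>H\<^sup>2\<close>; hence the logarithm of \<open>u\<close> in the potential.  The loop stops beyond
  \<open>U\<close>, but the cap is \<open>2 U\<close> so that a step from a level just below \<open>U\<close> still gains.\<close>

definition log_level :: "real \<Rightarrow> real \<Rightarrow> real \<Rightarrow> real" where
  "log_level R U H = (if H \<le> 0 then 2 * U else max 1 (min (2 * U) (- ln (R * H))))"

text \<open>The jump from above \<open>K\<close> down to \<open>0\<close> at time \<open>K\<close>
  ensures that a step of length \<open>g\<close> lowers the value by at least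
  \<open>min g K\<close>, even if it overshoots \<open>K\<close> from a time just before it.\<close>

definition remaining_time :: "real \<Rightarrow> real \<Rightarrow> real" where
  "remaining_time K T = (if T < K then 2 * K - T else 0)"

text \<open>The factor \<open>5\<close> leaves a margin: a typical step from a small distance gains
  \<open>5 * ln (3 / 2) \<ge> 5 / 3\<close>, of which exceptional steps take back at most
  \<open>1 / 2\<close> on average. The weight \<open>A\<close> is fixed in
  \<open>potential_drop_large\<close>.\<close>

definition potential :: "real \<Rightarrow> real \<Rightarrow> real \<Rightarrow> real \<Rightarrow> real \<times> real \<Rightarrow> real" where
  "potential R U K A s = 5 * (ln (2 * U) - ln (log_level R U (snd s))) + A * remaining_time K (fst s)"

lemma measurable_potential [measurable]: "potential R U K A \<in> borel_measurable borel"
proof -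
  have [measurable]: "log_level R U \<in> borel_measurable borel"
    unfolding log_level_def[abs_def] by measurable
  have [measurable]: "remaining_time K \<in> borel_measurable borel"
    unfolding remaining_time_def[abs_def] by measurable
  show ?thesis
    unfolding potential_def[abs_def] borel_prod[symmetric] by measurable
qed

section \<open>Decrease of the potential in one step\<close>

lemma log_level_bounds: "1 \<le> U \<Longrightarrow> 1 \<le> log_level R U H" "1 \<le> U \<Longrightarrow> log_level R U H \<le> 2 * U"
  by (auto simp: log_level_def)

lemma remaining_time_le:
  "0 \<le> g \<Longrightarrow> 0 < K \<Longrightarrow> T < K \<Longrightarrow> remaining_time K (g + T) \<le> remaining_time K T - min g K"
  by (auto simp: remaining_time_def min_def)

lemma remaining_time_nonneg: "0 < K \<Longrightarrow> 0 \<le> remaining_time K T"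
  by (auto simp: remaining_time_def)

text \<open>A step that lasts at most \<open>y\<close> leaves a distance at most
  \<open>R * y\<close>, which raises the level from \<open>u\<close> to at least
  \<open>3 * u / 2\<close>, still below the cap \<open>2 * U\<close>. Longer steps are unlikely by
  the upper tail.\<close>

lemma potential_drop_small:
  assumes H: "0 < H" "T < K" "0 < r" "r \<le> R" "0 < K" "0 \<le> A"
    and u: "u = - ln (R * H)" "1 \<le> u" "u \<le> U" "3 * exp (- u / 4) * ln (3 * u / 2) \<le> 1 / 10"
    and h: "\<And>g. 0 < g \<Longrightarrow> snd (update \<phi> r (T, H) g) \<le> R * g"
  shows "(\<integral>\<^sup>+g. ennreal (potential R U K A (update \<phi> r (T, H) g)) \<partial>inverse_gaussian (H / r) (H\<^sup>2)) + 1
    \<le> ennreal (potential R U K A (T, H))"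
proof -
  have R: "0 < R" using H by linarith
  interpret G: prob_space "inverse_gaussian (H / r) (H\<^sup>2)"
    using H by (intro prob_space_inverse_gaussian) auto
  \<comment> \<open>The exponent \<open>3 / 4\<close> balances two demands:
    \<open>R * (R * y) = exp (- (3 * u / 2))\<close> gives the new level, and
    \<open>H / sqrt y = exp (- u / 4)\<close> keeps the tail small.\<close>
  define y where "y = (exp (- (3 * u / 4)) / R)\<^sup>2"
  \<comment> \<open>The factor \<open>3\<close> bounds \<open>exp (r * H)\<close>, since
    \<open>r * H \<le> R * H \<le> 1\<close>.\<close>
  define p where "p = 3 * exp (- u / 4)"
  define a where "a = ln (2 * U) - ln (3 * u / 2)"
  have y: "0 < y" "sqrt y = exp (- (3 * u / 4)) / R" using R by (simp_all add: y_def)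
  have RH: "R * H = exp (- u)" using R H u by simp
  have a: "0 \<le> a" using u by (simp add: a_def)
  have lnu: "0 \<le> ln (3 * u / 2)" using u by simp
  have "(\<integral>\<^sup>+g. ennreal (potential R U K A (update \<phi> r (T, H) g)) \<partial>inverse_gaussian (H / r) (H\<^sup>2))
    \<le> ennreal ((5 * a + A * remaining_time K T) + 5 * ln (3 * u / 2) * p)"
  \<comment> \<open>On the exceptional set the new level may fall to \<open>1\<close>, which costs
    \<open>5 * ln (3 * u / 2)\<close> on top of the typical value.\<close>
  proof (rule G.nn_integral_le_indicator[where S="{y<..}"])
    show "AE g in inverse_gaussian (H / r) (H\<^sup>2). potential R U K A (update \<phi> r (T, H) g)
      \<le> 5 * a + A * remaining_time K T + 5 * ln (3 * u / 2) * indicator {y<..} g"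
      using AE_inverse_gaussian_pos
    proof eventually_elim
      fix g :: real assume g: "0 < g"
      let ?h = "snd (update \<phi> r (T, H) g)"
      have "A * remaining_time K (g + T) \<le> A * remaining_time K T"
        using remaining_time_le[of g K T] g H by (intro mult_left_mono) auto
      moreover have "ln (2 * U) - ln (log_level R U ?h) \<le> a + ln (3 * u / 2) * indicator {y<..} g"
      proof (cases "y < g")
        case True
        have "0 \<le> ln (log_level R U ?h)" using log_level_bounds(1)[of U R ?h] u by simp
        with True show ?thesis by (simp add: a_def)
      next
        case False
        have "3 * u / 2 \<le> log_level R U ?h"
        proof (cases "?h \<le> 0")
          case False
          have "R * ?h \<le> R * (R * g)" using h[OF g] R by simp
          also have "\<dots> \<le> R * (R * y)" using \<open>\<not> y < g\<close> R by simp
          also have "R * (R * y) = exp (- (3 * u / 4)) * exp (- (3 * u / 4))"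
            using R by (simp add: y_def power2_eq_square)
          also have "\<dots> = exp (- (3 * u / 2))" by (simp add: exp_add[symmetric])
          finally have "ln (R * ?h) \<le> - (3 * u / 2)"
            using R False by (metis ln_exp ln_le_cancel_iff exp_gt_zero mult_pos_pos not_le)
          then show ?thesis using False u by (auto simp: log_level_def)
        qed (use u in \<open>auto simp: log_level_def\<close>)
        then have "ln (3 * u / 2) \<le> ln (log_level R U ?h)" using u by (subst ln_le_cancel_iff) auto
        with False show ?thesis by (simp add: a_def)
      qed
      ultimately show "potential R U K A (update \<phi> r (T, H) g)
        \<le> 5 * a + A * remaining_time K T + 5 * ln (3 * u / 2) * indicator {y<..} g"
        by (simp add: potential_def update_def algebra_simps)
    qed
    have "exp (r * H) \<le> 3"
    proof -
      have "r * H \<le> R * H" using H by simp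
      also have "\<dots> \<le> 1" using u by (simp add: RH)
      finally have "exp (r * H) \<le> exp 1" by simp
      then show ?thesis using exp_le by linarith
    qed
    then have "exp (r * H) * H / sqrt y \<le> 3 * (H / sqrt y)"
      using H y by (simp add: divide_right_mono)
    also have "H / sqrt y = (R * H) * exp (3 * u / 4)"
      unfolding y using R by (simp add: exp_minus field_simps)
    also have "\<dots> = exp (- u / 4)"
      unfolding RH by (simp add: exp_add[symmetric])
    finally show "emeasure (inverse_gaussian (H / r) (H\<^sup>2)) {y<..} \<le> ennreal p"
      unfolding p_def using inverse_gaussian_upper_tail[OF H(1,3) y(1)] by (meson ennreal_leI order_trans)
  qed (use a lnu H in \<open>auto simp: p_def remaining_time_nonneg\<close>)
  also have "\<dots> + 1 = ennreal (((5 * a + A * remaining_time K T) + 5 * ln (3 * u / 2) * p) + 1)"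
    using a lnu H by (subst ennreal_plus) (auto simp: p_def remaining_time_nonneg)
  also have "\<dots> \<le> ennreal (potential R U K A (T, H))"
  proof (rule ennreal_leI)
    have "log_level R U H = u" using H u by (auto simp: log_level_def)
    then have pot: "potential R U K A (T, H) = 5 * (ln (2 * U) - ln u) + A * remaining_time K T"
      by (simp add: potential_def)
    have ln_u: "ln (3 * u / 2) = ln (3 / 2) + ln u"
      using u ln_mult[of "3/2" u] by simp
    have gain: "1 / 3 \<le> ln (3 / 2 :: real)"
      using ln_diff_le[of 1 "3/2"] by simp
    have loss: "5 * ln (3 * u / 2) * p \<le> 1 / 2" using u by (simp add: p_def mult.commute)
    have "5 * (x - (y + z)) + t + q + 1 \<le> 5 * (x - z) + t" if "1 / 3 \<le> y" "q \<le> 1 / 2"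
      for x y z t q :: real using that by (simp add: algebra_simps)
    from this[OF gain loss] show "5 * a + A * remaining_time K T + 5 * ln (3 * u / 2) * p + 1 \<le> potential R U K A (T, H)"
      unfolding pot a_def by (simp only: ln_u)
  qed
  finally show ?thesis by (simp add: add_right_mono)
qed

text \<open>From a large distance the level may be lost entirely, so progress must come from time.
  With probability at least one half the step lasts longer than \<open>c\<close> and uses up at
  least \<open>min c K\<close> of the remaining time. \<open>A\<close> is such that half of
  \<open>A * min c K\<close> pays for a fall of the level from \<open>u0\<close> to \<open>1\<close>
  and for the required decrease by one.\<close>

lemma potential_drop_large:
  assumes H: "0 < H" "T < K" "0 < r" "r \<le> R" "0 < K" and U: "1 \<le> u0" "u0 \<le> U"
    and u: "- ln (R * H) \<le> u0"
    and c: "c = (exp (- u0) / (6 * R))\<^sup>2"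
    and A: "A = 2 * (5 * ln u0 + 1) / min c K"
  shows "(\<integral>\<^sup>+g. ennreal (potential R U K A (update \<phi> r (T, H) g)) \<partial>inverse_gaussian (H / r) (H\<^sup>2)) + 1
    \<le> ennreal (potential R U K A (T, H))"
proof -
  have R: "0 < R" using H by linarith
  interpret G: prob_space "inverse_gaussian (H / r) (H\<^sup>2)"
    using H by (intro prob_space_inverse_gaussian) auto
  define m where "m = min c K"
  have c0: "0 < c" "sqrt c = exp (- u0) / (6 * R)" using R by (simp_all add: c)
  have m: "0 < m" "m \<le> c" "m \<le> K" using c0 H by (auto simp: m_def)
  have A0: "0 < A" "A * m = 2 * (5 * ln u0 + 1)"
    using m U by (simp_all add: A m_def[symmetric] add_nonneg_pos)
  have RH: "exp (- u0) \<le> R * H"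
    using u R H by (metis exp_le_cancel_iff exp_ln minus_le_iff mult_pos_pos)
  have "exp (- u0) \<le> 1" using U by simp
  have Tm: "m \<le> remaining_time K T" using m H by (auto simp: remaining_time_def)
  have alpha: "0 \<le> 5 * ln (2 * U) + A * (remaining_time K T - m)"
    using U A0 Tm by (intro add_nonneg_nonneg mult_nonneg_nonneg) auto
  have "(\<integral>\<^sup>+g. ennreal (potential R U K A (update \<phi> r (T, H) g)) \<partial>inverse_gaussian (H / r) (H\<^sup>2))
    \<le> ennreal ((5 * ln (2 * U) + A * (remaining_time K T - m)) + A * m * (1 / 2))"
  proof (rule G.nn_integral_le_indicator[where S="{..c}"])
    show "AE g in inverse_gaussian (H / r) (H\<^sup>2). potential R U K A (update \<phi> r (T, H) g)
      \<le> (5 * ln (2 * U) + A * (remaining_time K T - m)) + A * m * indicator {..c} g"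
      using AE_inverse_gaussian_pos
    proof eventually_elim
      fix g :: real assume g: "0 < g"
      have "0 \<le> ln (log_level R U (snd (update \<phi> r (T, H) g)))"
        using log_level_bounds(1)[of U R] U by simp
      moreover have "A * remaining_time K (g + T) \<le> A * ((remaining_time K T - m) + m * indicator {..c} g)"
        using remaining_time_le[of g K T] g H A0 m by (intro mult_left_mono) (auto simp: indicator_def)
      ultimately show "potential R U K A (update \<phi> r (T, H) g)
        \<le> (5 * ln (2 * U) + A * (remaining_time K T - m)) + A * m * indicator {..c} g"
        by (simp add: potential_def update_def algebra_simps)
    qed
    \<comment> \<open>The \<open>6\<close> in \<open>c\<close> is chosen for this bound: the lower
      tail is at most \<open>64 / 6 ^ 3 = 8 / 27\<close>, below one half.\<close>
    have "sqrt c / H = exp (- u0) / (R * H) / 6" using c0 by simp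
    also have "\<dots> \<le> 1 / 6" using RH R H by (simp add: divide_simps)
    finally have "64 * (sqrt c / H) ^ 3 \<le> 64 * (1 / 6) ^ 3"
      using c0 H by (intro mult_left_mono power_mono) auto
    then have "64 * (sqrt c / H) ^ 3 \<le> 1 / 2" by (simp add: power3_eq_cube)
    moreover have "emeasure (inverse_gaussian (H / r) (H\<^sup>2)) {..c} \<le> ennreal (64 * (sqrt c / H) ^ 3)"
    proof (rule inverse_gaussian_lower_tail[OF H(1,3) c0(1)])
      have "r * c \<le> R * c" using H c0 by simp
      also have "\<dots> = exp (- u0) * exp (- u0) / (36 * R)"
        using R by (simp add: c power2_eq_square)
      also have "\<dots> \<le> 1 * (R * H) / (36 * R)"
        using R RH \<open>exp (- u0) \<le> 1\<close> by (intro divide_right_mono mult_mono) auto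
      also have "\<dots> \<le> H / 2" using R H by simp
      finally show "r * c \<le> H / 2" .
    qed
    ultimately show "emeasure (inverse_gaussian (H / r) (H\<^sup>2)) {..c} \<le> ennreal (1 / 2)"
      by (meson ennreal_leI order_trans)
  qed (use alpha A0(1) m in auto)
  also have "\<dots> + 1 = ennreal (((5 * ln (2 * U) + A * (remaining_time K T - m)) + A * m * (1 / 2)) + 1)"
    using alpha mult_pos_pos[OF A0(1) m(1)] by (subst (2) ennreal_plus) auto
  also have "\<dots> \<le> ennreal (potential R U K A (T, H))"
  proof (rule ennreal_leI)
    have "log_level R U H \<le> u0" using H u U by (auto simp: log_level_def)
    then have "ln (log_level R U H) \<le> ln u0"
      using log_level_bounds(1)[of U R H] U by (subst ln_le_cancel_iff) auto
    then show "(5 * ln (2 * U) + A * (remaining_time K T - m)) + A * m * (1 / 2) + 1 \<le> potential R U K A (T, H)"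
      using A0(2) by (simp add: potential_def algebra_simps)
  qed
  finally show ?thesis by (simp add: add_right_mono)
qed

text \<open>A predicate, so that \<open>C\<close> and \<open>u0\<close> are visibly fixed before the
  boundary and all parameters, including the rate \<open>R\<close>.\<close>

definition running_bound :: "real \<Rightarrow> real \<Rightarrow> bool" where
  "running_bound C u0 \<longleftrightarrow> (\<forall>\<phi> \<epsilon> K r R. 0 < \<epsilon> \<longrightarrow> 0 < K \<longrightarrow> 0 < r \<longrightarrow> r \<le> R \<longrightarrow> continuous_on {0..} \<phi> \<longrightarrow>
    (\<forall>T H g. 0 < g \<longrightarrow> snd (update \<phi> r (T, H) g) \<le> R * g) \<longrightarrow>
    (\<Sum>n. emeasure (trajectory_law \<phi> \<epsilon> K r) {x. running \<epsilon> K (x n)})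
      \<le> ennreal (C * (1 + R\<^sup>2 * K + ln (2 * (u0 + \<bar>ln (R * \<epsilon>)\<bar>)))))"

lemma running_boundD:
  assumes "running_bound C u0" "0 < \<epsilon>" "0 < K" "0 < r" "r \<le> R" "continuous_on {0..} \<phi>"
    "\<And>T H g. 0 < g \<Longrightarrow> snd (update \<phi> r (T, H) g) \<le> R * g"
  shows "(\<Sum>n. emeasure (trajectory_law \<phi> \<epsilon> K r) {x. running \<epsilon> K (x n)})
    \<le> ennreal (C * (1 + R\<^sup>2 * K + ln (2 * (u0 + \<bar>ln (R * \<epsilon>)\<bar>))))"
  using assms unfolding running_bound_def by blast

text \<open>A running state falls under \<open>potential_drop_small\<close> or
  \<open>potential_drop_large\<close> according to whether its level reaches \<open>u0\<close>; the
  sum is then at most the potential of the initial state.\<close>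

theorem sum_running_bound:
  obtains C u0 :: real where "0 < C" "1 \<le> u0" "running_bound C u0"
proof -
  \<comment> \<open>From \<open>u0\<close> on, the tail \<open>exp (- u / 4)\<close> outweighs the
    logarithmic cost of an exceptional step.\<close>
  have "eventually (\<lambda>u :: real. 1 \<le> u \<and> 3 * exp (- u / 4) * ln (3 * u / 2) \<le> 1 / 10) at_top"
    by (intro eventually_conj eventually_ge_at_top) real_asymp
  then obtain u0 :: real where u0: "\<And>u. u0 \<le> u \<Longrightarrow> 1 \<le> u \<and> 3 * exp (- u / 4) * ln (3 * u / 2) \<le> 1 / 10"
    unfolding eventually_at_top_linorder by blast
  have u01: "1 \<le> u0" using u0[of u0] by simp
  \<comment> \<open>\<open>D\<close> and \<open>E\<close> are the constants in
    \<open>A * (2 * K) = D * (K / min c K)\<close> and \<open>K / c = E * (R\<^sup>2 * K)\<close>,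
    for \<open>A\<close> and \<open>c\<close> as below.\<close>
  define D where "D = 4 * (5 * ln u0 + 1)"
  define E where "E = 36 / (exp (- u0))\<^sup>2"
  have D: "0 < D" using u01 by (simp add: D_def add_nonneg_pos)
  have "(exp (- u0))\<^sup>2 \<le> 1\<^sup>2" using u01 by (intro power_mono) auto
  then have E: "1 \<le> E" by (simp add: E_def)
  show thesis
  proof (rule that[of "5 + D * E" u0])
    show "running_bound (5 + D * E) u0" unfolding running_bound_def
    proof (intro allI impI)
      fix \<phi> :: "real \<Rightarrow> real" and \<epsilon> K r R :: real
      assume *: "0 < \<epsilon>" "0 < K" "0 < r" "r \<le> R" "continuous_on {0..} \<phi>"
        "\<forall>T H g. 0 < g \<longrightarrow> snd (update \<phi> r (T, H) g) \<le> R * g"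
      \<comment> \<open>At a running state \<open>\<epsilon> < H\<close>, so its level
        \<open>u\<close> is at most \<open>\<bar>ln (R * \<epsilon>)\<bar>\<close>; adding
        \<open>u0\<close> keeps \<open>U\<close> at or above the threshold.\<close>
      define U where "U = u0 + \<bar>ln (R * \<epsilon>)\<bar>"
      define c where "c = (exp (- u0) / (6 * R))\<^sup>2"
      define A where "A = 2 * (5 * ln u0 + 1) / min c K"
      have R: "0 < R" using * by linarith
      have c: "0 < c" using R by (simp add: c_def)
      have A: "0 \<le> A" using u01 c * by (simp add: A_def)
      have U: "u0 \<le> U" by (simp add: U_def)
      note meas = measurable_update_at[OF *(5)]
      have "(\<Sum>n. emeasure (trajectory_law \<phi> \<epsilon> K r) {x. running \<epsilon> K (x n)})
          \<le> ennreal (potential R U K A (0, \<phi> 0))"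
      proof (rule sum_running_le_potential[OF *(1,3,5)])
        fix s assume s: "running \<epsilon> K s"
        obtain T H where [simp]: "s = (T, H)" by (cases s)
        have TH: "\<epsilon> < H" "T < K" using s by (auto simp: running_def)
        have int: "(\<integral>\<^sup>+y. ennreal (potential R U K A y) \<partial>step_kernel \<phi> \<epsilon> K r s)
          = (\<integral>\<^sup>+g. ennreal (potential R U K A (update \<phi> r (T, H) g)) \<partial>inverse_gaussian (H / r) (H\<^sup>2))"
          using s meas[of r s] by (simp add: step_kernel_def) (subst nn_integral_distr; simp)
        define u where "u = - ln (R * H)"
        have "R * \<epsilon> \<le> R * H" using R TH by simp
        then have "ln (R * \<epsilon>) \<le> ln (R * H)" using R * TH by (subst ln_le_cancel_iff) auto
        then have uU: "u \<le> U" using u01 by (simp add: U_def u_def)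
        show "(\<integral>\<^sup>+y. ennreal (potential R U K A y) \<partial>step_kernel \<phi> \<epsilon> K r s) + 1 \<le> ennreal (potential R U K A s)"
        proof (cases "u0 \<le> u")
          case True
          with u0[OF True] uU A * TH show ?thesis
            unfolding int by simp (rule potential_drop_small[OF _ _ _ _ _ _ u_def], auto)
        next
          case False
          with * TH u01 U show ?thesis
            unfolding int by simp (rule potential_drop_large[OF _ _ _ _ _ _ _ _ c_def A_def], auto simp: u_def)
        qed
      qed measurable
      also have "\<dots> \<le> ennreal ((5 + D * E) * (1 + R\<^sup>2 * K + ln (2 * U)))"
      proof (rule ennreal_leI)
        have "0 \<le> ln (log_level R U (\<phi> 0))"
          using log_level_bounds(1)[of U R] U u01 by simp
        then have "potential R U K A (0, \<phi> 0) \<le> 5 * ln (2 * U) + A * (2 * K)"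
          using * by (simp add: potential_def remaining_time_def)
        also have "A * (2 * K) = D * (K / min c K)" by (simp add: A_def D_def)
        also have "D * (K / min c K) \<le> D * (E * (1 + R\<^sup>2 * K))"
        proof (rule mult_left_mono)
          have "K / min c K \<le> 1 + K / c" using c * by (simp add: min_def)
          also have "K / c = E * (R\<^sup>2 * K)" by (simp add: c_def E_def power_divide field_simps)
          also have "1 + E * (R\<^sup>2 * K) \<le> E * (1 + R\<^sup>2 * K)" using E by (simp add: algebra_simps)
          finally show "K / min c K \<le> E * (1 + R\<^sup>2 * K)" .
        qed (use D in simp)
        finally have bound: "potential R U K A (0, \<phi> 0) \<le> 5 * ln (2 * U) + D * (E * (1 + R\<^sup>2 * K))"
          by simp
        moreover have "0 \<le> ln (2 * U)" using U u01 by simp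
        moreover have "0 \<le> R\<^sup>2 * K" using * by simp
        ultimately show "potential R U K A (0, \<phi> 0) \<le> (5 + D * E) * (1 + R\<^sup>2 * K + ln (2 * U))"
        proof -
          have "x \<le> (5 + D * E) * (1 + y + z)" if "x \<le> 5 * z + D * (E * (1 + y))" "0 \<le> y" "0 \<le> z" for x y z :: real
          proof -
            have "0 \<le> D * E * z" using D E that by (intro mult_nonneg_nonneg) auto
            with that show ?thesis by (simp add: algebra_simps)
          qed
          then show ?thesis using bound \<open>0 \<le> ln (2 * U)\<close> \<open>0 \<le> R\<^sup>2 * K\<close> by blast
        qed
      qed
      finally show "(\<Sum>n. emeasure (trajectory_law \<phi> \<epsilon> K r) {x. running \<epsilon> K (x n)})
          \<le> ennreal ((5 + D * E) * (1 + R\<^sup>2 * K + ln (2 * (u0 + \<bar>ln (R * \<epsilon>)\<bar>))))"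
        by (simp add: U_def)
    qed
  qed (use D E u01 in \<open>auto intro: add_pos_pos\<close>)
qed

section \<open>Expected number of iterations\<close>

text \<open>By the mean value theorem; from here on the derivative enters only through continuity
  and the two bounds on increments.\<close>

lemma bounded_derivativeD:
  assumes "bounded_derivative \<phi> \<rho>p \<rho>m"
  shows "0 < \<rho>p" "0 < \<rho>m" "continuous_on {0..} \<phi>"
    "\<And>s t. 0 \<le> s \<Longrightarrow> s \<le> t \<Longrightarrow> \<phi> t - \<phi> s \<le> \<rho>p * (t - s)"
    "\<And>s t. 0 \<le> s \<Longrightarrow> s \<le> t \<Longrightarrow> - (\<rho>m * (t - s)) \<le> \<phi> t - \<phi> s"
proof -
  obtain \<phi>' where \<phi>': "\<And>t. 0 \<le> t \<Longrightarrow> (\<phi> has_real_derivative \<phi>' t) (at t within {0..})"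
    and sup: "(SUP t\<in>{0..}. ereal (\<phi>' t)) \<le> ereal \<rho>p"
    and inf: "(INF t\<in>{0..}. ereal (\<phi>' t)) \<ge> ereal (- \<rho>m)"
    using assms unfolding bounded_derivative_def by blast
  show "0 < \<rho>p" "0 < \<rho>m" using assms unfolding bounded_derivative_def by auto
  show "continuous_on {0..} \<phi>"
    using \<phi>' by (auto simp: continuous_on_eq_continuous_within intro: DERIV_continuous)
  have le: "\<phi>' t \<le> \<rho>p" "- \<rho>m \<le> \<phi>' t" if "0 \<le> t" for t
    using sup inf that by (auto simp: SUP_le_iff le_INF_iff)
  have mvt: "\<exists>x. 0 \<le> x \<and> \<phi> t - \<phi> s = \<phi>' x * (t - s)" if "0 \<le> s" "s < t" for s t
  proof -
    have "\<exists>x\<in>{s<..<t}. \<phi> t - \<phi> s = (*) (\<phi>' x) (t - s)"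
      using that \<phi>' has_field_derivative_subset[of \<phi> _ _ "{0..}" "{s..t}"]
      by (intro mvt_simple) (auto simp: has_field_derivative_def[symmetric])
    then obtain x where "s < x" "\<phi> t - \<phi> s = \<phi>' x * (t - s)" by auto
    then show ?thesis using that by (intro exI[of _ x]) auto
  qed
  show "\<phi> t - \<phi> s \<le> \<rho>p * (t - s)" "- (\<rho>m * (t - s)) \<le> \<phi> t - \<phi> s" if st: "0 \<le> s" "s \<le> t" for s t
  proof (atomize (full), cases "s = t")
    case False
    then obtain x where x: "0 \<le> x" "\<phi> t - \<phi> s = \<phi>' x * (t - s)" using mvt[of s t] st by auto
    have "\<phi>' x * (t - s) \<le> \<rho>p * (t - s)" "(- \<rho>m) * (t - s) \<le> \<phi>' x * (t - s)"
      using le[OF x(1)] st by (intro mult_right_mono; simp)+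
    then show "\<phi> t - \<phi> s \<le> \<rho>p * (t - s) \<and> - (\<rho>m * (t - s)) \<le> \<phi> t - \<phi> s" using x by simp
  qed simp
qed

text \<open>Clamping at \<open>0\<close> is 1-Lipschitz, so the rate \<open>r + \<rho>\<close> is
  valid at every \<open>T\<close>, also at negative ones, as \<open>running_bound\<close>
  demands.\<close>

lemma update_le_slope:
  assumes "\<And>s t. 0 \<le> s \<Longrightarrow> s \<le> t \<Longrightarrow> \<phi> t - \<phi> s \<le> \<rho> * (t - s)" "0 \<le> \<rho>" "0 < g"
  shows "snd (update \<phi> r (T, H) g) \<le> (r + \<rho>) * g"
proof -
  have "\<phi> (max 0 (T + g)) - \<phi> (max 0 T) \<le> \<rho> * (max 0 (T + g) - max 0 T)"
    using assms by (intro assms(1)) auto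
  also have "\<dots> \<le> \<rho> * g" using assms by (intro mult_left_mono) auto
  finally show ?thesis by (simp add: update_def algebra_simps)
qed

text \<open>Taken with \<open>R = r + 1\<close> and \<open>\<kappa>0 = \<kappa>1 = 1\<close>: then
  \<open>(r + 1)\<^sup>2 * K \<le> r + 1\<close> is linear in \<open>r\<close>. The outer logarithm
  is bounded by its argument, and \<open>\<epsilon> \<le> exp (- 1)\<close> makes
  \<open>\<bar>ln \<epsilon>\<bar> \<ge> 1\<close>, which absorbs the additive constants.\<close>

theorem expected_iterations_small_slope:
  "\<exists>a>0. \<exists>b>0. \<exists>\<kappa>0>0. \<exists>\<kappa>1>0. \<exists>\<epsilon>0>0.
    \<forall>\<phi> \<rho>p \<rho>m K r.
      bounded_derivative \<phi> \<rho>p \<rho>m \<longrightarrow> 0 < \<phi> 0 \<longrightarrow> 0 < K \<longrightarrow> \<rho>m < r \<longrightarrow>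
      \<rho>p \<le> \<kappa>0 \<longrightarrow> (r + \<kappa>0) * K \<le> \<kappa>1 \<longrightarrow>
      (\<forall>\<epsilon>. 0 < \<epsilon> \<longrightarrow> \<epsilon> \<le> \<epsilon>0 \<longrightarrow>
         expected_iterations \<phi> \<epsilon> K r \<le> ennreal ((a + b * r) * \<bar>ln \<epsilon>\<bar>))"
proof -
  obtain C u0 :: real where C: "0 < C" "1 \<le> u0"
    and "running_bound C u0"
    by (rule sum_running_bound)
  note bound = running_boundD[OF \<open>running_bound C u0\<close>]
  have main: "expected_iterations \<phi> \<epsilon> K r \<le> ennreal ((C * (6 + 2 * u0) + (3 * C) * r) * \<bar>ln \<epsilon>\<bar>)"
    if \<phi>: "bounded_derivative \<phi> \<rho>p \<rho>m" and "0 < K" "\<rho>m < r" "\<rho>p \<le> 1" "(r + 1) * K \<le> 1"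
      and \<epsilon>: "0 < \<epsilon>" "\<epsilon> \<le> exp (- 1)" for \<phi> \<rho>p \<rho>m K r \<epsilon>
  proof -
    note \<phi>D = bounded_derivativeD[OF \<phi>]
    have r: "0 < r" using \<phi>D that by linarith
    have slope: "\<phi> t - \<phi> s \<le> 1 * (t - s)" if "0 \<le> s" "s \<le> t" for s t
      using \<phi>D(4)[OF that] mult_right_mono[OF \<open>\<rho>p \<le> 1\<close>, of "t - s"] that by simp
    have l: "ln \<epsilon> \<le> - 1" using \<epsilon> ln_le_cancel_iff[of \<epsilon> "exp (-1)"] by simp
    have "expected_iterations \<phi> \<epsilon> K r \<le> (\<Sum>n. emeasure (trajectory_law \<phi> \<epsilon> K r) {x. running \<epsilon> K (x n)})"
      using \<epsilon> r \<phi>D by (intro expected_iterations_le)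
    also have "\<dots> \<le> ennreal (C * (1 + (r + 1)\<^sup>2 * K + ln (2 * (u0 + \<bar>ln ((r + 1) * \<epsilon>)\<bar>))))"
      using \<epsilon> r \<phi>D that update_le_slope[OF slope, of _ r] by (intro bound) auto
    also have "\<dots> \<le> ennreal ((C * (6 + 2 * u0) + (3 * C) * r) * \<bar>ln \<epsilon>\<bar>)"
    proof (rule ennreal_leI)
      have "(r + 1)\<^sup>2 * K = (r + 1) * ((r + 1) * K)" by (simp add: power2_eq_square)
      also have "\<dots> \<le> (r + 1) * 1" using r that by (intro mult_left_mono) auto
      finally have 1: "(r + 1)\<^sup>2 * K \<le> r + 1" by simp
      have "ln ((r + 1) * \<epsilon>) = ln (r + 1) + ln \<epsilon>" using r \<epsilon> by (simp add: ln_mult)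
      moreover have "0 \<le> ln (r + 1)" "ln (r + 1) \<le> r" using r ln_add_one_self_le_self[of r] by (auto simp: add.commute)
      ultimately have 2: "\<bar>ln ((r + 1) * \<epsilon>)\<bar> \<le> r + \<bar>ln \<epsilon>\<bar>" by linarith
      have 3: "ln (2 * (u0 + \<bar>ln ((r + 1) * \<epsilon>)\<bar>)) \<le> 2 * (u0 + \<bar>ln ((r + 1) * \<epsilon>)\<bar>)"
        using C by (intro ln_bound) auto
      have "1 + x + y \<le> (2 + 3 * r + 2 * u0) * 1 + 2 * l"
        if "x \<le> r + 1" "y \<le> 2 * (u0 + z)" "z \<le> r + l" for x y z l :: real
        using that by (simp add: algebra_simps)
      from this[OF 1 3 2] have "1 + (r + 1)\<^sup>2 * K + ln (2 * (u0 + \<bar>ln ((r + 1) * \<epsilon>)\<bar>)) \<le> (2 + 3 * r + 2 * u0) * 1 + 2 * \<bar>ln \<epsilon>\<bar>" .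
      also have "\<dots> \<le> (2 + 3 * r + 2 * u0) * \<bar>ln \<epsilon>\<bar> + 2 * \<bar>ln \<epsilon>\<bar>"
        using l C r by (intro add_right_mono mult_left_mono) auto
      also have "\<dots> \<le> (6 + 2 * u0 + 3 * r) * \<bar>ln \<epsilon>\<bar>" by (simp add: algebra_simps)
      finally show "C * (1 + (r + 1)\<^sup>2 * K + ln (2 * (u0 + \<bar>ln ((r + 1) * \<epsilon>)\<bar>))) \<le> (C * (6 + 2 * u0) + (3 * C) * r) * \<bar>ln \<epsilon>\<bar>"
        using C mult_left_mono[of _ _ C] by (fastforce simp: algebra_simps)
    qed
    finally show ?thesis .
  qed
  show ?thesis
    by (rule exI[of _ "C * (6 + 2 * u0)"], rule conjI, use C in \<open>simp add: add_pos_nonneg\<close>,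
        rule exI[of _ "3 * C"], rule conjI, use C in simp,
        rule exI[of _ 1], rule conjI, simp, rule exI[of _ 1], rule conjI, simp,
        rule exI[of _ "exp (- 1)"], rule conjI, simp) (use main in blast)
qed

text \<open>A non-increasing boundary adds nothing to the distance, so \<open>R = r\<close>. The
  bound is doubly logarithmic in \<open>\<epsilon>\<close>, hence below
  \<open>r\<^sup>2 * K * \<bar>ln \<epsilon>\<bar>\<close> once \<open>\<epsilon>\<close> is small;
  this gives \<open>a = 1\<close>, with \<open>\<epsilon>0\<close> depending on \<open>K\<close> and
  \<open>r\<close>.\<close>

theorem expected_iterations_antimono:
  "\<exists>a>0. \<forall>K>0. \<forall>r>0. \<exists>\<epsilon>0>0.
    \<forall>\<phi> \<rho>p \<rho>m.
      bounded_derivative \<phi> \<rho>p \<rho>m \<longrightarrow> 0 < \<phi> 0 \<longrightarrow> antimono_on {0..} \<phi> \<longrightarrow> \<rho>m < r \<longrightarrow>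
      (\<forall>\<epsilon>. 0 < \<epsilon> \<longrightarrow> \<epsilon> \<le> \<epsilon>0 \<longrightarrow>
         expected_iterations \<phi> \<epsilon> K r \<le> ennreal (a * r\<^sup>2 * K * \<bar>ln \<epsilon>\<bar>))"
proof -
  obtain C u0 :: real where C: "0 < C" "1 \<le> u0"
    and "running_bound C u0"
    by (rule sum_running_bound)
  note bound = running_boundD[OF \<open>running_bound C u0\<close>]
  have "\<exists>\<epsilon>0>0. \<forall>\<phi> \<rho>p \<rho>m.
      bounded_derivative \<phi> \<rho>p \<rho>m \<longrightarrow> 0 < \<phi> 0 \<longrightarrow> antimono_on {0..} \<phi> \<longrightarrow> \<rho>m < r \<longrightarrow>
      (\<forall>\<epsilon>. 0 < \<epsilon> \<longrightarrow> \<epsilon> \<le> \<epsilon>0 \<longrightarrow>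
         expected_iterations \<phi> \<epsilon> K r \<le> ennreal (1 * r\<^sup>2 * K * \<bar>ln \<epsilon>\<bar>))" if K: "0 < K" and r: "0 < r" for K r :: real
  proof -
    have "eventually (\<lambda>\<epsilon>. C * (1 + r\<^sup>2 * K + ln (2 * (u0 + \<bar>ln (r * \<epsilon>)\<bar>))) \<le> r\<^sup>2 * K * \<bar>ln \<epsilon>\<bar>) (at_right 0)"
      using C K r by real_asymp
    then obtain \<epsilon>1 where \<epsilon>1: "0 < \<epsilon>1" "\<And>\<epsilon>. 0 < \<epsilon> \<Longrightarrow> \<epsilon> < \<epsilon>1 \<Longrightarrow>
        C * (1 + r\<^sup>2 * K + ln (2 * (u0 + \<bar>ln (r * \<epsilon>)\<bar>))) \<le> r\<^sup>2 * K * \<bar>ln \<epsilon>\<bar>"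
      by (auto simp: eventually_at_right_field)
    show ?thesis
    \<comment> \<open>Half of \<open>\<epsilon>1\<close>, because the asymptotic estimate is
      available for \<open>\<epsilon> < \<epsilon>1\<close> only.\<close>
    proof (intro exI[of _ "\<epsilon>1 / 2"] conjI allI impI)
      fix \<phi> :: "real \<Rightarrow> real" and \<rho>p \<rho>m \<epsilon> :: real
      assume \<phi>: "bounded_derivative \<phi> \<rho>p \<rho>m" "antimono_on {0..} \<phi>" and \<epsilon>: "0 < \<epsilon>" "\<epsilon> \<le> \<epsilon>1 / 2"
      note \<phi>D = bounded_derivativeD[OF \<phi>(1)]
      have slope: "\<phi> t - \<phi> s \<le> 0 * (t - s)" if "0 \<le> s" "s \<le> t" for s t
        using \<phi>(2) that by (auto simp: monotone_on_def)
      have "expected_iterations \<phi> \<epsilon> K r \<le> (\<Sum>n. emeasure (trajectory_law \<phi> \<epsilon> K r) {x. running \<epsilon> K (x n)})"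
        using \<epsilon> r \<phi>D by (intro expected_iterations_le)
      also have "\<dots> \<le> ennreal (C * (1 + r\<^sup>2 * K + ln (2 * (u0 + \<bar>ln (r * \<epsilon>)\<bar>))))"
        using \<epsilon> r K \<phi>D update_le_slope[OF slope, of _ r] by (intro bound) auto
      also have "\<dots> \<le> ennreal (1 * r\<^sup>2 * K * \<bar>ln \<epsilon>\<bar>)"
        using \<epsilon>1(2)[of \<epsilon>] \<epsilon> \<epsilon>1(1) by (intro ennreal_leI) auto
      finally show "expected_iterations \<phi> \<epsilon> K r \<le> ennreal (1 * r\<^sup>2 * K * \<bar>ln \<epsilon>\<bar>)" .
    qed (use \<epsilon>1 in simp)
  qed
  then show ?thesis by (intro exI[of _ 1] conjI) auto
qed

section \<open>The Markov property\<close>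

text \<open>Finite-dimensional events are to be expressed by increments over disjoint intervals; for
  this their times are placed on one strictly increasing grid.\<close>

lemma obtain_time_grid:
  fixes S :: "real set"
  assumes S: "finite S" "S \<subseteq> {0..c}" and c: "0 < c"
  obtains t :: "nat \<Rightarrow> real" and m where "0 < m" "t 0 = 0" "t m = c" "\<And>i. i < m \<Longrightarrow> t i < t (Suc i)"
    "S \<subseteq> t ` {..m}"
proof -
  define xs where "xs = sorted_list_of_set (insert 0 (insert c S))"
  have set: "set xs = insert 0 (insert c S)" 
    unfolding xs_def by (rule set_sorted_list_of_set) (use S in simp)
  have sorted: "sorted_wrt (<) xs" unfolding xs_def by (rule strict_sorted_list_of_set)
  define m where "m = length xs - 1"
  have "card {0, c} \<le> card (set xs)" unfolding set using S by (intro card_mono) auto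
  also have "\<dots> \<le> length xs" by (rule card_length)
  finally have len: "length xs = Suc m" "0 < m" using c by (auto simp: m_def)
  have less: "xs ! i < xs ! j" if "i < j" "j \<le> m" for i j
    using sorted that len by (auto simp: sorted_wrt_iff_nth_less)
  have le: "xs ! i \<le> xs ! j" if "i \<le> j" "j \<le> m" for i j
    using less[of i j] that by (cases "i = j") auto
  have mem: "xs ! i \<in> {0..c}" if "i \<le> m" for i
    using nth_mem[of i xs] that len set S c by auto
  have img: "insert 0 (insert c S) = (!) xs ` {..m}"
    using set by (auto simp: set_conv_nth len image_iff less_Suc_eq_le)
  have "0 \<in> (!) xs ` {..m}" "c \<in> (!) xs ` {..m}" by (simp_all flip: img)
  then obtain i j where ij: "i \<le> m" "xs ! i = 0" "j \<le> m" "xs ! j = c" by auto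
  show thesis
  proof (rule that)
    show "xs ! 0 = 0" using le[of 0 i] mem[of 0] ij by auto
    show "xs ! m = c" using le[of j m] mem[of m] ij by auto
    show "S \<subseteq> (!) xs ` {..m}" using img by auto
  qed (use less len in auto)
qed

lemma grid_nonneg:
  fixes t :: "nat \<Rightarrow> real"
  assumes "0 \<le> t 0" "\<And>i. i < n \<Longrightarrow> t i < t (Suc i)" "i \<le> n"
  shows "0 \<le> t i"
  using assms(3)
proof (induction i)
  case (Suc i)
  then show ?case using assms(2)[of i] by simp
qed (rule assms(1))

lemma restrict_in_prod_emb_iff:
  assumes "J \<subseteq> I"
  shows "restrict f I \<in> prod_emb I (\<lambda>_. borel :: 'b::topological_space measure) J (Pi\<^sub>E J F) \<longleftrightarrow> (\<forall>j\<in>J. f j \<in> F j)"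
proof -
  have "restrict (restrict f I) J = restrict f J" using assms by (auto simp: restrict_def fun_eq_iff)
  then show ?thesis by (auto simp: prod_emb_def)
qed

lemma sets_partial_sums:
  fixes f :: "nat \<Rightarrow> nat" and A :: "nat \<Rightarrow> real set"
  assumes "finite K" "\<And>i. i \<in> K \<Longrightarrow> A i \<in> sets borel" "\<And>i l. i \<in> K \<Longrightarrow> l < i \<Longrightarrow> f l \<in> I"
  shows "{d\<in>space (PiM I (\<lambda>_. borel :: real measure)). \<forall>i\<in>K. (\<Sum>l<i. d (f l)) \<in> A i} \<in> sets (PiM I (\<lambda>_. borel))"
proof (intro sets.sets_Collect_finite_All assms(1))
  fix i assume i: "i \<in> K"
  have "(\<lambda>d. \<Sum>l<i. d (f l)) \<in> borel_measurable (PiM I (\<lambda>_. borel :: real measure))"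
    using assms(3)[OF i] by (intro borel_measurable_sum measurable_component_singleton) auto
  from measurable_sets[OF this assms(2)[OF i]]
  show "{d \<in> space (PiM I (\<lambda>_. borel)). (\<Sum>l<i. d (f l)) \<in> A i} \<in> sets (PiM I (\<lambda>_. borel))"
    by (auto simp: vimage_def Int_def conj_commute)
qed

section \<open>Stationarity and independence of increments, stated for past and future paths\<close>

context standard_brownian_motion
begin

text \<open>\<open>restrict\<close> makes it a point of the space of \<open>PiM {0..}\<close>, so
  that its laws for different \<open>c\<close> can be compared.\<close>

definition path :: "real \<Rightarrow> 'a \<Rightarrow> real \<Rightarrow> real" where
  "path c \<omega> = (\<lambda>s\<in>{0..}. B (c + s) \<omega> - B c \<omega>)"

text \<open>The natural filtration, without completion. As the pullback of a product sigma-algebra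
  it has an intersection-stable generator.\<close>

definition past :: "real \<Rightarrow> 'a measure" where
  "past c = vimage_algebra (space M) (\<lambda>\<omega>. \<lambda>s\<in>{0..c}. B s \<omega>) (PiM {0..c} (\<lambda>_. borel))"

lemma measurable_path: "0 \<le> c \<Longrightarrow> path c \<in> measurable M (PiM {0..} (\<lambda>_. borel))"
  unfolding path_def[abs_def]
  by (intro measurable_restrict borel_measurable_diff random_variable) auto

lemma measurable_initial_path: "(\<lambda>\<omega>. \<lambda>s\<in>{0..c}. B s \<omega>) \<in> measurable M (PiM {0..c} (\<lambda>_. borel))"
  by (intro measurable_restrict random_variable) auto

lemma space_past [simp]: "space (past c) = space M"
  by (simp add: past_def)

lemma sets_past:
  "sets (past c) = {(\<lambda>\<omega>. \<lambda>s\<in>{0..c}. B s \<omega>) -` A \<inter> space M | A. A \<in> sets (PiM {0..c} (\<lambda>_. borel))}"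
  unfolding past_def by (rule sets_vimage_algebra2) (auto simp: space_PiM)

lemma past_subset: "sets (past c) \<subseteq> sets M"
  unfolding sets_past using measurable_sets[OF measurable_initial_path] by auto

lemma measurable_past: "0 \<le> s \<Longrightarrow> s \<le> c \<Longrightarrow> B s \<in> borel_measurable (past c)"
proof -
  assume s: "0 \<le> s" "s \<le> c"
  have "(\<lambda>\<omega>. (\<lambda>\<omega>. \<lambda>s\<in>{0..c}. B s \<omega>) \<omega> s) \<in> borel_measurable (past c)"
    unfolding past_def using s
    by (intro measurable_compose[OF measurable_vimage_algebra1 measurable_component_singleton]) (auto simp: space_PiM)
  then show ?thesis using s by simp
qed

definition increments_law :: "(nat \<Rightarrow> real) \<Rightarrow> nat \<Rightarrow> (nat \<Rightarrow> real) measure" where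
  "increments_law t n = PiM {..<n} (\<lambda>i. density lborel (normal_density 0 (sqrt (t (Suc i) - t i))))"

lemma distr_increments:
  assumes c: "0 \<le> c" and t: "0 \<le> t 0" "0 < n" "\<And>i. i < n \<Longrightarrow> t i < t (Suc i)"
  shows "distr M (PiM {..<n} (\<lambda>_. borel)) (\<lambda>\<omega>. \<lambda>i\<in>{..<n}. B (c + t (Suc i)) \<omega> - B (c + t i) \<omega>)
    = increments_law t n"
proof -
  have t0: "0 \<le> t i" if "i \<le> n" for i
    by (rule grid_nonneg[of t n, OF t(1,3) that])
  have "indep_vars (\<lambda>_. borel) (\<lambda>i \<omega>. B (c + t (Suc i)) \<omega> - B (c + t i) \<omega>) {..<n}"
    using t c by (intro indep_increments[of "\<lambda>i. c + t i"]) (auto intro: less_imp_le)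
  then have "distr M (PiM {..<n} (\<lambda>_. borel)) (\<lambda>\<omega>. \<lambda>i\<in>{..<n}. B (c + t (Suc i)) \<omega> - B (c + t i) \<omega>)
    = PiM {..<n} (\<lambda>i. distr M borel (\<lambda>\<omega>. B (c + t (Suc i)) \<omega> - B (c + t i) \<omega>))"
    using t c t0 by (subst (asm) indep_vars_iff_distr_eq_PiM') (auto intro!: borel_measurable_diff random_variable add_nonneg_nonneg)
  also have "\<dots> = increments_law t n"
    unfolding increments_law_def
  proof (intro PiM_cong refl)
    fix i assume "i \<in> {..<n}"
    then have "distributed M lborel (\<lambda>\<omega>. B (c + t (Suc i)) \<omega> - B (c + t i) \<omega>) (normal_density 0 (sqrt ((c + t (Suc i)) - (c + t i))))"
      using c t t0[of i] by (intro increment) auto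
    then show "distr M borel (\<lambda>\<omega>. B (c + t (Suc i)) \<omega> - B (c + t i) \<omega>) = density lborel (normal_density 0 (sqrt (t (Suc i) - t i)))"
      by (auto dest!: distributed_distr_eq_density simp: distr_cong[OF refl sets_lborel[symmetric] refl])
  qed
  finally show ?thesis .
qed

lemma sum_increments: "(\<Sum>l<i. B (c + t (Suc l)) \<omega> - B (c + t l) \<omega>) = B (c + t i) \<omega> - B (c + t 0) \<omega>"
  by (rule sum_lessThan_telescope)

text \<open>The event depends on the path only through partial sums of increments over a grid, and
  the law of the increments depends only on the grid spacings. The same set \<open>S\<close> of
  increments serves for \<open>c\<close> and for \<open>0\<close>.\<close>

lemma path_fidi_stationary:
  assumes c: "0 \<le> c" and J: "finite J" "J \<subseteq> {0..}" and A: "\<And>j. j \<in> J \<Longrightarrow> A j \<in> sets borel"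
  shows "prob {\<omega>\<in>space M. \<forall>j\<in>J. path c \<omega> j \<in> A j} = prob {\<omega>\<in>space M. \<forall>j\<in>J. path 0 \<omega> j \<in> A j}"
proof -
  \<comment> \<open>\<open>insert 1\<close> keeps the end point of the grid positive when
    \<open>J\<close> contains no positive time.\<close>
  define b where "b = Max (insert 1 J)"
  have "J \<subseteq> {0..b}" "0 < b" using J by (auto simp: b_def Max_ge_iff less_le_trans[OF zero_less_one])
  then obtain t n where t: "0 < n" "t 0 = 0" "t n = b" "\<And>i. i < n \<Longrightarrow> t i < t (Suc i)" "J \<subseteq> t ` {..n}"
    using obtain_time_grid[OF J(1), of b] by metis
  define S where "S = {d\<in>space (PiM {..<n} (\<lambda>_. borel :: real measure)). \<forall>i\<in>{i. i \<le> n \<and> t i \<in> J}. (\<Sum>l<i. d l) \<in> A (t i)}"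
  have S: "S \<in> sets (PiM {..<n} (\<lambda>_. borel))"
    unfolding S_def using A by (intro sets_partial_sums[where f="\<lambda>l. l"]) auto
  have "prob {\<omega>\<in>space M. \<forall>j\<in>J. path c \<omega> j \<in> A j} = measure (increments_law t n) S" if c: "0 \<le> c" for c
  proof -
    have meas: "(\<lambda>\<omega>. \<lambda>i\<in>{..<n}. B (c + t (Suc i)) \<omega> - B (c + t i) \<omega>) \<in> measurable M (PiM {..<n} (\<lambda>_. borel))"
    proof -
      have "0 \<le> t i" if "i \<le> n" for i
        by (rule grid_nonneg[of t n, OF _ t(4) that]) (use t in simp)
      then show ?thesis using c by (intro measurable_restrict borel_measurable_diff random_variable) auto
    qed
    have "measure (increments_law t n) S
        = prob ((\<lambda>\<omega>. \<lambda>i\<in>{..<n}. B (c + t (Suc i)) \<omega> - B (c + t i) \<omega>) -` S \<inter> space M)"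
      using distr_increments[OF c, of t n] t S meas by (subst measure_distr[symmetric]) auto
    also have "(\<lambda>\<omega>. \<lambda>i\<in>{..<n}. B (c + t (Suc i)) \<omega> - B (c + t i) \<omega>) -` S \<inter> space M
        = {\<omega>\<in>space M. \<forall>j\<in>J. path c \<omega> j \<in> A j}"
    proof -
      have "(\<lambda>i\<in>{..<n}. B (c + t (Suc i)) \<omega> - B (c + t i) \<omega>) \<in> S \<longleftrightarrow> (\<forall>i\<in>{i. i \<le> n \<and> t i \<in> J}. path c \<omega> (t i) \<in> A (t i))" for \<omega>
      proof -
        have "(\<Sum>l<i. (\<lambda>i\<in>{..<n}. B (c + t (Suc i)) \<omega> - B (c + t i) \<omega>) l) = path c \<omega> (t i)" if "i \<le> n" "t i \<in> J" for i
          using that J t sum_increments[of c t \<omega> i] by (auto simp: path_def intro!: sum.cong[THEN trans])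
        then show ?thesis by (auto simp: S_def space_PiM)
      qed
      moreover have "(\<forall>i\<in>{i. i \<le> n \<and> t i \<in> J}. path c \<omega> (t i) \<in> A (t i)) \<longleftrightarrow> (\<forall>j\<in>J. path c \<omega> j \<in> A j)" for \<omega>
        using t(5) by auto
      ultimately show ?thesis by auto
    qed
    finally show ?thesis ..
  qed
  from this[OF c] this[of 0] show ?thesis by simp
qed

lemma distr_path_stationary:
  assumes c: "0 \<le> c"
  shows "distr M (PiM {0..} (\<lambda>_. borel)) (path c) = distr M (PiM {0..} (\<lambda>_. borel)) (path 0)"
proof (rule measure_eqI_PiM_infinite)
  fix A :: "real \<Rightarrow> real set" and J
  assume J: "finite J" "J \<subseteq> {0..}" and A: "\<And>i. i \<in> J \<Longrightarrow> A i \<in> sets borel"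
  have "emeasure (distr M (PiM {0..} (\<lambda>_. borel)) (path c)) (prod_emb {0..} (\<lambda>_. borel) J (Pi\<^sub>E J A))
    = prob {\<omega>\<in>space M. \<forall>j\<in>J. path c \<omega> j \<in> A j}" if "0 \<le> c" for c
  proof -
    have "path c -` prod_emb {0..} (\<lambda>_. borel) J (Pi\<^sub>E J A) \<inter> space M = {\<omega>\<in>space M. \<forall>j\<in>J. path c \<omega> j \<in> A j}"
      unfolding path_def using restrict_in_prod_emb_iff[OF J(2)] J(2) by (auto simp: subset_eq)
    then show ?thesis using J A measurable_path[OF that]
      by (subst emeasure_distr) (auto simp: emeasure_eq_measure intro!: sets_PiM_I)
  qed
  with path_fidi_stationary[OF c J A] c
  show "emeasure (distr M (PiM {0..} (\<lambda>_. borel)) (path c)) (prod_emb {0..} (\<lambda>_. borel) J (Pi\<^sub>E J A))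
    = emeasure (distr M (PiM {0..} (\<lambda>_. borel)) (path 0)) (prod_emb {0..} (\<lambda>_. borel) J (Pi\<^sub>E J A))"
    by simp
qed (auto intro!: prob_space.finite_measure prob_space_distr measurable_path c)

text \<open>Two grids are joined: one on \<open>[0, c]\<close> for the past and one shifted by
  \<open>c\<close> for the future. The increments over the joint grid are independent; past values
  are sums over the first block, values of the future path are sums over the second.\<close>

lemma past_future_fidi:
  assumes c: "0 < c" and J: "finite J" "J \<subseteq> {0..c}" and A: "\<And>j. j \<in> J \<Longrightarrow> A j \<in> sets borel"
    and J': "finite J'" "J' \<subseteq> {0..}" and A': "\<And>j. j \<in> J' \<Longrightarrow> A' j \<in> sets borel"
  shows "prob ({\<omega>\<in>space M. \<forall>j\<in>J. B j \<omega> \<in> A j} \<inter> {\<omega>\<in>space M. \<forall>j\<in>J'. path c \<omega> j \<in> A' j})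
    = prob {\<omega>\<in>space M. \<forall>j\<in>J. B j \<omega> \<in> A j} * prob {\<omega>\<in>space M. \<forall>j\<in>J'. path c \<omega> j \<in> A' j}"
proof -
  obtain t m where t: "0 < m" "t 0 = 0" "t m = c" "\<And>i. i < m \<Longrightarrow> t i < t (Suc i)" "J \<subseteq> t ` {..m}"
    using obtain_time_grid[OF J c] by metis
  define b where "b = Max (insert 1 J')"
  have "J' \<subseteq> {0..b}" "0 < b" using J' by (auto simp: b_def Max_ge_iff less_le_trans[OF zero_less_one])
  then obtain t' n where t': "0 < n" "t' 0 = 0" "t' n = b" "\<And>i. i < n \<Longrightarrow> t' i < t' (Suc i)" "J' \<subseteq> t' ` {..n}"
    using obtain_time_grid[OF J'(1), of b] by metis
  define T where "T i = (if i \<le> m then t i else c + t' (i - m))" for i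
  have Tt: "T i = t i" if "i \<le> m" for i using that by (simp add: T_def)
  have Tt': "T (m + i) = c + t' i" for i using t t' by (cases i) (auto simp: T_def)
  have T_less: "T i < T (Suc i)" if "i < m + n" for i
  proof (cases "i < m")
    case True then show ?thesis using t by (simp add: T_def)
  next
    case False
    then obtain k where "i = m + k" "k < n" using \<open>i < m + n\<close> by (metis add_less_cancel_left le_iff_add not_less)
    then show ?thesis using Tt'[of k] Tt'[of "Suc k"] t' by simp
  qed
  define D where "D i \<omega> = B (T (Suc i)) \<omega> - B (T i) \<omega>" for i \<omega>
  have indep: "indep_vars (\<lambda>_. borel) D {..<m + n}"
    unfolding D_def[abs_def] using less_imp_le[OF T_less] t Tt[of 0] by (intro indep_increments) auto
  define X where "X \<omega> = restrict (\<lambda>i. D i \<omega>) {..<m}" for \<omega>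
  define Y where "Y \<omega> = restrict (\<lambda>i. D i \<omega>) {m..<m + n}" for \<omega>
  have ind: "indep_var (PiM {..<m} (\<lambda>_. borel)) X (PiM {m..<m + n} (\<lambda>_. borel)) Y"
    unfolding X_def[abs_def] Y_def[abs_def] by (rule indep_var_restrict[OF indep]) auto
  note XY[measurable] = indep_var_rv1[OF ind] indep_var_rv2[OF ind]
  define SX where "SX = {d\<in>space (PiM {..<m} (\<lambda>_. borel :: real measure)). \<forall>i\<in>{i. i \<le> m \<and> t i \<in> J}. (\<Sum>l<i. d l) \<in> A (t i)}"
  define SY where "SY = {d\<in>space (PiM {m..<m+n} (\<lambda>_. borel :: real measure)). \<forall>i\<in>{i. i \<le> n \<and> t' i \<in> J'}. (\<Sum>l<i. d (m + l)) \<in> A' (t' i)}"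
  have SX: "SX \<in> sets (PiM {..<m} (\<lambda>_. borel))"
    unfolding SX_def using A by (intro sets_partial_sums[where f="\<lambda>l. l"]) auto
  have SY: "SY \<in> sets (PiM {m..<m+n} (\<lambda>_. borel))"
    unfolding SY_def using A' by (intro sets_partial_sums) auto
  have sumX: "(\<Sum>l<i. X \<omega> l) = B (t i) \<omega> - B 0 \<omega>" if "i \<le> m" for i \<omega>
  proof -
    have "(\<Sum>l<i. X \<omega> l) = (\<Sum>l<i. B (T (Suc l)) \<omega> - B (T l) \<omega>)"
      using that by (intro sum.cong) (auto simp: X_def D_def)
    also have "\<dots> = B (T i) \<omega> - B (T 0) \<omega>" by (rule sum_lessThan_telescope)
    finally show ?thesis using that t by (simp add: T_def)
  qed
  have sumY: "(\<Sum>l<i. Y \<omega> (m + l)) = path c \<omega> (t' i)" if "i \<le> n" "0 \<le> t' i" for i \<omega>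
  proof -
    have "(\<Sum>l<i. Y \<omega> (m + l)) = (\<Sum>l<i. B (T (m + Suc l)) \<omega> - B (T (m + l)) \<omega>)"
      using that by (intro sum.cong) (auto simp: Y_def D_def)
    also have "\<dots> = B (T (m + i)) \<omega> - B (T (m + 0)) \<omega>"
      by (rule sum_lessThan_telescope[of "\<lambda>i. B (T (m + i)) \<omega>"])
    finally show ?thesis using that t' unfolding Tt' by (simp add: path_def)
  qed
  have inSX: "X \<omega> \<in> SX \<longleftrightarrow> (\<forall>j\<in>J. B j \<omega> - B 0 \<omega> \<in> A j)" for \<omega>
  proof -
    have "X \<omega> \<in> space (PiM {..<m} (\<lambda>_. borel))" by (auto simp: space_PiM X_def)
    then have "X \<omega> \<in> SX \<longleftrightarrow> (\<forall>i\<in>{i. i \<le> m \<and> t i \<in> J}. B (t i) \<omega> - B 0 \<omega> \<in> A (t i))"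
      using sumX by (auto simp: SX_def)
    then show ?thesis using t(5) by auto
  qed
  have inSY: "Y \<omega> \<in> SY \<longleftrightarrow> (\<forall>j\<in>J'. path c \<omega> j \<in> A' j)" for \<omega>
  proof -
    have "Y \<omega> \<in> space (PiM {m..<m+n} (\<lambda>_. borel))" by (auto simp: space_PiM Y_def)
    moreover have "(\<forall>i\<in>{i. i \<le> n \<and> t' i \<in> J'}. (\<Sum>l<i. Y \<omega> (m + l)) \<in> A' (t' i))
        \<longleftrightarrow> (\<forall>i\<in>{i. i \<le> n \<and> t' i \<in> J'}. path c \<omega> (t' i) \<in> A' (t' i))"
      using J' sumY by (intro ball_cong) auto
    ultimately have "Y \<omega> \<in> SY \<longleftrightarrow> (\<forall>i\<in>{i. i \<le> n \<and> t' i \<in> J'}. path c \<omega> (t' i) \<in> A' (t' i))"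
      by (auto simp: SY_def)
    then show ?thesis using t'(5) by auto
  qed
  define EX0 where "EX0 = X -` SX \<inter> space M"
  define EX1 where "EX1 = {\<omega>\<in>space M. \<forall>j\<in>J. B j \<omega> \<in> A j}"
  define EY where "EY = {\<omega>\<in>space M. \<forall>j\<in>J'. path c \<omega> j \<in> A' j}"
  have EY: "EY = Y -` SY \<inter> space M" using inSY by (auto simp: EY_def)
  have EX1: "EX1 \<in> events"
    unfolding EX1_def
  proof (intro sets.sets_Collect_finite_All)
    fix j assume j: "j \<in> J"
    have "B j \<in> borel_measurable M" using j J by (intro random_variable) auto
    from measurable_sets[OF this A[OF j]] show "{\<omega> \<in> space M. B j \<omega> \<in> A j} \<in> events"
      by (auto simp: vimage_def Int_def conj_commute)
  qed (use J in auto)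
  have ev: "EX0 \<in> events" "EY \<in> events"
    unfolding EX0_def EY using SX SY XY by (auto intro: measurable_sets)
  \<comment> \<open>Sums of increments yield \<open>B j - B 0\<close>, and \<open>B 0 = 0\<close>
    holds only almost surely; hence the two versions \<open>EX0\<close> and \<open>EX1\<close> of
    the past event.\<close>
  have ae: "AE \<omega> in M. \<omega> \<in> EX0 \<longleftrightarrow> \<omega> \<in> EX1"
    using start by eventually_elim (auto simp: EX0_def EX1_def inSX)
  have "prob (EX1 \<inter> EY) = prob (EX0 \<inter> EY)"
    using ae ev EX1 by (intro measure_eq_AE) (auto elim!: eventually_mono)
  also have "\<dots> = prob EX0 * prob EY"
    unfolding EX0_def EY using indep_varD[OF ind SX SY] by (simp add: vimage_def Int_def conj_ac)
  also have "prob EX0 = prob EX1" using ae ev EX1 by (intro measure_eq_AE) auto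
  finally show ?thesis by (simp add: EX1_def EY_def)
qed

text \<open>Both sigma-algebras are generated by pullbacks of product algebras, which are closed
  under intersection; \<open>past_future_fidi\<close> is independence of these generators.\<close>

lemma past_future_indep:
  assumes c: "0 < c" and E: "E \<in> sets (past c)" and A: "A \<in> sets (PiM {0..} (\<lambda>_. borel))"
  shows "prob (E \<inter> (path c -` A \<inter> space M)) = prob E * prob (path c -` A \<inter> space M)"
proof -
  let ?X = "\<lambda>\<omega>. \<lambda>s\<in>{0..c}. B s \<omega>"
  let ?G1 = "{?X -` A \<inter> space M | A. A \<in> prod_algebra {0..c} (\<lambda>_. borel :: real measure)}"
  let ?G2 = "{path c -` A \<inter> space M | A. A \<in> prod_algebra {0..} (\<lambda>_. borel :: real measure)}"
  have c0: "0 \<le> c" using c by simp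
  have vimage_stable: "Int_stable {f -` A \<inter> space M | A. A \<in> prod_algebra I N}"
    for f :: "'a \<Rightarrow> real \<Rightarrow> real" and I and N :: "real \<Rightarrow> real measure"
  proof (rule Int_stableI)
    fix a b assume "a \<in> {f -` A \<inter> space M | A. A \<in> prod_algebra I N}" "b \<in> {f -` A \<inter> space M | A. A \<in> prod_algebra I N}"
    then obtain A1 A2 where "a = f -` A1 \<inter> space M" "b = f -` A2 \<inter> space M" "A1 \<in> prod_algebra I N" "A2 \<in> prod_algebra I N"
      by blast
    moreover from this have "A1 \<inter> A2 \<in> prod_algebra I N"
      using Int_stable_prod_algebra[of I N] by (auto simp: Int_stable_def)
    ultimately show "a \<inter> b \<in> {f -` A \<inter> space M | A. A \<in> prod_algebra I N}"
      by (intro CollectI exI[of _ "A1 \<inter> A2"]) auto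
  qed
  have pre1: "?X -` prod_emb {0..c} (\<lambda>_. borel) J (Pi\<^sub>E J F) \<inter> space M = {\<omega>\<in>space M. \<forall>j\<in>J. B j \<omega> \<in> F j}"
    if "J \<subseteq> {0..c}" for J F using restrict_in_prod_emb_iff[OF that] by auto
  have pre2: "path c -` prod_emb {0..} (\<lambda>_. borel) J (Pi\<^sub>E J F) \<inter> space M = {\<omega>\<in>space M. \<forall>j\<in>J. path c \<omega> j \<in> F j}"
    if "J \<subseteq> {0..}" for J F
    unfolding path_def using restrict_in_prod_emb_iff[OF that] that by (auto simp: subset_eq)
  have "indep_set ?G1 ?G2"
    unfolding indep_sets2_eq
  proof (intro conjI ballI)
    show "?G1 \<subseteq> events"
      using measurable_sets[OF measurable_initial_path[of c]] by (auto simp: sets_PiM)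
    show "?G2 \<subseteq> events"
      using measurable_sets[OF measurable_path[OF c0]] by (auto simp: sets_PiM)
    fix a b assume "a \<in> ?G1" "b \<in> ?G2"
    then obtain A1 A2 where a: "a = ?X -` A1 \<inter> space M" "A1 \<in> prod_algebra {0..c} (\<lambda>_. borel :: real measure)"
      and b: "b = path c -` A2 \<inter> space M" "A2 \<in> prod_algebra {0..} (\<lambda>_. borel :: real measure)" by blast
    obtain J1 F1 where 1: "A1 = prod_emb {0..c} (\<lambda>_. borel) J1 (Pi\<^sub>E J1 F1)" "finite J1" "J1 \<subseteq> {0..c}" "\<And>i. i \<in> J1 \<Longrightarrow> F1 i \<in> sets borel"
      using prod_algebraE[OF a(2)] by metis
    obtain J2 F2 where 2: "A2 = prod_emb {0..} (\<lambda>_. borel) J2 (Pi\<^sub>E J2 F2)" "finite J2" "J2 \<subseteq> {0..}" "\<And>i. i \<in> J2 \<Longrightarrow> F2 i \<in> sets borel"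
      using prod_algebraE[OF b(2)] by metis
    show "prob (a \<inter> b) = prob a * prob b"
      unfolding a(1) b(1) 1(1) 2(1) pre1[OF 1(3)] pre2[OF 2(3)]
      by (rule past_future_fidi[OF c 1(2,3,4) 2(2,3,4)])
  qed
  then have ind: "indep_set (sigma_sets (space M) ?G1) (sigma_sets (space M) ?G2)"
    by (rule indep_set_sigma_sets) (rule vimage_stable)+
  have "sigma_sets (space M) ?G1 = sets (past c)"
    unfolding sets_past sets_PiM by (rule sigma_sets_vimage_commute[symmetric]) auto
  moreover have "sigma_sets (space M) ?G2 = {path c -` A \<inter> space M | A. A \<in> sets (PiM {0..} (\<lambda>_. borel))}"
    unfolding sets_PiM by (rule sigma_sets_vimage_commute[symmetric]) (auto simp: path_def)
  ultimately show ?thesis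
    using indep_setD[OF ind, of E "path c -` A \<inter> space M"] E A by blast
qed

end

section \<open>The strong Markov property\<close>

text \<open>The grid time lies strictly after \<open>x\<close>, so that the mesh of an optional time takes the value \<open>c\<close> on an
  event of the past up to \<open>c\<close>.\<close>

definition mesh :: "real \<Rightarrow> real \<Rightarrow> real" where
  "mesh h x = h * (real (nat \<lfloor>x / h\<rfloor>) + 1)"

lemma mesh_bounds:
  assumes "0 < h" "0 \<le> x"
  shows "x < mesh h x" "mesh h x \<le> x + h"
proof -
  have "real (nat \<lfloor>x / h\<rfloor>) = real_of_int \<lfloor>x / h\<rfloor>" using assms by simp
  moreover have "real_of_int \<lfloor>x / h\<rfloor> \<le> x / h" "x / h < real_of_int \<lfloor>x / h\<rfloor> + 1" by linarith+
  moreover have "h * real_of_int \<lfloor>x / h\<rfloor> \<le> h * (x / h)"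
    using assms by (intro mult_left_mono) auto
  ultimately show "x < mesh h x" "mesh h x \<le> x + h"
    using assms by (auto simp: mesh_def field_simps)
qed

lemma mesh_nonneg: "0 < h \<Longrightarrow> 0 \<le> x \<Longrightarrow> 0 \<le> mesh h x"
  using mesh_bounds(1)[of h x] by linarith

lemma mesh_tendsto:
  assumes "0 \<le> x" shows "(\<lambda>n. mesh (1 / real (Suc n)) x) \<longlonglongrightarrow> x"
proof (rule tendsto_sandwich[where f="\<lambda>_. x" and h="\<lambda>n. x + 1 / real (Suc n)"])
  show "(\<lambda>n. x + 1 / real (Suc n)) \<longlonglongrightarrow> x"
    using tendsto_add[OF tendsto_const LIMSEQ_inverse_real_of_nat, of x] by (simp add: inverse_eq_divide)
qed (use mesh_bounds[OF _ assms] in \<open>auto intro!: always_eventually less_imp_le simp del: of_nat_Suc\<close>)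

lemma measurable_mesh [measurable]: "mesh h \<in> borel_measurable borel"
  unfolding mesh_def[abs_def] by measurable

text \<open>A continuous approximation from above to the indicator of \<open>{..a}\<close>.
  Continuity lets expectations pass to the limit along meshes that approach the time from the
  right.\<close>

definition ramp :: "nat \<Rightarrow> real \<Rightarrow> real \<Rightarrow> real" where
  "ramp m a x = max 0 (min 1 (1 - real m * (x - a)))"

lemma ramp_bounds: "0 \<le> ramp m a x" "ramp m a x \<le> 1"
  by (auto simp: ramp_def)

lemma isCont_ramp: "isCont (ramp m a) x"
  unfolding ramp_def by (intro continuous_intros)

lemma measurable_ramp [measurable]: "ramp m a \<in> borel_measurable borel"
  unfolding ramp_def[abs_def] by measurable

lemma ramp_tendsto: "(\<lambda>m. ramp m a x) \<longlonglongrightarrow> indicator {..a} x"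
proof (cases "x \<le> a")
  case True
  then have "ramp m a x = 1" for m by (auto simp: ramp_def mult_nonneg_nonpos)
  then show ?thesis using True by simp
next
  case False
  obtain N where N: "1 < real N * (x - a)" using reals_Archimedean3[of "x - a"] False by auto
  have "ramp m a x = 0" if "N \<le> m" for m
  proof -
    have "real N * (x - a) \<le> real m * (x - a)" using that False by (intro mult_right_mono) auto
    then show ?thesis using N by (auto simp: ramp_def)
  qed
  then have "eventually (\<lambda>m. ramp m a x = 0) sequentially" by (auto simp: eventually_sequentially)
  then show ?thesis using False by (simp add: tendsto_eventually)
qed

section \<open>From discretized times to general optional times\<close>

context standard_brownian_motion
begin

text \<open>Along a mesh the random time takes countably many values; continuity of the paths gives
  the limit.\<close>

lemma measurable_at_random_time:
  assumes [measurable]: "\<tau> \<in> borel_measurable M" and \<tau>: "\<And>\<omega>. \<omega> \<in> space M \<Longrightarrow> 0 \<le> \<tau> \<omega>"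
  shows "(\<lambda>\<omega>. B (\<tau> \<omega>) \<omega>) \<in> borel_measurable M"
proof (rule borel_measurable_LIMSEQ_real)
  show "(\<lambda>\<omega>. B (mesh (1 / real (Suc n)) (\<tau> \<omega>)) \<omega>) \<in> borel_measurable M" for n
  proof -
    have "(\<lambda>\<omega>. (\<lambda>k \<omega>. B (1 / real (Suc n) * (real k + 1)) \<omega>) (nat \<lfloor>\<tau> \<omega> / (1 / real (Suc n))\<rfloor>) \<omega>) \<in> borel_measurable M"
      by (rule measurable_compose_countable) (auto intro!: random_variable)
    then show ?thesis by (simp add: mesh_def)
  qed
  fix \<omega> assume \<omega>: "\<omega> \<in> space M"
  show "(\<lambda>n. B (mesh (1 / real (Suc n)) (\<tau> \<omega>)) \<omega>) \<longlonglongrightarrow> B (\<tau> \<omega>) \<omega>"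
    using \<tau>[OF \<omega>] mesh_nonneg
    by (intro continuous_on_tendsto_compose[OF paths[OF \<omega>] mesh_tendsto]) auto
qed

lemma measurable_path_at:
  assumes [measurable]: "\<tau> \<in> borel_measurable M" and \<tau>: "\<And>\<omega>. \<omega> \<in> space M \<Longrightarrow> 0 \<le> \<tau> \<omega>"
  shows "(\<lambda>\<omega>. path (\<tau> \<omega>) \<omega>) \<in> measurable M (PiM {0..} (\<lambda>_. borel))"
  unfolding path_def
  by (intro measurable_restrict borel_measurable_diff measurable_at_random_time) (use \<tau> in auto)

lemma past_mono:
  assumes "c \<le> d" shows "sets (past c) \<subseteq> sets (past d)"
proof
  fix E assume "E \<in> sets (past c)"
  then obtain A where A: "E = (\<lambda>\<omega>. \<lambda>s\<in>{0..c}. B s \<omega>) -` A \<inter> space M" "A \<in> sets (PiM {0..c} (\<lambda>_. borel))"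
    unfolding sets_past by blast
  have "(\<lambda>\<omega>. \<lambda>s\<in>{0..c}. B s \<omega>) \<in> measurable (past d) (PiM {0..c} (\<lambda>_. borel))"
    using assms by (intro measurable_restrict measurable_past) auto
  from measurable_sets[OF this A(2)] show "E \<in> sets (past d)" by (simp add: A)
qed

text \<open>The condition is on \<open>\<sigma> \<omega> < c\<close>, with strict inequality, so
  that first passage over \<open>s > 0\<close> satisfies it without right-continuity of the
  filtration.\<close>

definition optional_time :: "('a \<Rightarrow> real) \<Rightarrow> bool" where
  "optional_time \<sigma> \<longleftrightarrow> (\<forall>\<omega>\<in>space M. 0 \<le> \<sigma> \<omega>) \<and> (\<forall>c>0. {\<omega>\<in>space M. \<sigma> \<omega> < c} \<in> sets (past c))"

lemma measurable_optional_time: "optional_time \<sigma> \<Longrightarrow> \<sigma> \<in> borel_measurable M"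
proof (subst borel_measurable_iff_less, intro allI)
  fix a assume \<sigma>: "optional_time \<sigma>"
  show "{\<omega>\<in>space M. \<sigma> \<omega> < a} \<in> events"
  proof (cases "0 < a")
    case True then show ?thesis using \<sigma> past_subset[of a] by (auto simp: optional_time_def)
  next
    case False
    then have eq: "{\<omega>\<in>space M. \<sigma> \<omega> < a} = {}" using \<sigma> by (force simp: optional_time_def)
    show ?thesis unfolding eq by simp
  qed
qed

text \<open>The mesh takes countably many values \<open>c k\<close>, each on an event of the past up
  to \<open>c k\<close>. The path after \<open>c k\<close> is independent of that event and has the
  law of \<open>path 0\<close>; summing over \<open>k\<close> gives the product formula on
  rectangles.\<close>

lemma strong_markov_mesh:
  assumes \<sigma>: "optional_time \<sigma>" and h: "0 < h"
  shows "distr M borel (\<lambda>\<omega>. mesh h (\<sigma> \<omega>)) \<Otimes>\<^sub>M distr M (PiM {0..} (\<lambda>_. borel)) (path 0)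
    = distr M (borel \<Otimes>\<^sub>M PiM {0..} (\<lambda>_. borel)) (\<lambda>\<omega>. (mesh h (\<sigma> \<omega>), path (mesh h (\<sigma> \<omega>)) \<omega>))"
    (is "?D1 \<Otimes>\<^sub>M ?D2 = ?D")
proof (rule pair_measure_eqI)
  let ?P = "PiM {0..} (\<lambda>_. borel :: real measure)"
  note [measurable] = measurable_optional_time[OF \<sigma>]
  have \<sigma>0: "0 \<le> \<sigma> \<omega>" if "\<omega> \<in> space M" for \<omega> using \<sigma> that by (auto simp: optional_time_def)
  have [measurable]: "(\<lambda>\<omega>. path (mesh h (\<sigma> \<omega>)) \<omega>) \<in> measurable M ?P"
    using \<sigma>0 mesh_nonneg[OF h] by (intro measurable_path_at) auto
  have [measurable]: "path 0 \<in> measurable M ?P" by (intro measurable_path) auto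
  show "sigma_finite_measure ?D1" "sigma_finite_measure ?D2"
    by (auto intro!: prob_space_imp_sigma_finite prob_space_distr)
  show "sets (?D1 \<Otimes>\<^sub>M ?D2) = sets ?D" by simp
  fix S A assume "S \<in> sets ?D1" "A \<in> sets ?D2"
  then have [measurable]: "S \<in> sets borel" "A \<in> sets ?P" by auto
  define c where "c k = h * (real k + 1)" for k
  have c: "0 < c k" "0 \<le> c k" for k using h by (auto simp: c_def)
  define E where "E k = {\<omega>\<in>space M. nat \<lfloor>\<sigma> \<omega> / h\<rfloor> = k \<and> c k \<in> S}" for k
  have E: "E k \<in> sets (past (c k))" for k
  proof (cases "c k \<in> S")
    case True
    \<comment> \<open>This writes \<open>E k\<close> as a difference of two events of the form
      \<open>\<sigma> \<omega> < b\<close>. The case \<open>k = 0\<close> is separate because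
      \<open>optional_time\<close> speaks of positive \<open>b\<close> only.\<close>
    have "nat \<lfloor>\<sigma> \<omega> / h\<rfloor> = k \<longleftrightarrow> \<sigma> \<omega> < c k \<and> \<not> \<sigma> \<omega> < h * real k" if "\<omega> \<in> space M" for \<omega>
    proof -
      have "nat \<lfloor>\<sigma> \<omega> / h\<rfloor> = k \<longleftrightarrow> real k \<le> \<sigma> \<omega> / h \<and> \<sigma> \<omega> / h < real k + 1"
        using \<sigma>0[OF that] h by (auto simp: nat_eq_iff2 floor_eq_iff nat_eq_iff)
      then show ?thesis using h by (auto simp: c_def field_simps)
    qed
    then have "E k = {\<omega>\<in>space M. \<sigma> \<omega> < c k} - {\<omega>\<in>space M. \<sigma> \<omega> < h * real k}"
      using True by (auto simp: E_def)
    moreover have "{\<omega>\<in>space M. \<sigma> \<omega> < h * real k} \<in> sets (past (c k))"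
    proof (cases "k = 0")
      case True
      then have eq: "{\<omega>\<in>space M. \<sigma> \<omega> < h * real k} = {}" using \<sigma>0 by force
      show ?thesis unfolding eq by simp
    next
      case False
      then have "{\<omega>\<in>space M. \<sigma> \<omega> < h * real k} \<in> sets (past (h * real k))"
        using \<sigma> h by (auto simp: optional_time_def)
      then show ?thesis using past_mono[of "h * real k" "c k"] h by (auto simp: c_def algebra_simps)
    qed
    moreover have "{\<omega>\<in>space M. \<sigma> \<omega> < c k} \<in> sets (past (c k))"
      using \<sigma> c by (auto simp: optional_time_def)
    ultimately show ?thesis by auto
  qed (simp add: E_def)
  then have E'[measurable]: "E k \<in> events" for k using past_subset[of "c k"] by blast
  have mesh_E: "mesh h (\<sigma> \<omega>) = c k" if "\<omega> \<in> E k" for \<omega> k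
    using that by (auto simp: E_def mesh_def c_def)
  have path_c[measurable]: "path (c k) \<in> measurable M ?P" for k using c by (intro measurable_path) auto
  have disj: "disjoint_family E" by (auto simp: disjoint_family_on_def E_def)
  have "emeasure ?D (S \<times> A) = emeasure M (\<Union>k. E k \<inter> (path (c k) -` A \<inter> space M))"
  proof (subst emeasure_distr)
    show "emeasure M ((\<lambda>\<omega>. (mesh h (\<sigma> \<omega>), path (mesh h (\<sigma> \<omega>)) \<omega>)) -` (S \<times> A) \<inter> space M)
      = emeasure M (\<Union>k. E k \<inter> (path (c k) -` A \<inter> space M))"
      by (rule arg_cong[where f="emeasure M"]) (auto simp: E_def mesh_def c_def)
  qed measurable
  also have "\<dots> = (\<Sum>k. emeasure M (E k \<inter> (path (c k) -` A \<inter> space M)))"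
    using disj by (intro suminf_emeasure[symmetric]) (auto simp: disjoint_family_on_def intro!: measurable_sets[OF path_c])
  also have "\<dots> = (\<Sum>k. emeasure M (E k) * emeasure ?D2 A)"
  proof (intro suminf_cong)
    fix k
    have "emeasure M (E k \<inter> (path (c k) -` A \<inter> space M)) = ennreal (prob (E k) * prob (path (c k) -` A \<inter> space M))"
      using past_future_indep[OF c(1) E, of A k] by (simp add: emeasure_eq_measure)
    also have "\<dots> = emeasure M (E k) * emeasure (distr M ?P (path (c k))) A"
      by (simp add: emeasure_distr emeasure_eq_measure ennreal_mult)
    finally show "emeasure M (E k \<inter> (path (c k) -` A \<inter> space M)) = emeasure M (E k) * emeasure ?D2 A"
      by (simp add: distr_path_stationary[OF c(2)])
  qed
  also have "\<dots> = (\<Sum>k. emeasure M (E k)) * emeasure ?D2 A" by simp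
  also have "(\<Sum>k. emeasure M (E k)) = emeasure M (\<Union>k. E k)"
    using disj by (intro suminf_emeasure) auto
  also have "(\<Union>k. E k) = (\<lambda>\<omega>. mesh h (\<sigma> \<omega>)) -` S \<inter> space M"
    by (auto simp: E_def mesh_def c_def)
  also have "emeasure M \<dots> = emeasure ?D1 S" by (subst emeasure_distr) auto
  finally show "emeasure ?D1 S * emeasure ?D2 A = emeasure ?D (S \<times> A)" ..
qed

lemma strong_markov_mesh_integral:
  assumes \<sigma>: "optional_time \<sigma>" and h: "0 < h"
    and [measurable]: "f \<in> borel_measurable borel" "G \<in> borel_measurable (PiM {0..} (\<lambda>_. borel))"
    and bounds: "\<And>x. \<bar>f x\<bar> \<le> 1" "\<And>w. \<bar>G w\<bar> \<le> (1::real)"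
  shows "expectation (\<lambda>\<omega>. f (mesh h (\<sigma> \<omega>)) * G (path (mesh h (\<sigma> \<omega>)) \<omega>))
    = expectation (\<lambda>\<omega>. f (mesh h (\<sigma> \<omega>))) * expectation (\<lambda>\<omega>. G (path 0 \<omega>))"
proof -
  let ?P = "PiM {0..} (\<lambda>_. borel :: real measure)"
  let ?D1 = "distr M borel (\<lambda>\<omega>. mesh h (\<sigma> \<omega>))" and ?D2 = "distr M ?P (path 0)"
  note [measurable] = measurable_optional_time[OF \<sigma>]
  have \<sigma>0: "0 \<le> \<sigma> \<omega>" if "\<omega> \<in> space M" for \<omega> using \<sigma> that by (auto simp: optional_time_def)
  have [measurable]: "(\<lambda>\<omega>. path (mesh h (\<sigma> \<omega>)) \<omega>) \<in> measurable M ?P"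
    using \<sigma>0 mesh_nonneg[OF h] by (intro measurable_path_at) auto
  have [measurable]: "path 0 \<in> measurable M ?P" by (intro measurable_path) auto
  interpret D1: prob_space ?D1 by (intro prob_space_distr) measurable
  interpret D2: prob_space ?D2 by (intro prob_space_distr) measurable
  interpret pair_sigma_finite ?D1 ?D2 ..
  interpret P: pair_prob_space ?D1 ?D2 ..
  have int: "integrable (?D1 \<Otimes>\<^sub>M ?D2) (\<lambda>(x, w). f x * G w)"
    using bounds by (intro P.integrable_const_bound[of _ 1]) (auto simp: abs_mult mult_le_one)
  have "expectation (\<lambda>\<omega>. f (mesh h (\<sigma> \<omega>)) * G (path (mesh h (\<sigma> \<omega>)) \<omega>))
    = (\<integral>z. (case z of (x, w) \<Rightarrow> f x * G w) \<partial>(?D1 \<Otimes>\<^sub>M ?D2))"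
    unfolding strong_markov_mesh[OF \<sigma> h] by (subst integral_distr) auto
  also have "\<dots> = (\<integral>x. (\<integral>w. f x * G w \<partial>?D2) \<partial>?D1)"
    using integral_fst'[OF int] by simp
  also have "\<dots> = (\<integral>x. f x \<partial>?D1) * (\<integral>w. G w \<partial>?D2)" by simp
  finally show ?thesis by (simp add: integral_distr)
qed

text \<open>Mesh width tends to \<open>0\<close>. Ramps and paths are continuous, so the integrands
  converge pointwise, and they are bounded by one.\<close>

lemma strong_markov_ramp:
  assumes \<sigma>: "optional_time \<sigma>" and J: "finite J" "J \<subseteq> {0..}"
  shows "expectation (\<lambda>\<omega>. ramp m a (\<sigma> \<omega>) * (\<Prod>j\<in>J. ramp m (b j) (path (\<sigma> \<omega>) \<omega> j)))
    = expectation (\<lambda>\<omega>. ramp m a (\<sigma> \<omega>)) * expectation (\<lambda>\<omega>. \<Prod>j\<in>J. ramp m (b j) (path 0 \<omega> j))"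
proof -
  let ?P = "PiM {0..} (\<lambda>_. borel :: real measure)"
  let ?h = "\<lambda>n. 1 / real (Suc n)"
  let ?G = "\<lambda>w. \<Prod>j\<in>J. ramp m (b j) (w j)"
  note [measurable] = measurable_optional_time[OF \<sigma>]
  have \<sigma>0: "0 \<le> \<sigma> \<omega>" if "\<omega> \<in> space M" for \<omega> using \<sigma> that by (auto simp: optional_time_def)
  have mesh0: "0 \<le> mesh (?h n) (\<sigma> \<omega>)" if "\<omega> \<in> space M" for \<omega> n
    using \<sigma>0[OF that] by (intro mesh_nonneg) (auto simp del: of_nat_Suc)
  have [measurable]: "(\<lambda>\<omega>. path (\<sigma> \<omega>) \<omega>) \<in> measurable M ?P"
    using \<sigma>0 by (intro measurable_path_at) auto
  have [measurable]: "(\<lambda>\<omega>. path (mesh (?h n) (\<sigma> \<omega>)) \<omega>) \<in> measurable M ?P" for n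
    using mesh0 by (intro measurable_path_at) auto
  have comp[measurable]: "(\<lambda>w. w j) \<in> borel_measurable ?P" if "j \<in> J" for j
    using that J by (intro measurable_component_singleton) auto
  have G[measurable]: "?G \<in> borel_measurable ?P"
    by (intro borel_measurable_prod measurable_compose[OF comp measurable_ramp])
  have G_bound: "\<bar>?G w\<bar> \<le> 1" for w
    using ramp_bounds by (auto simp: abs_prod intro!: prod_le_1)
  have mult_bound: "\<bar>ramp m a x * ?G w\<bar> \<le> 1" for x w
    unfolding abs_mult using G_bound ramp_bounds by (intro mult_le_one) auto
  have "(\<lambda>n. expectation (\<lambda>\<omega>. ramp m a (mesh (?h n) (\<sigma> \<omega>)) * ?G (path (mesh (?h n) (\<sigma> \<omega>)) \<omega>)))
    \<longlonglongrightarrow> expectation (\<lambda>\<omega>. ramp m a (\<sigma> \<omega>) * ?G (path (\<sigma> \<omega>) \<omega>))"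
  proof (rule integral_dominated_convergence[where w="\<lambda>_. 1"])
    show "AE \<omega> in M. (\<lambda>n. ramp m a (mesh (?h n) (\<sigma> \<omega>)) * ?G (path (mesh (?h n) (\<sigma> \<omega>)) \<omega>))
      \<longlonglongrightarrow> ramp m a (\<sigma> \<omega>) * ?G (path (\<sigma> \<omega>) \<omega>)"
    proof (rule AE_I2)
      fix \<omega> assume \<omega>: "\<omega> \<in> space M"
      note lim = mesh_tendsto[OF \<sigma>0[OF \<omega>]]
      have "(\<lambda>n. path (mesh (?h n) (\<sigma> \<omega>)) \<omega> j) \<longlonglongrightarrow> path (\<sigma> \<omega>) \<omega> j" if "j \<in> J" for j
      proof -
        have j: "0 \<le> j" using that J by auto
        have "(\<lambda>n. B (mesh (?h n) (\<sigma> \<omega>) + j) \<omega> - B (mesh (?h n) (\<sigma> \<omega>)) \<omega>) \<longlonglongrightarrow> B (\<sigma> \<omega> + j) \<omega> - B (\<sigma> \<omega>) \<omega>"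
          using mesh0[OF \<omega>] \<sigma>0[OF \<omega>] j
          by (intro tendsto_diff continuous_on_tendsto_compose[OF paths[OF \<omega>]] tendsto_add lim tendsto_const) auto
        then show ?thesis using j by (simp add: path_def)
      qed
      then show "(\<lambda>n. ramp m a (mesh (?h n) (\<sigma> \<omega>)) * ?G (path (mesh (?h n) (\<sigma> \<omega>)) \<omega>))
        \<longlonglongrightarrow> ramp m a (\<sigma> \<omega>) * ?G (path (\<sigma> \<omega>) \<omega>)"
        by (intro tendsto_mult tendsto_prod isCont_tendsto_compose[OF isCont_ramp] lim) auto
    qed
  qed (use mult_bound in \<open>auto simp del: of_nat_Suc\<close>)
  moreover have "(\<lambda>n. expectation (\<lambda>\<omega>. ramp m a (mesh (?h n) (\<sigma> \<omega>))) * expectation (\<lambda>\<omega>. ?G (path 0 \<omega>)))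
    \<longlonglongrightarrow> expectation (\<lambda>\<omega>. ramp m a (\<sigma> \<omega>)) * expectation (\<lambda>\<omega>. ?G (path 0 \<omega>))"
  proof (intro tendsto_mult tendsto_const integral_dominated_convergence[where w="\<lambda>_. 1"])
    show "AE \<omega> in M. (\<lambda>n. ramp m a (mesh (?h n) (\<sigma> \<omega>))) \<longlonglongrightarrow> ramp m a (\<sigma> \<omega>)"
      using \<sigma>0 by (intro AE_I2 isCont_tendsto_compose[OF isCont_ramp] mesh_tendsto)
  qed (use ramp_bounds in auto)
  moreover have "expectation (\<lambda>\<omega>. ramp m a (mesh (?h n) (\<sigma> \<omega>)) * ?G (path (mesh (?h n) (\<sigma> \<omega>)) \<omega>))
    = expectation (\<lambda>\<omega>. ramp m a (mesh (?h n) (\<sigma> \<omega>))) * expectation (\<lambda>\<omega>. ?G (path 0 \<omega>))" for n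
    using G_bound ramp_bounds by (intro strong_markov_mesh_integral[OF \<sigma>] G) (auto simp del: of_nat_Suc)
  ultimately show ?thesis by (simp add: LIMSEQ_unique)
qed

text \<open>Letting \<open>m\<close> grow in \<open>strong_markov_ramp\<close> turns the ramps into
  indicators of half lines, again by dominated convergence.\<close>

lemma strong_markov_halflines:
  assumes \<sigma>: "optional_time \<sigma>" and J: "finite J" "J \<subseteq> {0..}"
  shows "prob {\<omega>\<in>space M. \<sigma> \<omega> \<le> a \<and> (\<forall>j\<in>J. path (\<sigma> \<omega>) \<omega> j \<le> b j)}
    = prob {\<omega>\<in>space M. \<sigma> \<omega> \<le> a} * prob {\<omega>\<in>space M. \<forall>j\<in>J. path 0 \<omega> j \<le> b j}"
proof -
  let ?P = "PiM {0..} (\<lambda>_. borel :: real measure)"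
  let ?G = "\<lambda>m w. \<Prod>j\<in>J. ramp m (b j) (w j)"
  let ?I = "\<lambda>w. \<Prod>j\<in>J. indicator {..b j} (w j) :: real"
  note [measurable] = measurable_optional_time[OF \<sigma>]
  have \<sigma>0: "0 \<le> \<sigma> \<omega>" if "\<omega> \<in> space M" for \<omega> using \<sigma> that by (auto simp: optional_time_def)
  have [measurable]: "(\<lambda>\<omega>. path (\<sigma> \<omega>) \<omega>) \<in> measurable M ?P"
    using \<sigma>0 by (intro measurable_path_at) auto
  have [measurable]: "path 0 \<in> measurable M ?P" by (intro measurable_path) auto
  have comp[measurable]: "(\<lambda>w. w j) \<in> borel_measurable ?P" if "j \<in> J" for j
    using that J by (intro measurable_component_singleton) auto
  have G[measurable]: "?G m \<in> borel_measurable ?P" for m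
    by (intro borel_measurable_prod measurable_compose[OF comp measurable_ramp])
  have I[measurable]: "?I \<in> borel_measurable ?P"
    by (intro borel_measurable_prod measurable_compose[OF comp]) auto
  have G_bound: "\<bar>?G m w\<bar> \<le> 1" for w m
    using ramp_bounds by (auto simp: abs_prod intro!: prod_le_1)
  have mult_bound: "\<bar>ramp m a x * ?G m w\<bar> \<le> 1" for x w m
    unfolding abs_mult using G_bound ramp_bounds by (intro mult_le_one) auto
  have "(\<lambda>m. expectation (\<lambda>\<omega>. ramp m a (\<sigma> \<omega>) * ?G m (path (\<sigma> \<omega>) \<omega>)))
    \<longlonglongrightarrow> expectation (\<lambda>\<omega>. indicator {..a} (\<sigma> \<omega>) * ?I (path (\<sigma> \<omega>) \<omega>))"
    using mult_bound
    by (intro integral_dominated_convergence[where w="\<lambda>_. 1"] AE_I2 tendsto_mult tendsto_prod ramp_tendsto) auto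
  moreover have "(\<lambda>m. expectation (\<lambda>\<omega>. ramp m a (\<sigma> \<omega>)) * expectation (\<lambda>\<omega>. ?G m (path 0 \<omega>)))
    \<longlonglongrightarrow> expectation (\<lambda>\<omega>. indicator {..a} (\<sigma> \<omega>)) * expectation (\<lambda>\<omega>. ?I (path 0 \<omega>))"
    using ramp_bounds G_bound
    by (intro tendsto_mult integral_dominated_convergence[where w="\<lambda>_. 1"] AE_I2 tendsto_prod ramp_tendsto) auto
  ultimately have "expectation (\<lambda>\<omega>. indicator {..a} (\<sigma> \<omega>) * ?I (path (\<sigma> \<omega>) \<omega>))
    = expectation (\<lambda>\<omega>. indicator {..a} (\<sigma> \<omega>)) * expectation (\<lambda>\<omega>. ?I (path 0 \<omega>))"
    unfolding strong_markov_ramp[OF \<sigma> J] by (rule LIMSEQ_unique)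
  moreover have I_eq: "?I w = (if \<forall>j\<in>J. w j \<le> b j then 1 else 0)" for w
    using J by (auto simp: indicator_def intro!: prod_zero)
  have [measurable]: "{\<omega>\<in>space M. \<forall>j\<in>J. path 0 \<omega> j \<le> b j} \<in> events"
    "{\<omega>\<in>space M. \<forall>j\<in>J. path (\<sigma> \<omega>) \<omega> j \<le> b j} \<in> events"
    using J by (auto intro!: sets.sets_Collect_finite_All measurable_compose[OF _ measurable_component_singleton]
         borel_measurable_le simp: subset_eq)
  have "expectation (\<lambda>\<omega>. indicator {..a} (\<sigma> \<omega>) * ?I (path (\<sigma> \<omega>) \<omega>))
    = expectation (indicator {\<omega>\<in>space M. \<sigma> \<omega> \<le> a \<and> (\<forall>j\<in>J. path (\<sigma> \<omega>) \<omega> j \<le> b j)})"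
    unfolding I_eq by (intro Bochner_Integration.integral_cong) (auto simp: indicator_def)
  moreover have "expectation (\<lambda>\<omega>. indicator {..a} (\<sigma> \<omega>) :: real) = expectation (indicator {\<omega>\<in>space M. \<sigma> \<omega> \<le> a})"
    by (intro Bochner_Integration.integral_cong) (auto simp: indicator_def)
  moreover have "expectation (\<lambda>\<omega>. ?I (path 0 \<omega>)) = expectation (indicator {\<omega>\<in>space M. \<forall>j\<in>J. path 0 \<omega> j \<le> b j})"
    unfolding I_eq by (intro Bochner_Integration.integral_cong) (auto simp: indicator_def)
  ultimately show ?thesis by simp
qed

text \<open>Boxes of half lines in finitely many coordinates form an intersection-stable generator
  of the product sigma-algebra, and \<open>strong_markov_halflines\<close> is the claim on
  them.\<close>

theorem strong_markov:
  assumes \<sigma>: "optional_time \<sigma>"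
  shows "distr M (borel \<Otimes>\<^sub>M PiM {0..} (\<lambda>_. borel)) (\<lambda>\<omega>. (\<sigma> \<omega>, path (\<sigma> \<omega>) \<omega>))
    = distr M borel \<sigma> \<Otimes>\<^sub>M distr M (PiM {0..} (\<lambda>_. borel)) (path 0)"
    (is "?D = ?D1 \<Otimes>\<^sub>M ?D2")
proof -
  let ?P = "PiM {0..} (\<lambda>_. borel :: real measure)"
  define \<Omega> where "\<Omega> = space (borel \<Otimes>\<^sub>M ?P :: (real \<times> (real \<Rightarrow> real)) measure)"
  have \<Omega>_eq: "\<Omega> = UNIV \<times> space ?P" by (simp add: \<Omega>_def space_pair_measure)
  define Q where "Q a J b = {z\<in>\<Omega>. fst z \<le> a \<and> (\<forall>j\<in>J. snd z j \<le> b j)}" for a :: real and J and b :: "real \<Rightarrow> real"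
  define G where "G = {Q a J b | a J b. finite J \<and> J \<subseteq> {0..}}"
  note [measurable] = measurable_optional_time[OF \<sigma>]
  have \<sigma>0: "0 \<le> \<sigma> \<omega>" if "\<omega> \<in> space M" for \<omega> using \<sigma> that by (auto simp: optional_time_def)
  have [measurable]: "(\<lambda>\<omega>. path (\<sigma> \<omega>) \<omega>) \<in> measurable M ?P"
    using \<sigma>0 by (intro measurable_path_at) auto
  have [measurable]: "path 0 \<in> measurable M ?P" by (intro measurable_path) auto
  interpret D1: prob_space ?D1 by (intro prob_space_distr) measurable
  interpret D2: prob_space ?D2 by (intro prob_space_distr) measurable
  have box[measurable]: "{w\<in>space ?P. \<forall>j\<in>J. w j \<le> b j} \<in> sets ?P" if "finite J" "J \<subseteq> {0..}" for J b
    using that by (auto intro!: sets.sets_Collect_finite_All borel_measurable_le measurable_component_singleton simp: subset_eq)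
  have Q_eq: "Q a J b = {..a} \<times> {w\<in>space ?P. \<forall>j\<in>J. w j \<le> b j}" for a J b
    by (auto simp: Q_def \<Omega>_eq)
  have Q_sets: "Q a J b \<in> sets (borel \<Otimes>\<^sub>M ?P)" if "finite J" "J \<subseteq> {0..}" for a J b
    unfolding Q_eq using box[OF that] by (intro pair_measureI) auto
  have G_Pow: "G \<subseteq> Pow \<Omega>" by (auto simp: G_def Q_def)
  have sets: "sets (borel \<Otimes>\<^sub>M ?P) = sigma_sets \<Omega> G"
  proof
    show "sigma_sets \<Omega> G \<subseteq> sets (borel \<Otimes>\<^sub>M ?P)"
      unfolding \<Omega>_def using Q_sets by (intro sets.sigma_sets_subset) (auto simp: G_def)
    let ?S = "sigma \<Omega> G"
    have Q_S: "Q a J b \<in> sets ?S" if "finite J" "J \<subseteq> {0..}" for a J b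
      using G_Pow that by (auto simp: G_def)
    \<comment> \<open>This map only restricts the second component to \<open>{0..}\<close>, so on
      \<open>\<Omega>\<close> it is the identity; its measurability shows that the boxes generate
      the product sigma-algebra.\<close>
    have "(\<lambda>z. (fst z, \<lambda>j\<in>{0..}. snd z j)) \<in> measurable ?S (borel \<Otimes>\<^sub>M ?P)"
    proof (intro measurable_Pair measurable_restrict)
      have "{z\<in>space ?S. fst z \<le> a} = Q a {} (\<lambda>_. 0)" for a using G_Pow by (auto simp: Q_def)
      then show "fst \<in> borel_measurable ?S"
        using Q_S by (auto simp: borel_measurable_iff_le)
      fix j :: real assume j: "j \<in> {0..}"
      have "{z\<in>space ?S. snd z j \<le> a} = (\<Union>n::nat. Q (real n) {j} (\<lambda>_. a))" for a
        using G_Pow real_arch_simple by (auto simp: Q_def)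
      then show "(\<lambda>z. snd z j) \<in> borel_measurable ?S"
        using Q_S j by (auto simp: borel_measurable_iff_le)
    qed
    also have "(\<lambda>z. (fst z, \<lambda>j\<in>{0..}. snd z j)) \<in> measurable ?S (borel \<Otimes>\<^sub>M ?P) \<longleftrightarrow> (\<lambda>z. z) \<in> measurable ?S (borel \<Otimes>\<^sub>M ?P)"
      using G_Pow by (intro measurable_cong) (auto simp: \<Omega>_eq space_PiM PiE_iff extensional_restrict)
    finally have id: "(\<lambda>z. z) \<in> measurable ?S (borel \<Otimes>\<^sub>M ?P)" .
    show "sets (borel \<Otimes>\<^sub>M ?P) \<subseteq> sigma_sets \<Omega> G"
    proof
      fix A :: "(real \<times> (real \<Rightarrow> real)) set" assume A: "A \<in> sets (borel \<Otimes>\<^sub>M ?P)"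
      have "A \<subseteq> \<Omega>" using sets.sets_into_space[OF A] by (simp add: \<Omega>_def)
      then show "A \<in> sigma_sets \<Omega> G"
        using measurable_sets[OF id A] G_Pow by (simp add: Int_absorb2)
    qed
  qed
  show ?thesis
  proof (rule measure_eqI_generator_eq[where E=G and \<Omega>=\<Omega> and A="\<lambda>n. Q (real n) {} (\<lambda>_. 0)"])
    show "Int_stable G"
    proof (rule Int_stableI)
      fix x y assume "x \<in> G" "y \<in> G"
      then obtain a1 J1 b1 a2 J2 b2 where *: "x = Q a1 J1 b1" "finite J1" "J1 \<subseteq> {0..}" "y = Q a2 J2 b2" "finite J2" "J2 \<subseteq> {0..}"
        by (auto simp: G_def)
      have "x \<inter> y = Q (min a1 a2) (J1 \<union> J2) (\<lambda>j. if j \<in> J1 then if j \<in> J2 then min (b1 j) (b2 j) else b1 j else b2 j)"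
        unfolding * by (auto simp: Q_def)
      then show "x \<inter> y \<in> G" using * unfolding G_def by blast
    qed
    fix x assume "x \<in> G"
    then obtain a J b where x: "x = Q a J b" and J: "finite J" "J \<subseteq> {0..}" by (auto simp: G_def)
    have "emeasure ?D x = prob {\<omega>\<in>space M. \<sigma> \<omega> \<le> a \<and> (\<forall>j\<in>J. path (\<sigma> \<omega>) \<omega> j \<le> b j)}"
    proof -
      have "(\<lambda>\<omega>. (\<sigma> \<omega>, path (\<sigma> \<omega>) \<omega>)) -` x \<inter> space M
          = {\<omega>\<in>space M. \<sigma> \<omega> \<le> a \<and> (\<forall>j\<in>J. path (\<sigma> \<omega>) \<omega> j \<le> b j)}"
        by (auto simp: x Q_eq space_PiM path_def)
      then show ?thesis using Q_sets[OF J] x by (simp add: emeasure_distr emeasure_eq_measure)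
    qed
    also have "\<dots> = ennreal (prob {\<omega>\<in>space M. \<sigma> \<omega> \<le> a}) * ennreal (prob {\<omega>\<in>space M. \<forall>j\<in>J. path 0 \<omega> j \<le> b j})"
      unfolding strong_markov_halflines[OF \<sigma> J] by (simp add: ennreal_mult)
    also have "ennreal (prob {\<omega>\<in>space M. \<sigma> \<omega> \<le> a}) = emeasure ?D1 {..a}"
      by (subst emeasure_distr) (auto simp: emeasure_eq_measure intro!: arg_cong[where f=prob])
    also have "ennreal (prob {\<omega>\<in>space M. \<forall>j\<in>J. path 0 \<omega> j \<le> b j}) = emeasure ?D2 {w\<in>space ?P. \<forall>j\<in>J. w j \<le> b j}"
    proof -
      have "path 0 -` {w\<in>space ?P. \<forall>j\<in>J. w j \<le> b j} \<inter> space M = {\<omega>\<in>space M. \<forall>j\<in>J. path 0 \<omega> j \<le> b j}"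
        by (auto simp: space_PiM path_def)
      then show ?thesis using box[OF J] by (simp add: emeasure_distr emeasure_eq_measure)
    qed
    also have "emeasure ?D1 {..a} * emeasure ?D2 {w\<in>space ?P. \<forall>j\<in>J. w j \<le> b j} = emeasure (?D1 \<Otimes>\<^sub>M ?D2) x"
      unfolding x Q_eq using box[OF J] by (intro D2.emeasure_pair_measure_Times[symmetric]) auto
    finally show "emeasure ?D x = emeasure (?D1 \<Otimes>\<^sub>M ?D2) x" .
  next
    show "sets ?D = sigma_sets \<Omega> G" "sets (?D1 \<Otimes>\<^sub>M ?D2) = sigma_sets \<Omega> G"
      using sets sets_pair_measure_cong[of ?D1 borel ?D2 ?P] by auto
    show "range (\<lambda>n. Q (real n) {} (\<lambda>_. 0)) \<subseteq> G" by (auto simp: G_def)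
    show "(\<Union>n. Q (real n) {} (\<lambda>_. 0)) = \<Omega>" using real_arch_simple by (auto simp: Q_def)
    interpret D: prob_space ?D by (intro prob_space_distr) measurable
    show "emeasure ?D (Q (real n) {} (\<lambda>_. 0)) \<noteq> \<infinity>" for n by simp
  qed (rule G_Pow)
qed

corollary nn_integral_strong_markov:
  assumes \<sigma>: "optional_time \<sigma>" and [measurable]: "F \<in> borel_measurable (borel \<Otimes>\<^sub>M PiM {0..} (\<lambda>_. borel))"
  shows "(\<integral>\<^sup>+\<omega>. F (\<sigma> \<omega>, path (\<sigma> \<omega>) \<omega>) \<partial>M) = (\<integral>\<^sup>+g. (\<integral>\<^sup>+\<omega>. F (g, path 0 \<omega>) \<partial>M) \<partial>distr M borel \<sigma>)"
proof -
  let ?P = "PiM {0..} (\<lambda>_. borel :: real measure)"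
  note [measurable] = measurable_optional_time[OF \<sigma>]
  have [measurable]: "(\<lambda>\<omega>. path (\<sigma> \<omega>) \<omega>) \<in> measurable M ?P"
    using \<sigma> by (intro measurable_path_at) (auto simp: optional_time_def)
  have [measurable]: "path 0 \<in> measurable M ?P" by (intro measurable_path) auto
  interpret D2: prob_space "distr M ?P (path 0)" by (intro prob_space_distr) measurable
  have "(\<integral>\<^sup>+\<omega>. F (\<sigma> \<omega>, path (\<sigma> \<omega>) \<omega>) \<partial>M) = (\<integral>\<^sup>+z. F z \<partial>(distr M borel \<sigma> \<Otimes>\<^sub>M distr M ?P (path 0)))"
    unfolding strong_markov[OF \<sigma>, symmetric] by (subst nn_integral_distr) auto
  also have "\<dots> = (\<integral>\<^sup>+g. (\<integral>\<^sup>+w. F (g, w) \<partial>distr M ?P (path 0)) \<partial>distr M borel \<sigma>)"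
    by (subst D2.nn_integral_fst[symmetric]) (auto cong: measurable_cong_sets)
  also have "\<dots> = (\<integral>\<^sup>+g. (\<integral>\<^sup>+\<omega>. F (g, path 0 \<omega>) \<partial>M) \<partial>distr M borel \<sigma>)"
    by (intro nn_integral_cong nn_integral_distr) measurable
  finally show ?thesis .
qed

end

section \<open>Passage times and the reflection principle with drift\<close>

text \<open>Makes a condition over an interval countable. One direction approximates a point by
  rationals, the other takes a maximum over the compact interval. In the degenerate case
  \<open>a = b\<close> the only point must itself be rational.\<close>

lemma ex_nonneg_iff_rational:
  fixes f :: "real \<Rightarrow> real"
  assumes f: "continuous_on {a..b} f" and ab: "a < b \<or> a \<in> \<rat>"
  shows "(\<exists>v\<in>{a..b}. 0 \<le> f v) \<longleftrightarrow> (\<forall>m::nat. \<exists>q\<in>\<rat>. q \<in> {a..b} \<and> - (1 / real (Suc m)) < f q)"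
proof safe
  fix v and m :: nat assume v: "v \<in> {a..b}" "0 \<le> f v"
  show "\<exists>q\<in>\<rat>. q \<in> {a..b} \<and> - (1 / real (Suc m)) < f q"
  proof (cases "a < b")
    case True
    obtain d where d: "0 < d" "\<And>x. x \<in> {a..b} \<Longrightarrow> dist x v < d \<Longrightarrow> dist (f x) (f v) < 1 / real (Suc m)"
      using f v unfolding continuous_on_iff by (metis of_nat_0_less_iff zero_less_Suc zero_less_divide_1_iff)
    have "max a (v - d) < min b (v + d)" using True v d by auto
    then obtain q where q: "q \<in> \<rat>" "max a (v - d) < q" "q < min b (v + d)"
      using Rats_dense_in_real by blast
    then have "dist (f q) (f v) < 1 / real (Suc m)" by (intro d) (auto simp: dist_real_def)
    then show ?thesis using q v by (intro bexI[of _ q]) (auto simp: dist_real_def simp del: of_nat_Suc)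
  next
    case False
    then have "v = a" "a \<in> \<rat>" using v ab by auto
    then show ?thesis using v by (intro bexI[of _ a]) (auto intro: less_le_trans[of _ 0])
  qed
next
  assume *: "\<forall>m::nat. \<exists>q\<in>\<rat>. q \<in> {a..b} \<and> - (1 / real (Suc m)) < f q"
  then have "{a..b} \<noteq> {}" by blast
  then obtain v where v: "v \<in> {a..b}" "\<And>x. x \<in> {a..b} \<Longrightarrow> f x \<le> f v"
    using continuous_attains_sup[OF compact_Icc _ f] by blast
  have "- f v \<le> 0"
  proof (rule field_le_epsilon)
    fix e :: real assume "0 < e"
    then obtain m where "1 / real (Suc m) < e" using nat_approx_posE by blast
    moreover obtain q where "q \<in> {a..b}" "- (1 / real (Suc m)) < f q" using * by blast
    ultimately show "- f v \<le> 0 + e" using v(2)[of q] by linarith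
  qed
  then show "\<exists>v\<in>{a..b}. 0 \<le> f v" using v(1) by auto
qed

lemma first_passage_time_nonneg: "0 \<le> first_passage_time B \<psi> \<omega>"
  unfolding first_passage_time_def by (rule Inf_greatest) (auto intro: less_imp_le)

lemma truncated_passage_time_ereal:
  assumes "0 < L"
  shows "ereal (truncated_passage_time B \<psi> L \<omega>) = min (first_passage_time B \<psi> \<omega>) (ereal L)"
  using first_passage_time_nonneg[of B \<psi> \<omega>] assms unfolding truncated_passage_time_def
  by (cases "first_passage_time B \<psi> \<omega>") (auto simp: min_def)

lemma truncated_passage_time_bounds:
  assumes "0 < L"
  shows "0 \<le> truncated_passage_time B \<psi> L \<omega>" "truncated_passage_time B \<psi> L \<omega> \<le> L"
proof -
  have "0 \<le> ereal (truncated_passage_time B \<psi> L \<omega>)" "ereal (truncated_passage_time B \<psi> L \<omega>) \<le> ereal L"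
    unfolding truncated_passage_time_ereal[OF assms] using first_passage_time_nonneg assms by auto
  then show "0 \<le> truncated_passage_time B \<psi> L \<omega>" "truncated_passage_time B \<psi> L \<omega> \<le> L" by auto
qed

lemma truncated_passage_time_less_iff:
  assumes "0 < L" "c \<le> L"
  shows "truncated_passage_time B \<psi> L \<omega> < c \<longleftrightarrow> (\<exists>s. 0 < s \<and> s < c \<and> B s \<omega> = \<psi> s)"
proof -
  have "truncated_passage_time B \<psi> L \<omega> < c \<longleftrightarrow> min (first_passage_time B \<psi> \<omega>) (ereal L) < ereal c"
    unfolding truncated_passage_time_ereal[OF assms(1), symmetric] by simp
  also have "\<dots> \<longleftrightarrow> first_passage_time B \<psi> \<omega> < ereal c"
    using assms by (auto simp: min_less_iff_disj)
  also have "\<dots> \<longleftrightarrow> (\<exists>s. 0 < s \<and> s < c \<and> B s \<omega> = \<psi> s)"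
    unfolding first_passage_time_def by (auto simp: Inf_less_iff)
  finally show ?thesis .
qed

lemma truncated_passage_time_le:
  assumes "0 < L" "0 < s" "B s \<omega> = \<psi> s"
  shows "truncated_passage_time B \<psi> L \<omega> \<le> s"
proof -
  have "first_passage_time B \<psi> \<omega> \<le> ereal s"
    unfolding first_passage_time_def using assms by (intro Inf_lower) auto
  then have "ereal (truncated_passage_time B \<psi> L \<omega>) \<le> ereal s"
    unfolding truncated_passage_time_ereal[OF assms(1)] by (simp add: min.coboundedI1)
  then show ?thesis by simp
qed

text \<open>The infimum runs over \<open>s > 0\<close>, so attainment could fail at
  \<open>0\<close>. Starting off the boundary excludes \<open>0\<close>, and the compact zero set in
  \<open>[0, L]\<close> has a least element.\<close>

lemma truncated_passage_time_attained:
  assumes cont: "continuous_on {0..} (\<lambda>s. B s \<omega>)" "continuous_on {0..} \<psi>"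
    and L: "0 < L" and start: "B 0 \<omega> \<noteq> \<psi> 0" and less: "truncated_passage_time B \<psi> L \<omega> < L"
  shows "0 < truncated_passage_time B \<psi> L \<omega>"
    "B (truncated_passage_time B \<psi> L \<omega>) \<omega> = \<psi> (truncated_passage_time B \<psi> L \<omega>)"
proof -
  let ?\<tau> = "truncated_passage_time B \<psi> L \<omega>"
  define Z where "Z = {s\<in>{0..L}. B s \<omega> - \<psi> s = 0}"
  have "closed Z" unfolding Z_def
    by (intro continuous_closed_preimage_constant continuous_on_diff continuous_on_subset[OF cont(1)] continuous_on_subset[OF cont(2)]) auto
  moreover have "bounded Z"
    by (rule bounded_subset[OF bounded_closed_interval[of 0 L]]) (auto simp: Z_def)
  ultimately have "compact Z" by (simp add: compact_eq_bounded_closed)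
  moreover have "Z \<noteq> {}"
    using less truncated_passage_time_less_iff[OF L order_refl, of B \<psi> \<omega>] by (force simp: Z_def)
  ultimately obtain z where z: "z \<in> Z" "\<And>x. x \<in> Z \<Longrightarrow> z \<le> x"
    using continuous_attains_inf[of Z "\<lambda>x. x"] by auto
  have z0: "0 < z" using z(1) start by (cases "z = 0") (auto simp: Z_def)
  have "?\<tau> \<le> z" using z z0 by (intro truncated_passage_time_le L) (auto simp: Z_def)
  moreover have "\<not> ?\<tau> < z"
  proof
    assume "?\<tau> < z"
    then obtain s where "0 < s" "s < z" "B s \<omega> = \<psi> s"
      using truncated_passage_time_less_iff[OF L, of z B \<psi> \<omega>] z by (auto simp: Z_def)
    then have "s \<in> Z" using z by (auto simp: Z_def)
    then show False using z(2)[of s] \<open>s < z\<close> by simp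
  qed
  ultimately have "?\<tau> = z" by simp
  then show "0 < ?\<tau>" "B ?\<tau> \<omega> = \<psi> ?\<tau>" using z z0 by (auto simp: Z_def)
qed

lemma crossing_time:
  fixes f g :: "real \<Rightarrow> real"
  assumes "continuous_on {0..} f" "continuous_on {0..} g" "f 0 < g 0" "0 \<le> v" "g v \<le> f v"
  obtains s where "0 < s" "s \<le> v" "f s = g s"
proof -
  have "\<exists>s\<ge>0. s \<le> v \<and> f s - g s = 0"
    using assms by (intro IVT' continuous_on_diff continuous_on_subset[OF assms(1)] continuous_on_subset[OF assms(2)]) auto
  then obtain s where s: "0 \<le> s" "s \<le> v" "f s = g s" by auto
  then have "0 < s" using assms(3) by (cases "s = 0") auto
  then show thesis using s by (intro that[of s])
qed

section \<open>Passage times as optional times\<close>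

context standard_brownian_motion
begin

text \<open>A hit before \<open>c\<close> is a hit in one of countably many compact subintervals of
  the open interval from \<open>0\<close> to \<open>c\<close>, and there the path at rational times
  decides it.\<close>

lemma optional_time_truncated_passage:
  assumes \<psi>: "continuous_on {0..} \<psi>" and L: "0 < L"
  shows "optional_time (truncated_passage_time B \<psi> L)"
  unfolding optional_time_def
proof (intro conjI ballI allI impI truncated_passage_time_bounds L)
  fix c :: real assume c: "0 < c"
  show "{\<omega>\<in>space M. truncated_passage_time B \<psi> L \<omega> < c} \<in> sets (past c)"
  proof (cases "c \<le> L")
    case False
    then have "{\<omega>\<in>space M. truncated_passage_time B \<psi> L \<omega> < c} = space (past c)"
      by (auto simp: not_le intro: le_less_trans[OF truncated_passage_time_bounds(2)[OF L]])
    then show ?thesis by (metis sets.top)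
  next
    case True
    \<comment> \<open>\<open>n + 3\<close> makes \<open>a n \<le> c / 3\<close>, so that
      \<open>{a n..c - a n}\<close> is a nondegenerate interval, to which the rational criterion
      applies.\<close>
    define a where "a n = c / real (n + 3)" for n :: nat
    have a: "0 < a n" "a n < c - a n" for n
    proof -
      show "0 < a n" using c by (simp add: a_def)
      have "a n \<le> c / 3" unfolding a_def using c by (intro divide_left_mono) auto
      then show "a n < c - a n" using c by simp
    qed
    have ex: "(\<exists>s. 0 < s \<and> s < c \<and> P s) \<longleftrightarrow> (\<exists>n. \<exists>s\<in>{a n..c - a n}. P s)" for P
    proof safe
      fix s assume s: "0 < s" "s < c" "P s"
      define d where "d = min s (c - s)"
      have "0 < d" using s by (simp add: d_def)
      obtain n where "c / d < real n" using reals_Archimedean2 by blast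
      then have "c < real n * d" using \<open>0 < d\<close> by (simp add: divide_less_eq)
      also have "\<dots> \<le> real (n + 3) * d" using \<open>0 < d\<close> by (intro mult_right_mono) auto
      finally have "a n < d" by (simp add: a_def divide_less_eq mult.commute)
      then show "\<exists>n. \<exists>s\<in>{a n..c - a n}. P s" using s
        by (intro exI[of _ n] bexI[of _ s]) (auto simp: d_def)
    next
      fix n s assume "s \<in> {a n..c - a n}" "P s"
      then show "\<exists>s. 0 < s \<and> s < c \<and> P s" using a[of n] by (intro exI[of _ s]) auto
    qed
    have "{\<omega>\<in>space M. truncated_passage_time B \<psi> L \<omega> < c}
      = {\<omega>\<in>space (past c). \<exists>n::nat. \<forall>m::nat. \<exists>q\<in>\<rat>. q \<in> {a n..c - a n} \<and> - (1 / real (Suc m)) < - \<bar>B q \<omega> - \<psi> q\<bar>}"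
    proof -
      have "truncated_passage_time B \<psi> L \<omega> < c \<longleftrightarrow>
        (\<exists>n::nat. \<forall>m::nat. \<exists>q\<in>\<rat>. q \<in> {a n..c - a n} \<and> - (1 / real (Suc m)) < - \<bar>B q \<omega> - \<psi> q\<bar>)"
        if \<omega>: "\<omega> \<in> space M" for \<omega>
      proof -
        have "(\<exists>s\<in>{a n..c - a n}. B s \<omega> = \<psi> s) \<longleftrightarrow> (\<exists>s\<in>{a n..c - a n}. 0 \<le> - \<bar>B s \<omega> - \<psi> s\<bar>)" for n
          by auto
        also have "\<dots> n \<longleftrightarrow> (\<forall>m::nat. \<exists>q\<in>\<rat>. q \<in> {a n..c - a n} \<and> - (1 / real (Suc m)) < - \<bar>B q \<omega> - \<psi> q\<bar>)" for n
          using a[of n] by (intro ex_nonneg_iff_rational continuous_intros continuous_on_subset[OF paths[OF \<omega>]]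
              continuous_on_subset[OF \<psi>]) auto
        finally show ?thesis
          unfolding truncated_passage_time_less_iff[OF L True] ex by simp
      qed
      then show ?thesis by auto
    qed
    also have "\<dots> \<in> sets (past c)"
    proof (intro sets.sets_Collect_countable_Ex sets.sets_Collect_countable_All sets.sets_Collect_countable_Ex' countable_rat)
      fix n m :: nat and q :: real assume "q \<in> \<rat>"
      show "{\<omega>\<in>space (past c). q \<in> {a n..c - a n} \<and> - (1 / real (Suc m)) < - \<bar>B q \<omega> - \<psi> q\<bar>} \<in> sets (past c)"
      proof (cases "q \<in> {a n..c - a n}")
        case True
        then have [measurable]: "B q \<in> borel_measurable (past c)"
          using a[of n] by (intro measurable_past) auto
        show ?thesis by measurable
      next
        case False
        then have "{\<omega>\<in>space (past c). q \<in> {a n..c - a n} \<and> - (1 / real (Suc m)) < - \<bar>B q \<omega> - \<psi> q\<bar>} = {}"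
          by blast
        then show ?thesis by (simp only: sets.empty_sets)
      qed
    qed
    finally show ?thesis .
  qed
qed

end

text \<open>Reflection principle with drift: as a function of the final distance to a line of slope \<open>- r\<close>,
  \<open>reflection r\<close> vanishes on paths that stay below the line, and has mean one for a path that starts on
  the line.  By the strong Markov property its mean is therefore the probability of hitting the line.\<close>

definition reflection :: "real \<Rightarrow> real \<Rightarrow> real" where
  "reflection r x = (if x < 0 then 1 + exp (2 * r * x) else if x = 0 then 1 else 0)"

lemma reflection_nonneg: "0 \<le> reflection r x"
  by (simp add: reflection_def add_nonneg_nonneg)

lemma measurable_reflection [measurable]: "reflection r \<in> borel_measurable borel"
  unfolding reflection_def[abs_def] by measurable

section \<open>Gaussian tails and the hitting law of a line\<close>

definition std_cdf :: "real \<Rightarrow> real" where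
  "std_cdf = cdf (density lborel std_normal_density)"

lemma normal_upper_tail:
  assumes "0 < s"
  shows "emeasure (density lborel (normal_density 0 (sqrt s))) {a<..} = ennreal (1 - std_cdf (a / sqrt s))"
proof -
  let ?N = "density lborel (normal_density 0 (sqrt s))"
  interpret N: prob_space ?N using assms by (intro prob_space_normal_density) auto
  interpret S: real_distribution "density lborel std_normal_density" by (rule real_dist_normal_dist)
  have "distributed ?N lborel (\<lambda>x. x) (normal_density 0 (sqrt s))"
    unfolding distributed_def by (auto simp: distr_id2)
  then have d: "distributed ?N lborel (\<lambda>x. x / sqrt s) std_normal_density"
    using N.normal_standard_normal_convert[of "sqrt s" "\<lambda>x. x" 0] assms by simp
  have eq: "distr ?N lborel (\<lambda>x. x / sqrt s) = density lborel std_normal_density"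
    by (rule distributed_distr_eq_density[OF d])
  have "emeasure ?N {a<..} = emeasure (distr ?N lborel (\<lambda>x. x / sqrt s)) {a / sqrt s<..}"
    using assms by (subst emeasure_distr) (auto intro!: arg_cong[where f="emeasure ?N"] simp: divide_less_cancel)
  also have "\<dots> = ennreal (measure (density lborel std_normal_density) (UNIV - {..a / sqrt s}))"
    unfolding eq by (simp add: S.emeasure_eq_measure Compl_eq_Diff_UNIV[symmetric])
  also have "measure (density lborel std_normal_density) (UNIV - {..a / sqrt s}) = 1 - std_cdf (a / sqrt s)"
    unfolding std_cdf_def cdf_def using S.prob_compl[of "{..a / sqrt s}"] by simp
  finally show ?thesis .
qed

lemma std_cdf_bounds: "0 \<le> std_cdf x" "std_cdf x \<le> 1"
proof -
  interpret S: real_distribution "density lborel std_normal_density" by (rule real_dist_normal_dist)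
  show "0 \<le> std_cdf x" "std_cdf x \<le> 1" by (simp_all add: std_cdf_def cdf_def)
qed

lemma std_cdf_symmetric: "std_cdf (- x) = 1 - std_cdf x"
proof -
  let ?N = "density lborel std_normal_density"
  interpret S: real_distribution ?N by (rule real_dist_normal_dist)
  have "ennreal (std_cdf (- x)) = emeasure ?N {..- x}"
    by (simp add: std_cdf_def cdf_def S.emeasure_eq_measure)
  also have "\<dots> = (\<integral>\<^sup>+y. ennreal (std_normal_density y) * indicator {..- x} y \<partial>lborel)"
    by (simp add: emeasure_density)
  also have "\<dots> = (\<integral>\<^sup>+y. ennreal (std_normal_density (- y)) * indicator {..- x} (- y) \<partial>lborel)"
    by (subst nn_integral_real_affine[where c="-1" and t=0]) auto
  also have "\<dots> = (\<integral>\<^sup>+y. ennreal (std_normal_density y) * indicator {x..} y \<partial>lborel)"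
    by (intro nn_integral_cong) (auto simp: indicator_def normal_density_def)
  also have "\<dots> = (\<integral>\<^sup>+y. ennreal (std_normal_density y) * indicator {x<..} y \<partial>lborel)"
    using AE_lborel_singleton[of x] by (intro nn_integral_cong_AE) (auto elim!: eventually_mono simp: indicator_def)
  also have "\<dots> = emeasure ?N {x<..}" by (simp add: emeasure_density)
  also have "\<dots> = ennreal (1 - std_cdf x)" using normal_upper_tail[of 1 x] by simp
  finally show ?thesis using std_cdf_bounds by simp
qed

text \<open>The Bachelier-Levy formula for the first hitting time of the line
  \<open>H - r * s\<close>. For \<open>r = 0\<close> it is
  \<open>2 * (1 - std_cdf (H / sqrt t))\<close>, the classical reflection principle.\<close>

definition line_hit_cdf :: "real \<Rightarrow> real \<Rightarrow> real \<Rightarrow> real" where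
  "line_hit_cdf H r t = 1 - std_cdf ((H - r * t) / sqrt t) + exp (2 * r * H) * (1 - std_cdf ((H + r * t) / sqrt t))"

text \<open>The constant part of \<open>reflection\<close> yields a Gaussian tail. The exponential
  part tilts the normal density into one shifted by \<open>2 * r * s\<close> (\<open>key\<close>),
  hence a second tail with weight \<open>exp (2 * r * H)\<close>.\<close>

lemma nn_integral_reflection:
  assumes s: "0 < s"
  shows "(\<integral>\<^sup>+y. ennreal (reflection r (H - r * s - y)) \<partial>density lborel (normal_density 0 (sqrt s)))
    = ennreal (line_hit_cdf H r s)"
proof -
  let ?n = "normal_density 0 (sqrt s)"
  let ?N = "density lborel ?n"
  have "(\<integral>\<^sup>+y. ennreal (reflection r (H - r * s - y)) \<partial>?N)
    = (\<integral>\<^sup>+y. ennreal (?n y) * ennreal (reflection r (H - r * s - y)) \<partial>lborel)"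
    by (subst nn_integral_density) auto
  also have "\<dots> = (\<integral>\<^sup>+y. ennreal (?n y) * indicator {H - r * s<..} y
      + ennreal (exp (2 * r * H)) * (ennreal (?n (y + 2 * r * s)) * indicator {H + r * s<..} (y + 2 * r * s)) \<partial>lborel)"
  proof (intro nn_integral_cong_AE)
    have key: "exp (2 * r * (H - r * s - y)) * ?n y = exp (2 * r * H) * ?n (y + 2 * r * s)" for y
    proof -
      have "exp (2 * r * (H - r * s - y)) * exp (- (y\<^sup>2 / (2 * s))) = exp (2 * r * H) * exp (- ((y + 2 * r * s)\<^sup>2 / (2 * s)))"
        unfolding exp_add[symmetric] exp_inj_iff using s by (simp add: field_simps power2_eq_square)
      then show ?thesis using s by (simp add: normal_density_def)
    qed
    show "AE y in lborel. ennreal (?n y) * ennreal (reflection r (H - r * s - y))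
      = ennreal (?n y) * indicator {H - r * s<..} y
        + ennreal (exp (2 * r * H)) * (ennreal (?n (y + 2 * r * s)) * indicator {H + r * s<..} (y + 2 * r * s))"
      using AE_lborel_singleton[of "H - r * s"]
    proof eventually_elim
      fix y assume "y \<noteq> H - r * s"
      then consider "y < H - r * s" | "y > H - r * s" by linarith
      then show "ennreal (?n y) * ennreal (reflection r (H - r * s - y))
        = ennreal (?n y) * indicator {H - r * s<..} y
          + ennreal (exp (2 * r * H)) * (ennreal (?n (y + 2 * r * s)) * indicator {H + r * s<..} (y + 2 * r * s))"
      proof cases
        case 1 then show ?thesis by (simp add: reflection_def indicator_def)
      next
        case 2
        then have "?n y * reflection r (H - r * s - y) = ?n y + exp (2 * r * H) * ?n (y + 2 * r * s)"
          using key[of y] by (simp add: reflection_def algebra_simps)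
        then show ?thesis using 2
          by (simp add: indicator_def ennreal_mult[symmetric] ennreal_plus[symmetric] reflection_nonneg del: ennreal_plus)
      qed
    qed
  qed
  also have "\<dots> = (\<integral>\<^sup>+y. ennreal (?n y) * indicator {H - r * s<..} y \<partial>lborel)
      + ennreal (exp (2 * r * H)) * (\<integral>\<^sup>+y. ennreal (?n (y + 2 * r * s)) * indicator {H + r * s<..} (y + 2 * r * s) \<partial>lborel)"
    by (simp add: nn_integral_add nn_integral_cmult)
  also have "(\<integral>\<^sup>+y. ennreal (?n (y + 2 * r * s)) * indicator {H + r * s<..} (y + 2 * r * s) \<partial>lborel)
      = (\<integral>\<^sup>+y. ennreal (?n y) * indicator {H + r * s<..} y \<partial>lborel)"
    by (subst nn_integral_real_affine[where c=1 and t="2 * r * s" and f="\<lambda>y. ennreal (?n y) * indicator {H + r * s<..} y"])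
       (auto simp: add.commute)
  also have "(\<integral>\<^sup>+y. ennreal (?n y) * indicator {H - r * s<..} y \<partial>lborel) = emeasure ?N {H - r * s<..}"
    by (simp add: emeasure_density)
  also have "(\<integral>\<^sup>+y. ennreal (?n y) * indicator {H + r * s<..} y \<partial>lborel) = emeasure ?N {H + r * s<..}"
    by (simp add: emeasure_density)
  also have "emeasure ?N {H - r * s<..} + ennreal (exp (2 * r * H)) * emeasure ?N {H + r * s<..} = ennreal (line_hit_cdf H r s)"
    unfolding normal_upper_tail[OF s] line_hit_cdf_def using std_cdf_bounds
    by (simp add: ennreal_mult[symmetric] ennreal_plus[symmetric] del: ennreal_plus)
  finally show ?thesis .
qed

text \<open>For a start on the line the two tails are complementary by symmetry of the normal law.
  This is the mean one behind \<open>line_passage_cdf\<close>.\<close>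

lemma line_hit_cdf_0: "0 < s \<Longrightarrow> line_hit_cdf 0 r s = 1"
  using std_cdf_symmetric[of "r * s / sqrt s"] by (simp add: line_hit_cdf_def)

text \<open>The weight \<open>exp (2 * r * H)\<close> turns the normal density at \<open>q t\<close>
  into the one at \<open>p t\<close>, and in \<open>p' + q'\<close> the terms with \<open>r\<close>
  cancel.\<close>

lemma DERIV_line_hit_cdf:
  assumes H: "0 < H" and r: "0 < r" and t: "0 < t"
  shows "(line_hit_cdf H r has_real_derivative inverse_gaussian_density (H / r) (H\<^sup>2) t) (at t)"
proof -
  define p where "p t = (H - r * t) / sqrt t" for t
  define q where "q t = (H + r * t) / sqrt t" for t
  define p' where "p' = - (H / (2 * t * sqrt t)) - r / (2 * sqrt t)"
  define q' where "q' = - (H / (2 * t * sqrt t)) + r / (2 * sqrt t)"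
  have dp: "(p has_real_derivative p') (at t)"
    unfolding p_def p'_def using t by (auto intro!: derivative_eq_intros simp: field_simps)
  have dq: "(q has_real_derivative q') (at t)"
    unfolding q_def q'_def using t by (auto intro!: derivative_eq_intros simp: field_simps)
  have dS: "(std_cdf has_real_derivative std_normal_density x) (at x)" for x
    unfolding std_cdf_def by (rule DERIV_cdf_std_normal)
  have "(line_hit_cdf H r has_real_derivative
      - (std_normal_density (p t) * p') + exp (2 * r * H) * (- (std_normal_density (q t) * q'))) (at t)"
    unfolding line_hit_cdf_def[abs_def] p_def[symmetric] q_def[symmetric]
    by (auto intro!: derivative_eq_intros DERIV_chain2[OF dS dp] DERIV_chain2[OF dS dq])
  also have "exp (2 * r * H) * (- (std_normal_density (q t) * q')) = - (std_normal_density (p t) * q')"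
  proof -
    have sq: "(p t)\<^sup>2 = (H - r * t)\<^sup>2 / t" "(q t)\<^sup>2 = (H + r * t)\<^sup>2 / t"
      using t by (simp_all add: p_def q_def power_divide)
    have "2 * r * H + - (q t)\<^sup>2 / 2 = - (p t)\<^sup>2 / 2"
      unfolding sq using t by (simp add: field_simps power2_eq_square)
    then have "exp (2 * r * H) * std_normal_density (q t) = std_normal_density (p t)"
      by (simp add: std_normal_density_def exp_add[symmetric])
    then show ?thesis by (metis (no_types, lifting) minus_mult_right mult.assoc)
  qed
  also have "- (std_normal_density (p t) * p') + - (std_normal_density (p t) * q') = std_normal_density (p t) * (H / (t * sqrt t))"
    using t by (simp add: p'_def q'_def field_simps)
  also have "\<dots> = inverse_gaussian_density (H / r) (H\<^sup>2) t"
  proof -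
    have "(p t)\<^sup>2 = (r * t - H)\<^sup>2 / t" using t by (simp add: p_def power_divide power2_commute)
    then show ?thesis unfolding inverse_gaussian_density_drift[OF H r t]
      by (simp add: std_normal_density_def)
  qed
  finally show ?thesis .
qed

text \<open>The density is integrated from \<open>t\<close> to infinity, where its antiderivative
  \<open>line_hit_cdf H r\<close> tends to \<open>1\<close>.\<close>

lemma inverse_gaussian_cdf:
  assumes H: "0 < H" and r: "0 < r" and t: "0 < t"
  shows "measure (inverse_gaussian (H / r) (H\<^sup>2)) {..t} = line_hit_cdf H r t"
proof -
  let ?I = "inverse_gaussian (H / r) (H\<^sup>2)" and ?f = "inverse_gaussian_density (H / r) (H\<^sup>2)"
  interpret G: prob_space ?I using H r by (intro prob_space_inverse_gaussian) auto
  interpret S: real_distribution "density lborel std_normal_density" by (rule real_dist_normal_dist)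
  have lim: "(line_hit_cdf H r \<longlongrightarrow> 1) at_top"
  proof -
    have "filterlim (\<lambda>t. (H - r * t) / sqrt t) at_bot at_top" "filterlim (\<lambda>t. (H + r * t) / sqrt t) at_top at_top"
      using r by real_asymp+
    then have "(line_hit_cdf H r \<longlongrightarrow> 1 - 0 + exp (2 * r * H) * (1 - 1)) at_top"
      unfolding line_hit_cdf_def[abs_def] std_cdf_def
      by (intro tendsto_intros filterlim_compose[OF S.cdf_lim_at_bot] filterlim_compose[OF S.cdf_lim_at_top_prob])
    then show ?thesis by simp
  qed
  have "emeasure ?I {t<..} = (\<integral>\<^sup>+x. ennreal (?f x) * indicator {t<..} x \<partial>lborel)"
    by (simp add: inverse_gaussian_def emeasure_density)
  also have "\<dots> = (\<integral>\<^sup>+x. ennreal (?f x) * indicator {t..} x \<partial>lborel)"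
    using AE_lborel_singleton[of t] by (intro nn_integral_cong_AE) (auto elim!: eventually_mono simp: indicator_def)
  also have "\<dots> = ennreal (1 - line_hit_cdf H r t)"
    using H r t lim by (intro nn_integral_FTC_atLeast DERIV_line_hit_cdf inverse_gaussian_density_nonneg) auto
  finally have up: "emeasure ?I {t<..} = ennreal (1 - line_hit_cdf H r t)" .
  \<comment> \<open>\<open>ennreal\<close> sends negative numbers to \<open>0\<close>, so only this
    bound lets the tail determine \<open>line_hit_cdf\<close>.\<close>
  have "line_hit_cdf H r t \<le> 1"
  proof (rule tendsto_lowerbound[OF lim])
    show "eventually (\<lambda>x. line_hit_cdf H r t \<le> line_hit_cdf H r x) at_top"
      unfolding eventually_at_top_linorder
    proof (intro exI allI impI)
      fix x assume x: "t \<le> x"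
      show "line_hit_cdf H r t \<le> line_hit_cdf H r x"
      proof (rule DERIV_nonneg_imp_nondecreasing[OF x])
        fix y assume "t \<le> y"
        then have "(line_hit_cdf H r has_real_derivative ?f y) (at y)" using t by (intro DERIV_line_hit_cdf H r) simp
        then show "\<exists>z. (line_hit_cdf H r has_real_derivative z) (at y) \<and> 0 \<le> z"
          using inverse_gaussian_density_nonneg[of "H\<^sup>2" "H / r" y] by auto
      qed
    qed
  qed simp
  with up have "measure ?I {t<..} = 1 - line_hit_cdf H r t"
    by (simp add: G.emeasure_eq_measure)
  moreover have "measure ?I {t<..} = 1 - measure ?I {..t}"
    using G.prob_compl[of "{..t}"] by (simp add: Compl_eq_Diff_UNIV[symmetric])
  ultimately show ?thesis by simp
qed

section \<open>Renewal equation for the hitting probability\<close>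

lemma mesh_pos: "0 < h \<Longrightarrow> 0 < mesh h x"
  by (simp add: mesh_def add_nonneg_pos)

text \<open>Evaluation of a path at a variable time is not jointly measurable on the product space
  over all of \<open>{0..}\<close>; on a mesh only countably many times occur.\<close>

lemma measurable_eval_mesh:
  assumes "0 < h"
  shows "(\<lambda>z. snd z (mesh h (t - fst z))) \<in> borel_measurable (borel \<Otimes>\<^sub>M PiM {0..} (\<lambda>_. borel :: real measure))"
proof -
  have "(\<lambda>z. (\<lambda>k z. snd z (h * (real k + 1))) (nat \<lfloor>(t - fst z) / h\<rfloor>) z)
    \<in> borel_measurable (borel \<Otimes>\<^sub>M PiM {0..} (\<lambda>_. borel :: real measure))"
  proof (rule measurable_compose_countable)
    show "(\<lambda>z. snd z (h * (real k + 1))) \<in> borel_measurable (borel \<Otimes>\<^sub>M PiM {0..} (\<lambda>_. borel :: real measure))" for k :: nat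
      by (rule measurable_compose[OF measurable_snd measurable_component_singleton]) (use assms in auto)
  qed measurable
  then show ?thesis by (simp add: mesh_def)
qed

text \<open>A path started at time \<open>fst s\<close> at distance \<open>snd s\<close> below the boundary hits it by time \<open>t\<close> (see
  \<open>reach_iff\<close>).  Only rational times occur, which makes this jointly measurable in \<open>s\<close> and the path.\<close>

definition reach :: "(real \<Rightarrow> real) \<Rightarrow> real \<Rightarrow> real \<times> real \<Rightarrow> (real \<Rightarrow> real) \<Rightarrow> bool" where
  "reach \<phi> t s w \<longleftrightarrow> fst s \<le> t \<and> (\<forall>m::nat. \<exists>q\<in>\<rat>. q \<in> {0..t - fst s} \<and>
     - (1 / real (Suc m)) < w q - (\<phi> (max 0 (fst s + q)) - \<phi> (max 0 (fst s)) + snd s))"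

lemma continuous_on_max_0:
  assumes "continuous_on {0..} \<phi>"
  shows "continuous_on UNIV (\<lambda>x :: real. \<phi> (max 0 x))"
  by (rule continuous_on_compose2[OF assms]) (auto intro!: continuous_intros)

lemma reach_iff:
  assumes \<phi>: "continuous_on {0..} \<phi>" and w: "continuous_on {0..} w"
  shows "reach \<phi> t s w \<longleftrightarrow>
    fst s \<le> t \<and> (\<exists>v\<in>{0..t - fst s}. \<phi> (max 0 (fst s + v)) - \<phi> (max 0 (fst s)) + snd s \<le> w v)"
proof -
  have "(\<exists>v\<in>{0..t - fst s}. 0 \<le> w v - (\<phi> (max 0 (fst s + v)) - \<phi> (max 0 (fst s)) + snd s)) \<longleftrightarrow>
    (\<forall>m::nat. \<exists>q\<in>\<rat>. q \<in> {0..t - fst s} \<and> - (1 / real (Suc m)) < w q - (\<phi> (max 0 (fst s + q)) - \<phi> (max 0 (fst s)) + snd s))"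
    by (intro ex_nonneg_iff_rational continuous_intros continuous_on_subset[OF w]
        continuous_on_compose2[OF continuous_on_max_0[OF \<phi>]]) auto
  then show ?thesis by (simp add: reach_def)
qed

lemma measurable_reach:
  assumes \<phi>: "continuous_on {0..} \<phi>"
  shows "Measurable.pred ((borel :: (real \<times> real) measure) \<Otimes>\<^sub>M PiM {0..} (\<lambda>_. borel)) (\<lambda>z. reach \<phi> t (fst z) (snd z))"
proof -
  have [measurable]: "(\<lambda>x. \<phi> (max 0 x)) \<in> borel_measurable borel"
    by (rule borel_measurable_continuous_onI[OF continuous_on_max_0[OF \<phi>]])
  note [measurable] = borel_measurable_fst_snd
  let ?M = "(borel :: (real \<times> real) measure) \<Otimes>\<^sub>M PiM {0..} (\<lambda>_. borel :: real measure)"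
  have "Measurable.pred ?M (\<lambda>z. q \<in> {0..t - fst (fst z)} \<and>
     - (1 / real (Suc m)) < snd z q - (\<phi> (max 0 (fst (fst z) + q)) - \<phi> (max 0 (fst (fst z))) + snd (fst z)))" for q and m :: nat
  proof (cases "0 \<le> q")
    case True
    then have [measurable]: "(\<lambda>z. snd z q) \<in> borel_measurable ?M"
      by (intro measurable_compose[OF measurable_snd measurable_component_singleton]) auto
    show ?thesis using True by simp
  qed simp
  then have "{z\<in>space ?M. \<forall>m::nat. \<exists>q\<in>\<rat>. q \<in> {0..t - fst (fst z)} \<and>
     - (1 / real (Suc m)) < snd z q - (\<phi> (max 0 (fst (fst z) + q)) - \<phi> (max 0 (fst (fst z))) + snd (fst z))} \<in> sets ?M"
    unfolding pred_def by (rule sets.sets_Collect_countable_All[OF sets.sets_Collect_countable_Ex'[OF _ countable_rat]])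
  then have [measurable]: "Measurable.pred ?M (\<lambda>z. \<forall>m::nat. \<exists>q\<in>\<rat>. q \<in> {0..t - fst (fst z)} \<and>
     - (1 / real (Suc m)) < snd z q - (\<phi> (max 0 (fst (fst z) + q)) - \<phi> (max 0 (fst (fst z))) + snd (fst z)))"
    unfolding pred_def .
  have "Measurable.pred ?M (\<lambda>z. fst (fst z) \<le> t \<and> (\<forall>m::nat. \<exists>q\<in>\<rat>. q \<in> {0..t - fst (fst z)} \<and>
     - (1 / real (Suc m)) < snd z q - (\<phi> (max 0 (fst (fst z) + q)) - \<phi> (max 0 (fst (fst z))) + snd (fst z))))"
    by measurable
  then show ?thesis by (simp add: reach_def)
qed

section \<open>Hitting probabilities of lines and of the boundary\<close>

context standard_brownian_motion
begin

lemma continuous_on_path: "0 \<le> c \<Longrightarrow> \<omega> \<in> space M \<Longrightarrow> continuous_on {0..} (path c \<omega>)"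
proof -
  assume c: "0 \<le> c" and \<omega>: "\<omega> \<in> space M"
  have "continuous_on {0..} (\<lambda>s. B (c + s) \<omega> - B c \<omega>)"
    using c by (intro continuous_intros continuous_on_compose2[OF paths[OF \<omega>]]) auto
  then show ?thesis by (rule continuous_on_eq) (simp add: path_def)
qed

lemma passage_attained:
  assumes "\<omega> \<in> space M" "continuous_on {0..} \<psi>" "0 < L" "B 0 \<omega> \<noteq> \<psi> 0"
    "truncated_passage_time B \<psi> L \<omega> < L"
  shows "0 < truncated_passage_time B \<psi> L \<omega>"
    "B (truncated_passage_time B \<psi> L \<omega>) \<omega> = \<psi> (truncated_passage_time B \<psi> L \<omega>)"
  using truncated_passage_time_attained[of B \<omega> \<psi> L] paths assms by auto

lemma distr_path_0:
  assumes "0 < s"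
  shows "distr M borel (\<lambda>\<omega>. path 0 \<omega> s) = density lborel (normal_density 0 (sqrt s))"
proof -
  have "distributed M lborel (\<lambda>\<omega>. B s \<omega> - B 0 \<omega>) (normal_density 0 (sqrt (s - 0)))"
    using assms by (intro increment) auto
  then show ?thesis using assms
    by (auto dest!: distributed_distr_eq_density simp: path_def distr_cong[OF refl sets_lborel[symmetric] refl])
qed

lemma measurable_path_component [measurable]: "0 \<le> s \<Longrightarrow> (\<lambda>\<omega>. path 0 \<omega> s) \<in> borel_measurable M"
  by (intro measurable_compose[OF measurable_path measurable_component_singleton]) auto

lemma nn_integral_reflection_path:
  assumes "0 < s"
  shows "(\<integral>\<^sup>+\<omega>. ennreal (reflection r (H - r * s - path 0 \<omega> s)) \<partial>M) = ennreal (line_hit_cdf H r s)"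
  unfolding nn_integral_reflection[OF assms, symmetric] distr_path_0[OF assms, symmetric]
  using assms by (subst nn_integral_distr) auto

text \<open>The mean of \<open>reflection\<close> at time \<open>t\<close> is computed in two ways:
  from the normal law of the path at \<open>t\<close>, and by the strong Markov property at the
  passage time. The case \<open>r = 0\<close> serves \<open>hit_prob_ge\<close>, which uses a
  horizontal line.\<close>

theorem line_passage_cdf:
  assumes H: "0 < H" and r: "0 \<le> r" and t: "0 < t" "t < L"
  shows "emeasure M {\<omega>\<in>space M. truncated_passage_time B (\<lambda>s. H - r * s) L \<omega> \<le> t} = ennreal (line_hit_cdf H r t)"
proof -
  let ?\<psi> = "\<lambda>s. H - r * s"
  let ?\<sigma> = "truncated_passage_time B ?\<psi> L"
  let ?h = "\<lambda>n. 1 / real (Suc n)"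
  have L: "0 < L" using t by simp
  have \<psi>: "continuous_on {0..} ?\<psi>" by (intro continuous_intros)
  have opt: "optional_time ?\<sigma>" by (rule optional_time_truncated_passage[OF \<psi> L])
  note [measurable] = measurable_optional_time[OF opt]
  \<comment> \<open>\<open>F\<close> has to be measurable on the whole product space, so the value
    at the variable time \<open>t - fst z\<close> is written as a limit along meshes; on continuous
    paths the limit is that value.\<close>
  define F where "F z = indicator {..t} (fst z)
      * ennreal (reflection r (- (r * (t - fst z)) - lim (\<lambda>n. snd z (mesh (?h n) (t - fst z)))))" for z :: "real \<times> (real \<Rightarrow> real)"
  have [measurable]: "(\<lambda>z. snd z (mesh (?h n) (t - fst z))) \<in> borel_measurable (borel \<Otimes>\<^sub>M PiM {0..} (\<lambda>_. borel :: real measure))" for n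
    by (intro measurable_eval_mesh) simp
  have F[measurable]: "F \<in> borel_measurable (borel \<Otimes>\<^sub>M PiM {0..} (\<lambda>_. borel))"
    unfolding F_def[abs_def] by measurable
  have lim: "lim (\<lambda>n. path c \<omega> (mesh (?h n) s)) = B (c + s) \<omega> - B c \<omega>"
    if "\<omega> \<in> space M" "0 \<le> c" "0 \<le> s" for \<omega> c s
  proof (rule limI)
    have "(\<lambda>n. path c \<omega> (mesh (?h n) s)) \<longlonglongrightarrow> path c \<omega> s"
      using that less_imp_le[OF mesh_pos]
      by (intro continuous_on_tendsto_compose[OF continuous_on_path mesh_tendsto]) auto
    then show "(\<lambda>n. path c \<omega> (mesh (?h n) s)) \<longlonglongrightarrow> B (c + s) \<omega> - B c \<omega>" using that by (simp add: path_def)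
  qed
  have "(\<integral>\<^sup>+\<omega>. F (?\<sigma> \<omega>, path (?\<sigma> \<omega>) \<omega>) \<partial>M) = (\<integral>\<^sup>+\<omega>. ennreal (reflection r (H - r * t - path 0 \<omega> t)) \<partial>M)"
  proof (rule nn_integral_cong_AE)
    show "AE \<omega> in M. F (?\<sigma> \<omega>, path (?\<sigma> \<omega>) \<omega>) = ennreal (reflection r (H - r * t - path 0 \<omega> t))"
      using start AE_space
    proof eventually_elim
      fix \<omega> assume B0: "B 0 \<omega> = 0" and \<omega>: "\<omega> \<in> space M"
      note \<sigma>0 = truncated_passage_time_bounds(1)[OF L, of B ?\<psi> \<omega>]
      show "F (?\<sigma> \<omega>, path (?\<sigma> \<omega>) \<omega>) = ennreal (reflection r (H - r * t - path 0 \<omega> t))"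
      proof (cases "?\<sigma> \<omega> \<le> t")
        case True
        have "B (?\<sigma> \<omega>) \<omega> = H - r * ?\<sigma> \<omega>"
          using passage_attained(2)[OF \<omega> \<psi> L] B0 H True t by simp
        moreover have "lim (\<lambda>n. path (?\<sigma> \<omega>) \<omega> (mesh (?h n) (t - ?\<sigma> \<omega>))) = B t \<omega> - B (?\<sigma> \<omega>) \<omega>"
          using lim[OF \<omega> \<sigma>0, of "t - ?\<sigma> \<omega>"] True by (simp del: of_nat_Suc)
        moreover have "path 0 \<omega> t = B t \<omega>" using t B0 by (simp add: path_def)
        ultimately have "F (?\<sigma> \<omega>, path (?\<sigma> \<omega>) \<omega>) = ennreal (reflection r (H - path 0 \<omega> t - r * t))"
          using True by (simp add: F_def right_diff_distrib del: of_nat_Suc)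
        also have "H - path 0 \<omega> t - r * t = H - r * t - path 0 \<omega> t" by simp
        finally show ?thesis .
      next
        case False
        have "B t \<omega> < H - r * t"
        proof (rule ccontr)
          assume "\<not> B t \<omega> < H - r * t"
          then obtain s where "0 < s" "s \<le> t" "B s \<omega> = H - r * s"
            using crossing_time[OF paths[OF \<omega>] \<psi>, of t] B0 H t by (auto simp: not_less)
          then show False using truncated_passage_time_le[OF L, of s B \<omega> ?\<psi>] False by simp
        qed
        then show ?thesis using False t B0 by (simp add: F_def path_def reflection_def)
      qed
    qed
  qed
  then have "ennreal (line_hit_cdf H r t) = (\<integral>\<^sup>+\<omega>. F (?\<sigma> \<omega>, path (?\<sigma> \<omega>) \<omega>) \<partial>M)"
    using nn_integral_reflection_path[OF t(1)] by simp
  also have "\<dots> = (\<integral>\<^sup>+g. (\<integral>\<^sup>+\<omega>. F (g, path 0 \<omega>) \<partial>M) \<partial>distr M borel ?\<sigma>)"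
    by (rule nn_integral_strong_markov[OF opt F])
  also have "\<dots> = (\<integral>\<^sup>+g. indicator {..t} g \<partial>distr M borel ?\<sigma>)"
  proof (intro nn_integral_cong)
    fix g
    show "(\<integral>\<^sup>+\<omega>. F (g, path 0 \<omega>) \<partial>M) = indicator {..t} g"
    proof (cases "g \<le> t")
      case False then show ?thesis by (simp add: F_def)
    next
      case True
      have "(\<integral>\<^sup>+\<omega>. F (g, path 0 \<omega>) \<partial>M) = (\<integral>\<^sup>+\<omega>. ennreal (reflection r (0 - r * (t - g) - path 0 \<omega> (t - g))) \<partial>M)"
        using True lim[of _ 0 "t - g"] by (intro nn_integral_cong) (simp add: F_def path_def)
      also have "\<dots> = 1"
      \<comment> \<open>At \<open>g = t\<close> no time is left and the path sits on the line, where
        \<open>reflection\<close> is \<open>1\<close>.\<close>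
      proof (cases "g = t")
        case True
        then show ?thesis by (simp add: path_def reflection_def emeasure_space_1)
      next
        case False
        then show ?thesis using True nn_integral_reflection_path[of "t - g" r 0] line_hit_cdf_0[of "t - g" r] by simp
      qed
      finally show ?thesis using True by simp
    qed
  qed
  also have "\<dots> = emeasure M {\<omega>\<in>space M. ?\<sigma> \<omega> \<le> t}"
    by (simp add: emeasure_distr vimage_def Int_def conj_commute)
  finally show ?thesis ..
qed

text \<open>The bridge between Brownian motion and the simulated variable. Between \<open>0\<close>
  and \<open>L\<close> both distribution functions are \<open>line_hit_cdf\<close>; outside they are
  \<open>0\<close> and \<open>1\<close>.\<close>

lemma distr_line_passage:
  assumes H: "0 < H" and r: "0 < r" and L: "0 < L"
  shows "distr M borel (truncated_passage_time B (\<lambda>s. H - r * s) L)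
    = distr (inverse_gaussian (H / r) (H\<^sup>2)) borel (\<lambda>g. min g L)"
proof (rule cdf_unique)
  let ?\<psi> = "\<lambda>s. H - r * s"
  let ?\<sigma> = "truncated_passage_time B ?\<psi> L"
  let ?I = "inverse_gaussian (H / r) (H\<^sup>2)"
  have \<psi>: "continuous_on {0..} ?\<psi>" by (intro continuous_intros)
  note [measurable] = measurable_optional_time[OF optional_time_truncated_passage[OF \<psi> L]]
  interpret G: prob_space ?I using H r by (intro prob_space_inverse_gaussian) auto
  show "real_distribution (distr M borel ?\<sigma>)" "real_distribution (distr ?I borel (\<lambda>g. min g L))"
    by (auto intro!: real_distribution_distr G.real_distribution_distr)
  show "cdf (distr M borel ?\<sigma>) = cdf (distr ?I borel (\<lambda>g. min g L))"
  proof
    fix x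
    have 1: "cdf (distr M borel ?\<sigma>) x = prob {\<omega>\<in>space M. ?\<sigma> \<omega> \<le> x}"
      by (simp add: cdf_def measure_distr vimage_def Int_def conj_commute)
    have 2: "cdf (distr ?I borel (\<lambda>g. min g L)) x = measure ?I {g. min g L \<le> x}"
      by (simp add: cdf_def measure_distr vimage_def)
    consider "x \<le> 0" | "0 < x" "x < L" | "L \<le> x" by linarith
    then show "cdf (distr M borel ?\<sigma>) x = cdf (distr ?I borel (\<lambda>g. min g L)) x"
    proof cases
      case 1
      have "AE \<omega> in M. \<not> ?\<sigma> \<omega> \<le> x"
        using start AE_space
      proof eventually_elim
        fix \<omega> assume "B 0 \<omega> = 0" and \<omega>: "\<omega> \<in> space M"
        then have "0 < ?\<sigma> \<omega>"
          using passage_attained(1)[OF \<omega> \<psi> L] H L by (cases "?\<sigma> \<omega> < L") auto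
        then show "\<not> ?\<sigma> \<omega> \<le> x" using 1 by simp
      qed
      then have "prob {\<omega>\<in>space M. ?\<sigma> \<omega> \<le> x} = 0" by (subst prob_eq_0) auto
      moreover have "measure ?I {g. min g L \<le> x} = 0"
      proof (subst G.prob_eq_0)
        show "AE g in ?I. g \<notin> {g. min g L \<le> x}"
          using AE_inverse_gaussian_pos by eventually_elim (use 1 L in auto)
      qed simp
      ultimately show ?thesis using \<open>cdf (distr M borel ?\<sigma>) x = _\<close> 2 by simp
    next
      case 2
      have "ennreal (prob {\<omega>\<in>space M. ?\<sigma> \<omega> \<le> x}) = ennreal (line_hit_cdf H r x)"
        using line_passage_cdf[OF H _ 2, of r] r by (simp add: emeasure_eq_measure)
      moreover have "measure ?I {g. min g L \<le> x} = line_hit_cdf H r x"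
      proof -
        have "{g. min g L \<le> x} = {..x}" using 2 by auto
        then show ?thesis using inverse_gaussian_cdf[OF H r 2(1)] by simp
      qed
      ultimately show ?thesis using 1 \<open>cdf (distr ?I borel (\<lambda>g. min g L)) x = _\<close>
        by (metis ennreal_inj measure_nonneg)
    next
      case 3
      have "{\<omega>\<in>space M. ?\<sigma> \<omega> \<le> x} = space M"
        using 3 by (auto intro: order_trans[OF truncated_passage_time_bounds(2)[OF L]])
      moreover have "{g. min g L \<le> x} = space ?I" using 3 by (auto simp: min_le_iff_disj)
      ultimately show ?thesis using 1 2 prob_space G.prob_space by simp
    qed
  qed
qed

text \<open>The \<open>Q\<close> of the overview. \<open>path 0\<close> starts exactly at
  \<open>0\<close>, whereas \<open>B 0 = 0\<close> holds only almost surely.\<close>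

definition hit_prob :: "(real \<Rightarrow> real) \<Rightarrow> real \<Rightarrow> real \<times> real \<Rightarrow> ennreal" where
  "hit_prob \<phi> t s = (\<integral>\<^sup>+\<omega>. indicator {w. reach \<phi> t s w} (path 0 \<omega>) \<partial>M)"

lemma measurable_indicator_reach:
  assumes \<phi>: "continuous_on {0..} \<phi>" and f: "f \<in> measurable N borel" and g: "g \<in> measurable N (PiM {0..} (\<lambda>_. borel))"
  shows "(\<lambda>x. indicator {w. reach \<phi> t (f x) w} (g x) :: ennreal) \<in> borel_measurable N"
proof -
  have "(\<lambda>x. (f x, g x)) \<in> measurable N (borel \<Otimes>\<^sub>M PiM {0..} (\<lambda>_. borel))"
    using f g by measurable
  from measurable_compose[OF this measurable_reach[OF \<phi>, of t]]
  have [measurable]: "Measurable.pred N (\<lambda>x. reach \<phi> t (f x) (g x))" by simp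
  have "(\<lambda>x. indicator {w. reach \<phi> t (f x) w} (g x) :: ennreal) = (\<lambda>x. if reach \<phi> t (f x) (g x) then 1 else 0)"
    by (auto simp: indicator_def)
  then show ?thesis by simp
qed

lemma measurable_hit_prob:
  assumes "continuous_on {0..} \<phi>"
  shows "hit_prob \<phi> t \<in> borel_measurable borel"
  unfolding hit_prob_def[abs_def]
proof (rule borel_measurable_nn_integral)
  have "(\<lambda>z. indicator {w. reach \<phi> t (fst z) w} (path 0 (snd z)) :: ennreal) \<in> borel_measurable (borel \<Otimes>\<^sub>M M)"
    by (intro measurable_indicator_reach assms measurable_compose[OF measurable_snd measurable_path]) auto
  then show "(\<lambda>(s, \<omega>). indicator {w. reach \<phi> t s w} (path 0 \<omega>) :: ennreal) \<in> borel_measurable (borel \<Otimes>\<^sub>M M)"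
    by (simp add: case_prod_beta')
qed

lemma hit_prob_le: "hit_prob \<phi> t s \<le> indicator {s. fst s \<le> t} s"
proof (cases "fst s \<le> t")
  case True
  have "hit_prob \<phi> t s \<le> (\<integral>\<^sup>+\<omega>. 1 \<partial>M)"
    unfolding hit_prob_def by (intro nn_integral_mono) (auto simp: indicator_def)
  then show ?thesis using True by (simp add: emeasure_space_1)
next
  case False
  then show ?thesis by (simp add: hit_prob_def reach_def)
qed

lemma hit_prob_eq_0: "t < fst s \<Longrightarrow> hit_prob \<phi> t s = 0"
  by (simp add: hit_prob_def reach_def)

theorem hit_prob_renewal:
  assumes \<phi>: "continuous_on {0..} \<phi>" and slope: "\<And>s t. 0 \<le> s \<Longrightarrow> s \<le> t \<Longrightarrow> - (r * (t - s)) \<le> \<phi> t - \<phi> s"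
    and r: "0 < r" and T: "0 \<le> T" and H: "0 < H"
  shows "(\<integral>\<^sup>+g. hit_prob \<phi> t (update \<phi> r (T, H) g) \<partial>inverse_gaussian (H / r) (H\<^sup>2)) = hit_prob \<phi> t (T, H)"
proof (cases "T \<le> t")
  case False
  have "(\<integral>\<^sup>+g. hit_prob \<phi> t (update \<phi> r (T, H) g) \<partial>inverse_gaussian (H / r) (H\<^sup>2)) = (\<integral>\<^sup>+g. 0 \<partial>inverse_gaussian (H / r) (H\<^sup>2))"
  proof (rule nn_integral_cong_AE)
    show "AE g in inverse_gaussian (H / r) (H\<^sup>2). hit_prob \<phi> t (update \<phi> r (T, H) g) = 0"
      using AE_inverse_gaussian_pos by eventually_elim (use False in \<open>auto intro!: hit_prob_eq_0 simp: update_def\<close>)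
  qed
  also have "\<dots> = hit_prob \<phi> t (T, H)" using False by (simp add: hit_prob_eq_0)
  finally show ?thesis .
next
  case Tt: True
  let ?\<psi> = "\<lambda>s. H - r * s"
  \<comment> \<open>A truncated passage time equal to \<open>L\<close> leads to time
    \<open>t + 1\<close>, past \<open>t\<close>; hence truncation never affects hitting by time
    \<open>t\<close>.\<close>
  define L where "L = t - T + 1"
  have L: "0 < L" using Tt by (simp add: L_def)
  let ?\<sigma> = "truncated_passage_time B ?\<psi> L"
  let ?I = "inverse_gaussian (H / r) (H\<^sup>2)"
  have \<psi>: "continuous_on {0..} ?\<psi>" by (intro continuous_intros)
  have opt: "optional_time ?\<sigma>" by (rule optional_time_truncated_passage[OF \<psi> L])
  note [measurable] = measurable_optional_time[OF opt]
  note up[measurable] = measurable_update_at[OF \<phi>, of r "(T, H)"]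
  have hp[measurable]: "hit_prob \<phi> t \<in> borel_measurable borel" by (rule measurable_hit_prob[OF \<phi>])
  have F: "(\<lambda>z. indicator {w. reach \<phi> t (update \<phi> r (T, H) (fst z)) w} (snd z) :: ennreal)
    \<in> borel_measurable (borel \<Otimes>\<^sub>M PiM {0..} (\<lambda>_. borel))"
    by (intro measurable_indicator_reach \<phi> measurable_compose[OF measurable_fst up] measurable_snd)
  have "hit_prob \<phi> t (T, H) = (\<integral>\<^sup>+\<omega>. (\<lambda>z. indicator {w. reach \<phi> t (update \<phi> r (T, H) (fst z)) w} (snd z)) (?\<sigma> \<omega>, path (?\<sigma> \<omega>) \<omega>) \<partial>M)"
    unfolding hit_prob_def
  proof (rule nn_integral_cong_AE)
    show "AE \<omega> in M. indicator {w. reach \<phi> t (T, H) w} (path 0 \<omega>)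
      = ((\<lambda>z. indicator {w. reach \<phi> t (update \<phi> r (T, H) (fst z)) w} (snd z)) (?\<sigma> \<omega>, path (?\<sigma> \<omega>) \<omega>) :: ennreal)"
      using start AE_space
    proof eventually_elim
      fix \<omega> assume B0: "B 0 \<omega> = 0" and \<omega>: "\<omega> \<in> space M"
      define \<sigma> where "\<sigma> = ?\<sigma> \<omega>"
      have \<sigma>0: "0 \<le> \<sigma>" unfolding \<sigma>_def by (rule truncated_passage_time_bounds[OF L])
      have attained: "B \<sigma> \<omega> = H - r * \<sigma>" if "\<sigma> \<le> t - T"
      proof -
        have "\<sigma> < L" using that by (simp add: L_def)
        then show ?thesis using passage_attained(2)[OF \<omega> \<psi> L] B0 H unfolding \<sigma>_def by simp
      qed
      have "reach \<phi> t (T, H) (path 0 \<omega>) \<longleftrightarrow> (\<exists>v\<in>{0..t - T}. \<phi> (T + v) - \<phi> T + H \<le> B v \<omega>)"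
        unfolding reach_iff[OF \<phi> continuous_on_path[OF order_refl \<omega>]]
        using Tt T B0 by (auto simp: path_def)
      also have "\<dots> \<longleftrightarrow> \<sigma> + T \<le> t \<and> (\<exists>v\<in>{0..t - (\<sigma> + T)}. \<phi> (\<sigma> + T + v) - \<phi> (\<sigma> + T) + (\<phi> (T + \<sigma>) - \<phi> T + r * \<sigma>) \<le> B (\<sigma> + v) \<omega> - B \<sigma> \<omega>)"
      proof safe
        fix v assume v: "v \<in> {0..t - T}" "\<phi> (T + v) - \<phi> T + H \<le> B v \<omega>"
        \<comment> \<open>The boundary falls no faster than the line, so a path at or above the
          boundary at \<open>v\<close> has met the line by then.\<close>
        have "H - r * v \<le> B v \<omega>" using slope[of T "T + v"] v T by simp
        then obtain s where s: "0 < s" "s \<le> v" "B s \<omega> = H - r * s"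
          using crossing_time[OF paths[OF \<omega>] \<psi>, of v] B0 H v by auto
        then have "\<sigma> \<le> v" unfolding \<sigma>_def using truncated_passage_time_le[OF L, of s B \<omega> ?\<psi>] by simp
        then show "\<sigma> + T \<le> t" using v by simp
        then show "\<exists>v\<in>{0..t - (\<sigma> + T)}. \<phi> (\<sigma> + T + v) - \<phi> (\<sigma> + T) + (\<phi> (T + \<sigma>) - \<phi> T + r * \<sigma>) \<le> B (\<sigma> + v) \<omega> - B \<sigma> \<omega>"
          using v \<open>\<sigma> \<le> v\<close> attained by (intro bexI[of _ "v - \<sigma>"]) (auto simp: add.commute)
      next
        fix v assume "\<sigma> + T \<le> t" "v \<in> {0..t - (\<sigma> + T)}" "\<phi> (\<sigma> + T + v) - \<phi> (\<sigma> + T) + (\<phi> (T + \<sigma>) - \<phi> T + r * \<sigma>) \<le> B (\<sigma> + v) \<omega> - B \<sigma> \<omega>"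
        then show "\<exists>v\<in>{0..t - T}. \<phi> (T + v) - \<phi> T + H \<le> B v \<omega>"
          using attained \<sigma>0 by (intro bexI[of _ "\<sigma> + v"]) (auto simp: add_ac)
      qed
      also have "\<dots> \<longleftrightarrow> reach \<phi> t (update \<phi> r (T, H) \<sigma>) (path \<sigma> \<omega>)"
        unfolding reach_iff[OF \<phi> continuous_on_path[OF \<sigma>0 \<omega>]]
        using T \<sigma>0 by (auto simp: path_def update_def)
      finally show "indicator {w. reach \<phi> t (T, H) w} (path 0 \<omega>)
        = ((\<lambda>z. indicator {w. reach \<phi> t (update \<phi> r (T, H) (fst z)) w} (snd z)) (?\<sigma> \<omega>, path (?\<sigma> \<omega>) \<omega>) :: ennreal)"
        by (simp add: \<sigma>_def[symmetric] indicator_def)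
    qed
  qed
  also have "\<dots> = (\<integral>\<^sup>+g. hit_prob \<phi> t (update \<phi> r (T, H) g) \<partial>distr M borel ?\<sigma>)"
    by (subst nn_integral_strong_markov[OF opt F]) (simp add: hit_prob_def)
  also have "\<dots> = (\<integral>\<^sup>+g. hit_prob \<phi> t (update \<phi> r (T, H) (min g L)) \<partial>?I)"
    unfolding distr_line_passage[OF H r L] by (subst nn_integral_distr) measurable
  \<comment> \<open>Where \<open>min g L\<close> differs from \<open>g\<close>, both updates lie
    past \<open>t\<close> and both hitting probabilities are \<open>0\<close>.\<close>
  also have "\<dots> = (\<integral>\<^sup>+g. hit_prob \<phi> t (update \<phi> r (T, H) g) \<partial>?I)"
    by (intro nn_integral_cong) (auto simp: min_def hit_prob_eq_0 update_def L_def)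
  finally show ?thesis ..
qed

lemma std_cdf_le: "0 \<le> x \<Longrightarrow> std_cdf x \<le> 1 / 2 + x / sqrt (2 * pi)"
proof -
  assume x: "0 \<le> x"
  have half: "std_cdf 0 = 1 / 2" using std_cdf_symmetric[of 0] by simp
  have "std_cdf x - x / sqrt (2 * pi) \<le> std_cdf 0 - 0 / sqrt (2 * pi)"
  proof (rule DERIV_nonpos_imp_nonincreasing[OF x])
    fix y :: real
    have "((\<lambda>x. std_cdf x - x / sqrt (2 * pi)) has_real_derivative std_normal_density y - 1 / sqrt (2 * pi)) (at y)"
      unfolding std_cdf_def by (intro DERIV_diff DERIV_cdf_std_normal DERIV_cdivide DERIV_ident)
    moreover have "std_normal_density y - 1 / sqrt (2 * pi) \<le> 0"
      by (simp add: std_normal_density_def divide_right_mono)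
    ultimately show "\<exists>z. ((\<lambda>x. std_cdf x - x / sqrt (2 * pi)) has_real_derivative z) (at y) \<and> z \<le> 0" by blast
  qed
  then show ?thesis using half by simp
qed

text \<open>During time \<open>\<epsilon>\<close> the boundary rises by at most
  \<open>\<rho> * \<epsilon>\<close>, so reaching the constant level
  \<open>a = (1 + \<rho>) * \<epsilon>\<close> within \<open>\<epsilon>\<close> suffices. The
  reflection principle gives this probability, and the linear bound \<open>std_cdf_le\<close> turns
  it into the error term.\<close>

lemma hit_prob_ge:
  assumes \<phi>: "continuous_on {0..} \<phi>" and slope: "\<And>s t. 0 \<le> s \<Longrightarrow> s \<le> t \<Longrightarrow> \<phi> t - \<phi> s \<le> \<rho> * (t - s)" "0 \<le> \<rho>"
    and \<epsilon>: "0 < \<epsilon>" and T: "0 \<le> T" "T \<le> t - \<epsilon>" and H: "H \<le> \<epsilon>"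
  shows "ennreal (1 - (1 + \<rho>) * sqrt (2 * \<epsilon> / pi)) \<le> hit_prob \<phi> t (T, H)"
proof -
  define a where "a = (1 + \<rho>) * \<epsilon>"
  have a: "0 < a" using \<epsilon> slope by (simp add: a_def add_pos_nonneg)
  \<comment> \<open>\<open>0 * s\<close> presents the constant level as a line of slope
    \<open>0\<close>, the form of \<open>line_passage_cdf\<close>.\<close>
  let ?\<psi> = "\<lambda>s :: real. a - 0 * s"
  let ?\<sigma> = "truncated_passage_time B ?\<psi> (\<epsilon> + 1)"
  have L: "0 < \<epsilon> + 1" using \<epsilon> by simp
  have \<psi>: "continuous_on {0..} ?\<psi>" by (intro continuous_intros)
  have "a / sqrt \<epsilon> = (1 + \<rho>) * sqrt \<epsilon>" using \<epsilon> by (simp add: a_def real_div_sqrt flip: times_divide_eq_right)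
  then have "line_hit_cdf a 0 \<epsilon> = 2 * (1 - std_cdf ((1 + \<rho>) * sqrt \<epsilon>))" by (simp add: line_hit_cdf_def)
  moreover have "std_cdf ((1 + \<rho>) * sqrt \<epsilon>) \<le> 1 / 2 + ((1 + \<rho>) * sqrt \<epsilon>) / sqrt (2 * pi)"
    using \<epsilon> slope by (intro std_cdf_le) auto
  moreover have "2 * (((1 + \<rho>) * sqrt \<epsilon>) / sqrt (2 * pi)) = (1 + \<rho>) * sqrt (2 * \<epsilon> / pi)"
  proof -
    have eq: "2 * (sqrt \<epsilon> / sqrt (2 * pi)) = sqrt (2 * \<epsilon> / pi)"
    proof -
      have "2 * \<epsilon> / pi = 2\<^sup>2 * (\<epsilon> / (2 * pi))" by (simp add: power2_eq_square)
      then show ?thesis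
        by (simp only: real_sqrt_mult[of "2\<^sup>2"] real_sqrt_divide[of \<epsilon>] real_sqrt_abs abs_numeral)
    qed
    have "2 * (((1 + \<rho>) * sqrt \<epsilon>) / sqrt (2 * pi)) = (1 + \<rho>) * (2 * (sqrt \<epsilon> / sqrt (2 * pi)))" by simp
    then show ?thesis by (simp only: eq)
  qed
  moreover have "1 - z \<le> x" if "x = 2 * (1 - S)" "S \<le> 1 / 2 + y" "2 * y = z" for x y z S :: real
    using that by (simp add: algebra_simps)
  ultimately have "1 - (1 + \<rho>) * sqrt (2 * \<epsilon> / pi) \<le> line_hit_cdf a 0 \<epsilon>" by blast
  then have "ennreal (1 - (1 + \<rho>) * sqrt (2 * \<epsilon> / pi)) \<le> emeasure M {\<omega>\<in>space M. ?\<sigma> \<omega> \<le> \<epsilon>}"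
    using line_passage_cdf[OF a order_refl \<epsilon>, of "\<epsilon> + 1"] by (simp add: ennreal_leI)
  also have "\<dots> = (\<integral>\<^sup>+\<omega>. indicator {\<omega>\<in>space M. ?\<sigma> \<omega> \<le> \<epsilon>} \<omega> \<partial>M)"
    using measurable_optional_time[OF optional_time_truncated_passage[OF \<psi> L]]
    by (intro nn_integral_indicator[symmetric]) measurable
  also have "\<dots> \<le> hit_prob \<phi> t (T, H)"
    unfolding hit_prob_def
  proof (rule nn_integral_mono_AE)
    show "AE \<omega> in M. indicator {\<omega>\<in>space M. ?\<sigma> \<omega> \<le> \<epsilon>} \<omega> \<le> (indicator {w. reach \<phi> t (T, H) w} (path 0 \<omega>) :: ennreal)"
      using start AE_space
    proof eventually_elim
      fix \<omega> assume B0: "B 0 \<omega> = 0" and \<omega>: "\<omega> \<in> space M"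
      have "reach \<phi> t (T, H) (path 0 \<omega>)" if "?\<sigma> \<omega> \<le> \<epsilon>"
      proof -
        define \<sigma> where "\<sigma> = ?\<sigma> \<omega>"
        have \<sigma>: "0 < \<sigma>" "B \<sigma> \<omega> = a" "\<sigma> \<le> \<epsilon>"
          using passage_attained[OF \<omega> \<psi> L] B0 a that by (auto simp: \<sigma>_def)
        have "\<phi> (T + \<sigma>) - \<phi> T + H \<le> \<rho> * \<sigma> + \<epsilon>" using slope(1)[of T "T + \<sigma>"] T \<sigma> H by simp
        also have "\<dots> \<le> \<rho> * \<epsilon> + \<epsilon>" using \<sigma> slope by (intro add_right_mono mult_left_mono)
        also have "\<dots> = B \<sigma> \<omega>" using \<sigma> by (simp add: a_def algebra_simps)
        finally show ?thesis
          unfolding reach_iff[OF \<phi> continuous_on_path[OF order_refl \<omega>]]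
          using T \<sigma> \<epsilon> B0 by (auto simp: path_def intro!: bexI[of _ \<sigma>])
      qed
      then show "indicator {\<omega>\<in>space M. ?\<sigma> \<omega> \<le> \<epsilon>} \<omega> \<le> (indicator {w. reach \<phi> t (T, H) w} (path 0 \<omega>) :: ennreal)"
        by (auto simp: indicator_def)
    qed
  qed
  finally show ?thesis .
qed

text \<open>For \<open>t < K\<close> the truncation is invisible; since the path starts below the
  boundary, being at or above it at some time up to \<open>t\<close> is the same as hitting it by
  \<open>t\<close>.\<close>

lemma passage_law_eq_hit_prob:
  assumes \<phi>: "continuous_on {0..} \<phi>" "0 < \<phi> 0" and K: "0 < K" and t: "0 \<le> t" "t < K"
  shows "ennreal (cdf (passage_law M B \<phi> K) t) = hit_prob \<phi> t (0, \<phi> 0)"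
proof -
  let ?\<tau> = "truncated_passage_time B \<phi> K"
  note [measurable] = measurable_optional_time[OF optional_time_truncated_passage[OF \<phi>(1) K]]
  have "ennreal (cdf (passage_law M B \<phi> K) t) = emeasure M {\<omega>\<in>space M. ?\<tau> \<omega> \<le> t}"
    by (simp add: cdf_def passage_law_def measure_distr emeasure_eq_measure vimage_def Int_def conj_commute)
  also have "\<dots> = (\<integral>\<^sup>+\<omega>. indicator {\<omega>\<in>space M. ?\<tau> \<omega> \<le> t} \<omega> \<partial>M)"
    by (intro nn_integral_indicator[symmetric]) measurable
  also have "\<dots> = hit_prob \<phi> t (0, \<phi> 0)"
    unfolding hit_prob_def
  proof (rule nn_integral_cong_AE)
    show "AE \<omega> in M. indicator {\<omega>\<in>space M. ?\<tau> \<omega> \<le> t} \<omega> = (indicator {w. reach \<phi> t (0, \<phi> 0) w} (path 0 \<omega>) :: ennreal)"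
      using start AE_space
    proof eventually_elim
      fix \<omega> assume B0: "B 0 \<omega> = 0" and \<omega>: "\<omega> \<in> space M"
      have "reach \<phi> t (0, \<phi> 0) (path 0 \<omega>) \<longleftrightarrow> (\<exists>v\<in>{0..t}. \<phi> v \<le> B v \<omega>)"
        unfolding reach_iff[OF \<phi>(1) continuous_on_path[OF order_refl \<omega>]]
        using t B0 by (auto simp: path_def)
      also have "\<dots> \<longleftrightarrow> ?\<tau> \<omega> \<le> t"
      proof
        assume "\<exists>v\<in>{0..t}. \<phi> v \<le> B v \<omega>"
        then obtain v where "v \<in> {0..t}" "\<phi> v \<le> B v \<omega>" by blast
        moreover then obtain s where "0 < s" "s \<le> v" "B s \<omega> = \<phi> s"
          using crossing_time[OF paths[OF \<omega>] \<phi>(1), of v] B0 \<phi>(2) by auto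
        ultimately show "?\<tau> \<omega> \<le> t" using truncated_passage_time_le[OF K, of s B \<omega> \<phi>] by simp
      next
        assume "?\<tau> \<omega> \<le> t"
        then show "\<exists>v\<in>{0..t}. \<phi> v \<le> B v \<omega>"
          using passage_attained[OF \<omega> \<phi>(1) K] B0 \<phi>(2) t by (intro bexI[of _ "?\<tau> \<omega>"]) auto
      qed
      finally show "indicator {\<omega>\<in>space M. ?\<tau> \<omega> \<le> t} \<omega> = (indicator {w. reach \<phi> t (0, \<phi> 0) w} (path 0 \<omega>) :: ennreal)"
        using \<omega> by (simp add: indicator_def)
    qed
  qed
  finally show ?thesis .
qed

end

section \<open>Comparison of the two laws\<close>

lemma outcome_time_le: "outcome_time \<epsilon> K x \<le> K"
  by (simp add: outcome_time_def split: enat.split)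

text \<open>Once the loop condition fails the state never changes, so any later index shows the
  final state. This allows evaluation at a fixed \<open>n\<close> instead of the random number of
  iterations.\<close>

lemma outcome_time_not_running:
  assumes frozen: "\<And>n. \<not> running \<epsilon> K (x n) \<Longrightarrow> x (Suc n) = x n" and n: "\<not> running \<epsilon> K (x n)"
  shows "outcome_time \<epsilon> K x = min (fst (x n)) K"
proof -
  define N where "N = (LEAST n. \<not> running \<epsilon> K (x n))"
  have N: "\<not> running \<epsilon> K (x N)" "N \<le> n"
    unfolding N_def using n by (rule LeastI, rule Least_le)
  have const: "x k = x N" if "N \<le> k" for k
    using that
  proof (induction rule: dec_induct)
    case (step k)
    from N(1) have "\<not> running \<epsilon> K (x k)" unfolding step.IH .
    from frozen[OF this] show ?case unfolding step.IH .
  qed (rule refl)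
  from const[OF N(2)] have "x n = x N" .
  moreover have "iterations \<epsilon> K x = enat N"
    unfolding iterations_def
  proof (rule antisym)
    show "Inf {enat n | n. \<not> running \<epsilon> K (x n)} \<le> enat N" using N(1) by (intro Inf_lower) auto
    show "enat N \<le> Inf {enat n | n. \<not> running \<epsilon> K (x n)}"
      unfolding N_def by (intro Inf_greatest) (auto intro: Least_le)
  qed
  ultimately show ?thesis unfolding outcome_time_def by (simp only: enat.case)
qed

section \<open>Almost sure behaviour and termination of the algorithm\<close>

context
  fixes \<phi> :: "real \<Rightarrow> real" and \<rho>p \<rho>m \<epsilon> K r :: real
  assumes \<phi>: "bounded_derivative \<phi> \<rho>p \<rho>m" and \<phi>0: "0 < \<phi> 0" and K: "0 < K" and r: "\<rho>m < r" and \<epsilon>: "0 < \<epsilon>"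
begin

lemma algorithm_params: "0 < \<epsilon>" "0 < r" "continuous_on {0..} \<phi>"
  using bounded_derivativeD[OF \<phi>] r \<epsilon> by auto

text \<open>The strict inequality \<open>\<rho>m < r\<close> makes the distance positive after a
  step of positive duration. The signs supply, along the chain, the hypotheses of
  \<open>hit_prob_renewal\<close> and \<open>hit_prob_ge\<close>.\<close>

lemma AE_trajectory_valid: "AE x in trajectory_law \<phi> \<epsilon> K r. \<forall>n. 0 \<le> fst (x n) \<and> 0 < snd (x n)"
proof -
  let ?T = "trajectory_law \<phi> \<epsilon> K r"
  let ?V = "\<lambda>s :: real \<times> real. 0 \<le> fst s \<and> 0 < snd s"
  note [measurable] = borel_measurable_fst_snd
  note [measurable] = measurable_update_at[OF algorithm_params(3)]
  have kernel: "AE y in step_kernel \<phi> \<epsilon> K r s. ?V s \<longrightarrow> ?V y" for s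
  proof (cases "running \<epsilon> K s")
    case False
    then have eq: "step_kernel \<phi> \<epsilon> K r s = return borel s" by (simp add: step_kernel_def)
    show ?thesis unfolding eq by (subst AE_return) auto
  next
    case True
    then have eq: "step_kernel \<phi> \<epsilon> K r s = distr (inverse_gaussian (snd s / r) ((snd s)\<^sup>2)) borel (update \<phi> r s)"
      by (simp add: step_kernel_def)
    have "AE g in inverse_gaussian (snd s / r) ((snd s)\<^sup>2). ?V s \<longrightarrow> ?V (update \<phi> r s g)"
      using AE_inverse_gaussian_pos
    proof eventually_elim
      fix g :: real assume g: "0 < g"
      have "0 < \<phi> (fst s + g) - \<phi> (fst s) + r * g" if "0 \<le> fst s"
      proof -
        have "- (\<rho>m * g) \<le> \<phi> (fst s + g) - \<phi> (fst s)"
          using bounded_derivativeD(5)[OF \<phi>, of "fst s" "fst s + g"] that g by simp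
        moreover have "\<rho>m * g < r * g" using r g by simp
        ultimately show ?thesis by linarith
      qed
      then show "?V s \<longrightarrow> ?V (update \<phi> r s g)" using g by (auto simp: update_def)
    qed
    then show ?thesis unfolding eq by (subst AE_distr_iff) auto
  qed
  have "AE x in ?T. ?V (x 0)"
    using \<phi>0 by (intro AE_trajectory_law_0[OF algorithm_params]) auto
  moreover have "AE x in ?T. \<forall>n. ?V (x n) \<longrightarrow> ?V (x (Suc n))"
    unfolding AE_all_countable by (intro allI AE_trajectory_law_step[OF algorithm_params] kernel) measurable
  ultimately show ?thesis
  proof eventually_elim
    fix x :: "nat \<Rightarrow> real \<times> real" assume "?V (x 0)" "\<forall>n. ?V (x n) \<longrightarrow> ?V (x (Suc n))"
    then have "?V (x n)" for n by (induction n) auto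
    then show "\<forall>n. ?V (x n)" by blast
  qed
qed

text \<open>Almost sure termination: the probabilities are summable by \<open>running_bound\<close>
  with \<open>R = r + \<rho>p\<close>.\<close>

lemma running_tendsto_0: "(\<lambda>n. measure (trajectory_law \<phi> \<epsilon> K r) {x. running \<epsilon> K (x n)}) \<longlonglongrightarrow> 0"
proof -
  interpret T: prob_space "trajectory_law \<phi> \<epsilon> K r" by (rule prob_space_trajectory_law[OF algorithm_params])
  obtain C u0 :: real where "running_bound C u0"
    by (rule sum_running_bound)
  note bound = running_boundD[OF this]
  have "(\<Sum>n. emeasure (trajectory_law \<phi> \<epsilon> K r) {x. running \<epsilon> K (x n)})
      \<le> ennreal (C * (1 + (r + \<rho>p)\<^sup>2 * K + ln (2 * (u0 + \<bar>ln ((r + \<rho>p) * \<epsilon>)\<bar>))))"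
    using bounded_derivativeD[OF \<phi>] algorithm_params K
    by (intro bound update_le_slope) auto
  then have "(\<Sum>n. ennreal (measure (trajectory_law \<phi> \<epsilon> K r) {x. running \<epsilon> K (x n)})) \<noteq> \<top>"
    by (auto simp: T.emeasure_eq_measure top_unique)
  then show ?thesis by (intro summable_LIMSEQ_zero summable_suminf_not_top) auto
qed

lemma cdf_outcome_law: "cdf (outcome_law \<phi> \<epsilon> K r) t = measure (trajectory_law \<phi> \<epsilon> K r) {x. outcome_time \<epsilon> K x \<le> t}"
proof -
  have "outcome_time \<epsilon> K \<in> borel_measurable (trajectory_law \<phi> \<epsilon> K r)"
    by (simp add: measurable_cong_sets[OF sets_trajectory_law[OF algorithm_params] refl] measurable_outcome_time)
  then show ?thesis
    by (simp add: cdf_def outcome_law_def measure_distr space_trajectory_law[OF algorithm_params] vimage_def)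
qed

lemma sets_outcome_time_le: "{x. outcome_time \<epsilon> K x \<le> t} \<in> sets (trajectory_law \<phi> \<epsilon> K r)"
proof -
  have "{x \<in> space (PiM UNIV (\<lambda>_. borel)). outcome_time \<epsilon> K x \<le> t} \<in> sets (PiM UNIV (\<lambda>_. borel))"
    using measurable_outcome_time by measurable
  then show ?thesis by (simp add: sets_trajectory_law[OF algorithm_params] space_PiM)
qed

lemma cdf_outcome_law_bounds:
  "0 \<le> cdf (outcome_law \<phi> \<epsilon> K r) t" "cdf (outcome_law \<phi> \<epsilon> K r) t \<le> 1"
  "K \<le> t \<Longrightarrow> cdf (outcome_law \<phi> \<epsilon> K r) t = 1" "t < 0 \<Longrightarrow> cdf (outcome_law \<phi> \<epsilon> K r) t = 0"
proof -
  interpret T: prob_space "trajectory_law \<phi> \<epsilon> K r" by (rule prob_space_trajectory_law[OF algorithm_params])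
  show "0 \<le> cdf (outcome_law \<phi> \<epsilon> K r) t" "cdf (outcome_law \<phi> \<epsilon> K r) t \<le> 1"
    by (simp_all add: cdf_outcome_law)
  show "cdf (outcome_law \<phi> \<epsilon> K r) t = 1" if "K \<le> t"
  proof -
    have "{x. outcome_time \<epsilon> K x \<le> t} = space (trajectory_law \<phi> \<epsilon> K r)"
      using that by (auto simp: space_trajectory_law[OF algorithm_params] intro: order_trans[OF outcome_time_le])
    then show ?thesis using T.prob_space by (simp add: cdf_outcome_law)
  qed
  show "cdf (outcome_law \<phi> \<epsilon> K r) t = 0" if "t < 0"
    unfolding cdf_outcome_law
  proof (subst T.prob_eq_0[OF sets_outcome_time_le])
    show "AE x in trajectory_law \<phi> \<epsilon> K r. x \<notin> {x. outcome_time \<epsilon> K x \<le> t}"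
      using AE_trajectory_valid
    proof eventually_elim
      fix x :: "nat \<Rightarrow> real \<times> real" assume "\<forall>n. 0 \<le> fst (x n) \<and> 0 < snd (x n)"
      then have "0 \<le> outcome_time \<epsilon> K x" using K by (simp add: outcome_time_def split: enat.split)
      then show "x \<notin> {x. outcome_time \<epsilon> K x \<le> t}" using that by auto
    qed
  qed
qed

end

section \<open>Inequalities between the distribution functions, and convergence\<close>

context standard_brownian_motion
begin

context
  fixes \<phi> :: "real \<Rightarrow> real" and \<rho>p \<rho>m \<epsilon> K r :: real
  assumes \<phi>: "bounded_derivative \<phi> \<rho>p \<rho>m" and \<phi>0: "0 < \<phi> 0" and K: "0 < K" and r: "\<rho>m < r" and \<epsilon>: "0 < \<epsilon>"
begin

lemmas hyps = \<phi> \<phi>0 K r \<epsilon>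
lemmas params = algorithm_params[OF hyps]

text \<open>\<open>hit_prob\<close> behaves like a martingale along the chain: running states are
  treated by \<open>hit_prob_renewal\<close>, and at frozen states nothing changes.\<close>

lemma hit_prob_trajectory: "(\<integral>\<^sup>+x. hit_prob \<phi> t (x n) \<partial>trajectory_law \<phi> \<epsilon> K r) = hit_prob \<phi> t (0, \<phi> 0)"
proof (induction n)
  case 0
  show ?case by (rule nn_integral_trajectory_law_0[OF params measurable_hit_prob[OF params(3)]])
next
  case (Suc n)
  have [measurable]: "hit_prob \<phi> t \<in> borel_measurable borel" by (rule measurable_hit_prob[OF params(3)])
  note [measurable] = measurable_update_at[OF params(3)]
  have slope: "- (r * (t - s)) \<le> \<phi> t - \<phi> s" if "0 \<le> s" "s \<le> t" for s t
    using bounded_derivativeD(5)[OF \<phi> that] mult_right_mono[of \<rho>m r "t - s"] r that by simp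
  have "(\<integral>\<^sup>+x. hit_prob \<phi> t (x (Suc n)) \<partial>trajectory_law \<phi> \<epsilon> K r)
    = (\<integral>\<^sup>+x. (\<integral>\<^sup>+y. hit_prob \<phi> t y \<partial>step_kernel \<phi> \<epsilon> K r (x n)) \<partial>trajectory_law \<phi> \<epsilon> K r)"
    by (rule nn_integral_trajectory_law_Suc[OF params]) simp
  also have "\<dots> = (\<integral>\<^sup>+x. hit_prob \<phi> t (x n) \<partial>trajectory_law \<phi> \<epsilon> K r)"
  proof (rule nn_integral_cong_AE)
    show "AE x in trajectory_law \<phi> \<epsilon> K r. (\<integral>\<^sup>+y. hit_prob \<phi> t y \<partial>step_kernel \<phi> \<epsilon> K r (x n)) = hit_prob \<phi> t (x n)"
      using AE_trajectory_valid[OF hyps]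
    proof eventually_elim
      fix x :: "nat \<Rightarrow> real \<times> real" assume "\<forall>n. 0 \<le> fst (x n) \<and> 0 < snd (x n)"
      then have valid: "0 \<le> fst (x n)" "0 < snd (x n)" by auto
      show "(\<integral>\<^sup>+y. hit_prob \<phi> t y \<partial>step_kernel \<phi> \<epsilon> K r (x n)) = hit_prob \<phi> t (x n)"
      proof (cases "running \<epsilon> K (x n)")
        case True
        then have "(\<integral>\<^sup>+y. hit_prob \<phi> t y \<partial>step_kernel \<phi> \<epsilon> K r (x n))
          = (\<integral>\<^sup>+g. hit_prob \<phi> t (update \<phi> r (x n) g) \<partial>inverse_gaussian (snd (x n) / r) ((snd (x n))\<^sup>2))"
          by (simp add: step_kernel_def) (subst nn_integral_distr; simp)
        also have "\<dots> = hit_prob \<phi> t (x n)"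
          using hit_prob_renewal[OF params(3) slope params(2) valid, of t] by simp
        finally show ?thesis .
      qed (simp add: step_kernel_def nn_integral_return)
    qed
  qed
  finally show ?case using Suc.IH by simp
qed

lemma cdf_passage_law_bounds:
  "0 \<le> cdf (passage_law M B \<phi> K) t" "cdf (passage_law M B \<phi> K) t \<le> 1"
  "K \<le> t \<Longrightarrow> cdf (passage_law M B \<phi> K) t = 1" "t < 0 \<Longrightarrow> cdf (passage_law M B \<phi> K) t = 0"
proof -
  note [measurable] = measurable_optional_time[OF optional_time_truncated_passage[OF params(3) K]]
  have eq: "cdf (passage_law M B \<phi> K) t = prob {\<omega>\<in>space M. truncated_passage_time B \<phi> K \<omega> \<le> t}"
    by (simp add: cdf_def passage_law_def measure_distr vimage_def Int_def conj_commute)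
  show "0 \<le> cdf (passage_law M B \<phi> K) t" "cdf (passage_law M B \<phi> K) t \<le> 1" by (simp_all add: eq)
  show "cdf (passage_law M B \<phi> K) t = 1" if "K \<le> t"
  proof -
    have all: "{\<omega>\<in>space M. truncated_passage_time B \<phi> K \<omega> \<le> t} = space M"
      using that by (auto intro: order_trans[OF truncated_passage_time_bounds(2)[OF K]])
    show ?thesis unfolding eq all by (rule prob_space)
  qed
  show "cdf (passage_law M B \<phi> K) t = 0" if "t < 0"
  proof -
    have none: "{\<omega>\<in>space M. truncated_passage_time B \<phi> K \<omega> \<le> t} = {}"
      using that truncated_passage_time_bounds(1)[OF K, of B \<phi>] by (auto simp: not_le intro: less_le_trans)
    show ?thesis unfolding eq none by simp
  qed
qed

text \<open>At a stopped state with time beyond \<open>t\<close> the boundary cannot be hit by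
  \<open>t\<close>, so \<open>hit_prob\<close> is at most the indicator of
  \<open>outcome_time \<epsilon> K x \<le> t\<close>. States still running at \<open>n\<close> cost
  at most \<open>p n\<close>, which vanishes in the limit.\<close>

lemma cdf_passage_le_outcome: "cdf (passage_law M B \<phi> K) t \<le> cdf (outcome_law \<phi> \<epsilon> K r) t"
proof -
  consider "t < 0" | "K \<le> t" | "0 \<le> t" "t < K" by linarith
  then show ?thesis
  proof cases
    case 3
    let ?T = "trajectory_law \<phi> \<epsilon> K r"
    interpret T: prob_space ?T by (rule prob_space_trajectory_law[OF params])
    define p where "p n = measure ?T {x. running \<epsilon> K (x n)}" for n
    note meas = sets_outcome_time_le[OF hyps] sets_running[OF params]
    have "cdf (passage_law M B \<phi> K) t \<le> cdf (outcome_law \<phi> \<epsilon> K r) t + p n" for n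
    proof -
      have "ennreal (cdf (passage_law M B \<phi> K) t) = (\<integral>\<^sup>+x. hit_prob \<phi> t (x n) \<partial>?T)"
        unfolding hit_prob_trajectory by (rule passage_law_eq_hit_prob[OF params(3) \<phi>0 K 3])
      also have "\<dots> \<le> (\<integral>\<^sup>+x. indicator {x. outcome_time \<epsilon> K x \<le> t} x + indicator {x. running \<epsilon> K (x n)} x \<partial>?T)"
      proof (rule nn_integral_mono_AE)
        show "AE x in ?T. hit_prob \<phi> t (x n) \<le> indicator {x. outcome_time \<epsilon> K x \<le> t} x + indicator {x. running \<epsilon> K (x n)} x"
          using AE_trajectory_law_frozen[OF params]
        proof eventually_elim
          fix x :: "nat \<Rightarrow> real \<times> real" assume frozen: "\<forall>n. \<not> running \<epsilon> K (x n) \<longrightarrow> x (Suc n) = x n"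
          show "hit_prob \<phi> t (x n) \<le> indicator {x. outcome_time \<epsilon> K x \<le> t} x + indicator {x. running \<epsilon> K (x n)} x"
          proof (cases "running \<epsilon> K (x n)")
            case True
            have "hit_prob \<phi> t (x n) \<le> 1"
              using hit_prob_le[of \<phi> t "x n"] by (auto simp: indicator_def split: if_splits intro: order_trans)
            then show ?thesis using True by (simp add: add_increasing)
          next
            case False
            then have "outcome_time \<epsilon> K x = min (fst (x n)) K"
              using frozen by (intro outcome_time_not_running) auto
            then show ?thesis
              using False hit_prob_le[of \<phi> t "x n"] hit_prob_eq_0[of t "x n" \<phi>]
              by (cases "fst (x n) \<le> t") (auto simp: indicator_def not_le min_le_iff_disj)
          qed
        qed
      qed
      also have "\<dots> = ennreal (cdf (outcome_law \<phi> \<epsilon> K r) t + p n)"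
        using meas by (simp add: nn_integral_add cdf_outcome_law[OF hyps] p_def T.emeasure_eq_measure)
      finally show ?thesis
        using cdf_outcome_law_bounds(1)[OF hyps, of t] by (subst (asm) ennreal_le_iff) (auto simp: p_def)
    qed
    moreover have "(\<lambda>n. cdf (outcome_law \<phi> \<epsilon> K r) t + p n) \<longlonglongrightarrow> cdf (outcome_law \<phi> \<epsilon> K r) t + 0"
      unfolding p_def by (intro tendsto_add tendsto_const running_tendsto_0[OF hyps])
    ultimately show ?thesis by (intro LIMSEQ_le_const[of _ "cdf (outcome_law \<phi> \<epsilon> K r) t"]) auto
  qed (use cdf_passage_law_bounds cdf_outcome_law_bounds[OF hyps] in auto)
qed

text \<open>If \<open>t < K\<close>, a stopped outcome by \<open>t - \<epsilon>\<close> can only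
  come from \<open>H \<le> \<epsilon>\<close>, and then the boundary is hit by \<open>t\<close> with
  probability at least \<open>1 - c\<close>.\<close>

lemma cdf_outcome_le_passage:
  assumes t: "\<epsilon> \<le> t"
  shows "cdf (outcome_law \<phi> \<epsilon> K r) (t - \<epsilon>) - (1 + \<rho>p) * sqrt (2 * \<epsilon> / pi) \<le> cdf (passage_law M B \<phi> K) t"
proof -
  note \<phi>D = bounded_derivativeD[OF \<phi>]
  define c where "c = (1 + \<rho>p) * sqrt (2 * \<epsilon> / pi)"
  have c: "0 \<le> c" using \<phi>D(1) \<epsilon> by (simp add: c_def)
  have "cdf (outcome_law \<phi> \<epsilon> K r) (t - \<epsilon>) - c \<le> cdf (passage_law M B \<phi> K) t"
  proof (cases "K \<le> t")
    case True
    then show ?thesis using cdf_passage_law_bounds(3)[OF True] cdf_outcome_law_bounds(2)[OF hyps, of "t - \<epsilon>"] c by simp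
  next
    case False
    let ?T = "trajectory_law \<phi> \<epsilon> K r"
    interpret T: prob_space ?T by (rule prob_space_trajectory_law[OF params])
    define p where "p n = measure ?T {x. running \<epsilon> K (x n)}" for n
    define F where "F = cdf (outcome_law \<phi> \<epsilon> K r) (t - \<epsilon>)"
    note meas = sets_outcome_time_le[OF hyps] sets_running[OF params]
    have hp: "(\<lambda>x. hit_prob \<phi> t (x n)) \<in> borel_measurable ?T" for n
      unfolding measurable_cong_sets[OF sets_trajectory_law[OF params] refl]
      by (rule measurable_compose[OF _ measurable_hit_prob[OF params(3)]]) (rule measurable_component_singleton, simp)
    have F: "0 \<le> F" "F \<le> 1" using cdf_outcome_law_bounds[OF hyps] by (simp_all add: F_def)
    \<comment> \<open>\<open>max 0\<close> because \<open>ennreal (1 - c)\<close> is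
      \<open>0\<close> when \<open>c > 1\<close>.\<close>
    have "max 0 (1 - c) * F \<le> cdf (passage_law M B \<phi> K) t + p n" for n
    proof -
      have "ennreal (max 0 (1 - c) * F) = (\<integral>\<^sup>+x. ennreal (1 - c) * indicator {x. outcome_time \<epsilon> K x \<le> t - \<epsilon>} x \<partial>?T)"
        using meas F by (simp add: nn_integral_cmult_indicator F_def cdf_outcome_law[OF hyps] T.emeasure_eq_measure ennreal_mult max_def ennreal_neg)
      also have "\<dots> \<le> (\<integral>\<^sup>+x. hit_prob \<phi> t (x n) + indicator {x. running \<epsilon> K (x n)} x \<partial>?T)"
      proof (rule nn_integral_mono_AE)
        show "AE x in ?T. ennreal (1 - c) * indicator {x. outcome_time \<epsilon> K x \<le> t - \<epsilon>} x \<le> hit_prob \<phi> t (x n) + indicator {x. running \<epsilon> K (x n)} x"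
          using AE_trajectory_law_frozen[OF params] AE_trajectory_valid[OF hyps]
        proof eventually_elim
          fix x :: "nat \<Rightarrow> real \<times> real"
          assume frozen: "\<forall>n. \<not> running \<epsilon> K (x n) \<longrightarrow> x (Suc n) = x n" and valid: "\<forall>n. 0 \<le> fst (x n) \<and> 0 < snd (x n)"
          show "ennreal (1 - c) * indicator {x. outcome_time \<epsilon> K x \<le> t - \<epsilon>} x \<le> hit_prob \<phi> t (x n) + indicator {x. running \<epsilon> K (x n)} x"
          proof (cases "running \<epsilon> K (x n)")
            case True
            have "ennreal (1 - c) * indicator {x. outcome_time \<epsilon> K x \<le> t - \<epsilon>} x \<le> ennreal 1 * 1"
              using c by (intro mult_mono ennreal_leI) (auto simp: indicator_def)
            then show ?thesis using True by (auto intro: order_trans simp: add_increasing)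
          next
            case not_running: False
            then have out: "outcome_time \<epsilon> K x = min (fst (x n)) K"
              using frozen by (intro outcome_time_not_running) auto
            show ?thesis
            proof (cases "outcome_time \<epsilon> K x \<le> t - \<epsilon>")
              case True
              then have T: "fst (x n) \<le> t - \<epsilon>" using out False \<epsilon> by (auto simp: min_le_iff_disj)
              then have "snd (x n) \<le> \<epsilon>" using not_running False \<epsilon> by (auto simp: running_def)
              then have "ennreal (1 - c) \<le> hit_prob \<phi> t (fst (x n), snd (x n))"
                unfolding c_def using T valid \<phi>D \<epsilon> by (intro hit_prob_ge) auto
              then show ?thesis using True by (simp add: add_increasing2)
            qed simp
          qed
        qed
      qed
      also have "\<dots> = ennreal (cdf (passage_law M B \<phi> K) t) + ennreal (p n)"
        using meas hp passage_law_eq_hit_prob[OF params(3) \<phi>0 K, of t] t \<epsilon> False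
        by (simp add: nn_integral_add hit_prob_trajectory p_def T.emeasure_eq_measure)
      also have "\<dots> = ennreal (cdf (passage_law M B \<phi> K) t + p n)"
        using cdf_passage_law_bounds(1) by (simp add: p_def)
      finally show ?thesis
        using cdf_passage_law_bounds(1)[of t] by (subst (asm) ennreal_le_iff) (auto simp: p_def)
    qed
    moreover have "(\<lambda>n. cdf (passage_law M B \<phi> K) t + p n) \<longlonglongrightarrow> cdf (passage_law M B \<phi> K) t + 0"
      unfolding p_def by (intro tendsto_add tendsto_const running_tendsto_0[OF hyps])
    ultimately have "max 0 (1 - c) * F \<le> cdf (passage_law M B \<phi> K) t"
      by (intro LIMSEQ_le_const[of _ "cdf (passage_law M B \<phi> K) t"]) auto
    \<comment> \<open>Since \<open>F \<le> 1\<close>, the multiplicative loss \<open>c * F\<close>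
      is at most the additive loss \<open>c\<close>.\<close>
    moreover have "F - c \<le> (1 - c) * F" using mult_left_mono[OF F(2) c] by (simp add: algebra_simps)
    moreover have "(1 - c) * F \<le> max 0 (1 - c) * F" using F by (intro mult_right_mono) auto
    ultimately show ?thesis by (simp add: F_def)
  qed
  then show ?thesis by (simp add: c_def)
qed

end

text \<open>Squeezed between \<open>?F x\<close> and \<open>?F (x + e n)\<close> plus a vanishing
  error, the distribution functions converge at every \<open>x\<close> by right-continuity of
  \<open>?F\<close>. Negative \<open>x\<close> are separate because
  \<open>cdf_outcome_le_passage\<close> concerns arguments
  \<open>t - \<epsilon> \<ge> 0\<close>.\<close>

theorem outcome_law_weak_conv:
  assumes \<phi>: "bounded_derivative \<phi> \<rho>p \<rho>m" and \<phi>0: "0 < \<phi> 0" and K: "0 < K" and r: "\<rho>m < r"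
    and e: "\<And>n. 0 < e n" "e \<longlonglongrightarrow> 0"
  shows "weak_conv_m (\<lambda>n. outcome_law \<phi> (e n) K r) (passage_law M B \<phi> K)"
  unfolding weak_conv_m_def weak_conv_def
proof (intro allI impI)
  fix x :: real
  note hyps = \<phi> \<phi>0 K r e(1)
  let ?F = "cdf (passage_law M B \<phi> K)"
  show "(\<lambda>n. cdf (outcome_law \<phi> (e n) K r) x) \<longlonglongrightarrow> ?F x"
  proof (cases "x < 0")
    case True
    then show ?thesis using cdf_outcome_law_bounds(4)[OF hyps True] cdf_passage_law_bounds(4)[OF hyps True] by simp
  next
    case False
    note [measurable] = measurable_optional_time[OF optional_time_truncated_passage[OF bounded_derivativeD(3)[OF \<phi>] K]]
    interpret P: real_distribution "passage_law M B \<phi> K"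
      unfolding passage_law_def by (rule real_distribution_distr) measurable
    show ?thesis
    proof (rule tendsto_sandwich)
      show "eventually (\<lambda>n. ?F x \<le> cdf (outcome_law \<phi> (e n) K r) x) sequentially"
        using cdf_passage_le_outcome[OF hyps] by simp
      show "eventually (\<lambda>n. cdf (outcome_law \<phi> (e n) K r) x \<le> ?F (x + e n) + (1 + \<rho>p) * sqrt (2 * e n / pi)) sequentially"
      proof (intro always_eventually allI)
        fix n
        have "e n \<le> x + e n" using False by simp
        from cdf_outcome_le_passage[OF hyps this]
        show "cdf (outcome_law \<phi> (e n) K r) x \<le> ?F (x + e n) + (1 + \<rho>p) * sqrt (2 * e n / pi)" by simp
      qed
      have "filterlim (\<lambda>n. x + e n) (at_right x) sequentially"
        using e(1) tendsto_add[OF tendsto_const e(2), of x] by (auto simp: filterlim_at less_imp_neq[symmetric])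
      moreover have "(?F \<longlongrightarrow> ?F x) (at_right x)"
        using P.cdf_is_right_cont[of x] by (simp add: continuous_within)
      ultimately have "(\<lambda>n. ?F (x + e n)) \<longlonglongrightarrow> ?F x" by (rule filterlim_compose[rotated])
      moreover have "(\<lambda>n. (1 + \<rho>p) * sqrt (2 * e n / pi)) \<longlonglongrightarrow> (1 + \<rho>p) * sqrt (2 * 0 / pi)"
        by (intro tendsto_intros e) simp
      ultimately show "(\<lambda>n. ?F (x + e n) + (1 + \<rho>p) * sqrt (2 * e n / pi)) \<longlonglongrightarrow> ?F x"
        using tendsto_add by fastforce
    qed simp
  qed
qed

end

theorem theorem2p1:
  shows
    "(\<forall>(M :: 'a measure) B \<phi> \<rho>p \<rho>m K r.
        standard_brownian_motion M B \<longrightarrow>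
        bounded_derivative \<phi> \<rho>p \<rho>m \<longrightarrow> 0 < \<phi> 0 \<longrightarrow> 0 < K \<longrightarrow> \<rho>m < r \<longrightarrow>
        (\<forall>e :: nat \<Rightarrow> real. (\<forall>n. 0 < e n) \<longrightarrow> e \<longlonglongrightarrow> 0 \<longrightarrow>
           weak_conv_m (\<lambda>n. outcome_law \<phi> (e n) K r) (passage_law M B \<phi> K)) \<and>
        (\<forall>\<epsilon>>0. \<forall>t\<ge>\<epsilon>.
           cdf (outcome_law \<phi> \<epsilon> K r) (t - \<epsilon>) - (1 + \<rho>p) * sqrt (2 * \<epsilon> / pi)
             \<le> cdf (passage_law M B \<phi> K) t \<and>
           cdf (passage_law M B \<phi> K) t \<le> cdf (outcome_law \<phi> \<epsilon> K r) t))
     \<and>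
     (\<exists>a>0. \<exists>b>0. \<exists>\<kappa>0>0. \<exists>\<kappa>1>0. \<exists>\<epsilon>0>0.
        \<forall>\<phi> \<rho>p \<rho>m K r.
          bounded_derivative \<phi> \<rho>p \<rho>m \<longrightarrow> 0 < \<phi> 0 \<longrightarrow> 0 < K \<longrightarrow> \<rho>m < r \<longrightarrow>
          \<rho>p \<le> \<kappa>0 \<longrightarrow> (r + \<kappa>0) * K \<le> \<kappa>1 \<longrightarrow>
          (\<forall>\<epsilon>. 0 < \<epsilon> \<longrightarrow> \<epsilon> \<le> \<epsilon>0 \<longrightarrow>
             expected_iterations \<phi> \<epsilon> K r \<le> ennreal ((a + b * r) * \<bar>ln \<epsilon>\<bar>)))
     \<and>
     (\<exists>a>0. \<forall>K>0. \<forall>r>0. \<exists>\<epsilon>0>0.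
        \<forall>\<phi> \<rho>p \<rho>m.
          bounded_derivative \<phi> \<rho>p \<rho>m \<longrightarrow> 0 < \<phi> 0 \<longrightarrow> antimono_on {0..} \<phi> \<longrightarrow> \<rho>m < r \<longrightarrow>
          (\<forall>\<epsilon>. 0 < \<epsilon> \<longrightarrow> \<epsilon> \<le> \<epsilon>0 \<longrightarrow>
             expected_iterations \<phi> \<epsilon> K r \<le> ennreal (a * r\<^sup>2 * K * \<bar>ln \<epsilon>\<bar>)))"

proof (intro conjI expected_iterations_small_slope expected_iterations_antimono allI impI)
  fix M :: "'a measure" and B :: "real \<Rightarrow> 'a \<Rightarrow> real" and \<phi> :: "real \<Rightarrow> real" and \<rho>p \<rho>m K r :: real
  assume "standard_brownian_motion M B"
  then interpret standard_brownian_motion M B .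
  assume hyps: "bounded_derivative \<phi> \<rho>p \<rho>m" "0 < \<phi> 0" "0 < K" "\<rho>m < r"
  show "weak_conv_m (\<lambda>n. outcome_law \<phi> (e n) K r) (passage_law M B \<phi> K)"
    if "\<forall>n. 0 < e n" "e \<longlonglongrightarrow> 0" for e :: "nat \<Rightarrow> real"
    using that by (intro outcome_law_weak_conv[OF hyps]) auto
  fix \<epsilon> t :: real assume \<epsilon>: "0 < \<epsilon>" "\<epsilon> \<le> t"
  show "cdf (outcome_law \<phi> \<epsilon> K r) (t - \<epsilon>) - (1 + \<rho>p) * sqrt (2 * \<epsilon> / pi) \<le> cdf (passage_law M B \<phi> K) t"
    by (rule cdf_outcome_le_passage[OF hyps \<epsilon>])
  show "cdf (passage_law M B \<phi> K) t \<le> cdf (outcome_law \<phi> \<epsilon> K r) t"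
    by (rule cdf_passage_le_outcome[OF hyps \<epsilon>(1)])
qed

end
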